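(* Let $\mathcal{A}$ be an additive strict monoidal category with biadditive tensor product $\circ$ and identity object $\mathbf{1}$, and let $\mathcal{C}$ be an additive category equipped with a strict monoidal action $\lozenge:\mathcal{A}\times\mathcal{C}\to\mathcal{C}$ by additive functors. Then the construct $\star:\mathcal{P}(\mathcal{A})\times\mathcal{P}(\mathcal{C})\to\mathcal{P}(\mathcal{C})$, defined on categories of pyramids in the context, is a strict monoidal action by additive functors of the strict monoidal category $\mathcal{P}(\mathcal{A})$ on $\mathcal{P}(\mathcal{C})$. This action descends to a strict monoidal action $$\star:\mathcal{H}(\mathcal{A})\times\mathcal{H}(\mathcal{C})\to\mathcal{H}(\mathcal{C})$$ on homotopy categories of pyramids.
   Context: **Indices.** $\mathbb{I}$ is the abelian group of all $\mathbf{a}=(a_i)_{i\in\mathbb{N}}$ with $a_i\in\mathbb{Z}$ and $a_i=0$ for $i\gg0$ ($\mathbb{N}=\{1,2,\dots\}$); $\varepsilon_i\in\mathbb{I}$ is the $i$-th standard basis vector; $\mathrm{ht}(\mathbf{a})=\sum_i a_i$; $\mathbb{I}_k=\{\mathbf{a}\in\mathbb{I}:\mathrm{ht}(\mathbf{a})=k\}$. For $k\geq0$, $\pi_k(\mathbf{a})=(a_1,\dots,a_k,0,0,\dots)$ (so $\pi_0(\mathbf{a})=\mathbf{0}$) and $\sigma_k(\mathbf{a})=(a_{k+1},a_{k+2},\dots)$ (so $\sigma_0=\mathrm{id}$). **Pyramids.** A pyramid $(X_\bullet,d_\bullet,n)$ over an additive category $\mathcal{B}$ consists of $n\in\mathbb{Z}_{\geq0}$,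 objects $X_{\mathbf{a}}$ of $\mathcal{B}$ ($\mathbf{a}\in\mathbb{I}$) and morphisms $d_{\mathbf{a},i}:X_{\mathbf{a}}\to X_{\mathbf{a}+\varepsilon_i}$ ($i\in\mathbb{N}$) such that: (I) $X_{\mathbf{a}}=0$ unless $a_i=0$ for all $i>n$; (II) there is $m\in\mathbb{Z}$ with $X_{\mathbf{a}}=0$ unless all $a_i<m$; (III) $d_{\mathbf{a}+\varepsilon_i,i}\circ d_{\mathbf{a},i}=0$; (IV) $d_{\mathbf{a}+\varepsilon_i,j}\circ d_{\mathbf{a},i}=-d_{\mathbf{a}+\varepsilon_j,i}\circ d_{\mathbf{a},j}$. Let $d^{(k)}$ be the matrix with rows indexed by $\mathbf{a}\in\mathbb{I}_{k+1}$, columns by $\mathbf{b}\in\mathbb{I}_k$, and entries $d^{(k)}_{\mathbf{a},\mathbf{b}}=d_{\mathbf{b},i}$ if $\mathbf{a}=\mathbf{b}+\varepsilon_i$, and $0$ otherwise. A morphism $\alpha:(X_\bullet,d_\bullet,n)\to(Y_\bullet,\partial_\bullet,m)$ is a family of matrices $\alpha^{(k)}=(\alpha^{(k)}_{\mathbf{a},\mathbf{b}})_{\mathbf{a},\mathbf{b}\in\mathbb{I}_k}$, $k\in\mathbb{Z}$, with $\alpha^{(k)}_{\mathbf{a},\mathbf{b}}:X_{\mathbf{b}}\to Y_{\mathbf{a}}$, such that $\alpha^{(k+1)}\cdot d^{(k)}=\partial^{(k)}\cdot\alpha^{(k)}$ for all $k$. Composition is matrix multiplication for each $k$; the identity morphism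 $\omega$ has $\omega^{(k)}_{\mathbf{a},\mathbf{b}}=\mathrm{id}_{X_{\mathbf{a}}}$ if $\mathbf{a}=\mathbf{b}$ and $0$ otherwise. This gives the additive category $\mathcal{P}(\mathcal{B})$ (addition of morphisms and direct sums are component-wise). **Homotopy category.** A homotopy $\chi:(X_\bullet,d_\bullet,n)\to(Y_\bullet,\partial_\bullet,m)$ is a family of matrices $\chi^{(k)}$ with entries $\chi^{(k)}_{\mathbf{a},\mathbf{b}}:X_{\mathbf{b}}\to Y_{\mathbf{a}}$, $\mathbf{a}\in\mathbb{I}_{k-1}$, $\mathbf{b}\in\mathbb{I}_k$. A morphism $\alpha$ is null homotopic if $\alpha^{(k)}=\chi^{(k+1)}\cdot d^{(k)}+\partial^{(k-1)}\cdot\chi^{(k)}$ for all $k$ for some homotopy $\chi$. $\mathcal{H}(\mathcal{B})$ is the quotient of $\mathcal{P}(\mathcal{B})$ by the ideal of null homotopic morphisms. **Conventions.** Zero objects are identified with a single object $0$. The action $\lozenge$ is biadditive. **Tensor product on $\mathcal{P}(\mathcal{A})$.** $(X_\bullet,d_\bullet,n)\circ(Y_\bullet,\partial_\bullet,m)=(Z_\bullet,\daleth_\bullet,n+m)$ with $Z_{\mathbf{a}}=X_{\pi_n(\mathbf{a})}\circ Y_{\sigma_n(\mathbf{a})}$ and $\daleth_{\mathbf{a},i}=d_{\pi_n(\mathbf{a}),i}\circ_0\mathrm{id}$ if $i\leq n$, $\daleth_{\mathbf{a},i}=(-1)^{\mathrm{ht}(\pi_n(\mathbf{a}))}\,\mathrm{id}\circ_0\partial_{\sigma_n(\mathbf{a}),i-n}$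 if $i>n$ ($\circ_0$ is the tensor product of morphisms). For $\alpha:(X_\bullet,d_\bullet,n)\to(\tilde X_\bullet,\tilde d_\bullet,\tilde n)$ and $\beta:(Y_\bullet,\partial_\bullet,m)\to(\tilde Y_\bullet,\tilde\partial_\bullet,\tilde m)$, and $\mathbf{a},\mathbf{b}\in\mathbb{I}_k$, $(\alpha\circ_0\beta)^{(k)}_{\mathbf{a},\mathbf{b}}=\alpha^{(l)}_{\pi_{\tilde n}(\mathbf{a}),\pi_n(\mathbf{b})}\circ_0\beta^{(k-l)}_{\sigma_{\tilde n}(\mathbf{a}),\sigma_n(\mathbf{b})}$ if $l=\mathrm{ht}(\pi_{\tilde n}(\mathbf{a}))=\mathrm{ht}(\pi_n(\mathbf{b}))$, and $0$ otherwise. The unit is the pyramid with $n=0$, $X_{\mathbf{0}}=\mathbf{1}$, all other $X_{\mathbf{a}}=0$, and zero differentials. This is a strict monoidal structure on $\mathcal{P}(\mathcal{A})$, inducing one on $\mathcal{H}(\mathcal{A})$. **Definition of $\star$.** For $(X_\bullet,d_\bullet,n)\in\mathcal{P}(\mathcal{A})$ and $(Y_\bullet,\partial_\bullet,m)\in\mathcal{P}(\mathcal{C})$, $(X_\bullet,d_\bullet,n)\star(Y_\bullet,\partial_\bullet,m)=(Z_\bullet,\daleth_\bullet,n+m)\in\mathcal{P}(\mathcal{C})$ with $Z_{\mathbf{a}}=X_{\pi_n(\mathbf{a})}\lozenge Y_{\sigma_n(\mathbf{a})}$ and $\daleth_{\mathbf{a},i}=d_{\pi_n(\mathbf{a}),i}\lozenge\mathrm{id}$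 if $i\leq n$, $\daleth_{\mathbf{a},i}=(-1)^{\mathrm{ht}(\pi_n(\mathbf{a}))}\,\mathrm{id}\lozenge\partial_{\sigma_n(\mathbf{a}),i-n}$ if $i>n$. For a morphism $\beta:(Y_\bullet,\partial_\bullet,m)\to(\tilde Y_\bullet,\tilde\partial_\bullet,\tilde m)$ in $\mathcal{P}(\mathcal{C})$, the morphism $\gamma=(X_\bullet,d_\bullet,n)\star\beta$ has entries, for $\mathbf{a},\mathbf{b}\in\mathbb{I}_k$ and $l=\mathrm{ht}(\pi_n(\mathbf{a}))$, $\gamma^{(k)}_{\mathbf{a},\mathbf{b}}=\omega^{(l)}_{\pi_n(\mathbf{a}),\pi_n(\mathbf{b})}\lozenge\beta^{(k-l)}_{\sigma_n(\mathbf{a}),\sigma_n(\mathbf{b})}$ if also $l=\mathrm{ht}(\pi_n(\mathbf{b}))$, and $0$ otherwise. For a morphism $\alpha:(X_\bullet,d_\bullet,n)\to(\tilde X_\bullet,\tilde d_\bullet,\tilde n)$ in $\mathcal{P}(\mathcal{A})$, the morphism $\eta=\alpha\star(Y_\bullet,\partial_\bullet,m)$ has entries, for $\mathbf{a},\mathbf{b}\in\mathbb{I}_k$ and $l=\mathrm{ht}(\pi_{\tilde n}(\mathbf{a}))$, $\eta^{(k)}_{\mathbf{a},\mathbf{b}}=\alpha^{(l)}_{\pi_{\tilde n}(\mathbf{a}),\pi_n(\mathbf{b})}\lozenge\omega^{(k-l)}_{\sigma_{\tilde n}(\mathbf{a}),\sigma_n(\mathbf{b})}$ if also $l=\mathrm{ht}(\pi_n(\mathbf{b}))$,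 and $0$ otherwise. *)

theory Defs
  imports "HOL-Algebra.Ring" "HOL-Library.Poly_Mapping"
begin

section \<open>Additive categories\<close>

text \<open>
  The addition and the zero morphisms are part of the data. All operations are total functions
  whose values matter only on composable, respectively parallel, arrows.
\<close>

record ('o, 'm) cat =
  Obj :: "'o set"
  Arr :: "'m set"
  Dom :: "'m \<Rightarrow> 'o"
  Cod :: "'m \<Rightarrow> 'o"
  Idn :: "'o \<Rightarrow> 'm"
  Comp :: "'m \<Rightarrow> 'm \<Rightarrow> 'm"
  Add :: "'m \<Rightarrow> 'm \<Rightarrow> 'm"
  Zero :: "'o \<Rightarrow> 'o \<Rightarrow> 'm"

text \<open>
  Only the additive part of this record (used with \<^const>\<open>abelian_group\<close> and \<^const>\<open>finsum\<close>)
  is relevant; the multiplicative part is meaningful for \<open>X = Y\<close> only.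
\<close>

definition Hom :: "('o, 'm) cat \<Rightarrow> 'o \<Rightarrow> 'o \<Rightarrow> 'm ring" where
  "Hom C X Y = \<lparr>carrier = {f \<in> Arr C. Dom C f = X \<and> Cod C f = Y},
     mult = Comp C, one = Idn C X, zero = Zero C X Y, add = Add C\<rparr>"

definition neg :: "('o, 'm) cat \<Rightarrow> 'm \<Rightarrow> 'm" where
  "neg C f = \<ominus>\<^bsub>Hom C (Dom C f) (Cod C f)\<^esub> f"

definition zero_object :: "('o, 'm) cat \<Rightarrow> 'o \<Rightarrow> bool" where
  "zero_object C Z \<longleftrightarrow> Z \<in> Obj C \<and>
     (\<forall>X\<in>Obj C. (\<exists>!f. f \<in> carrier (Hom C X Z)) \<and> (\<exists>!f. f \<in> carrier (Hom C Z X)))"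

definition single_zero_object :: "('o, 'm) cat \<Rightarrow> bool" where
  "single_zero_object C \<longleftrightarrow> (\<exists>!Z. zero_object C Z)"

definition the_zero_object :: "('o, 'm) cat \<Rightarrow> 'o" where
  "the_zero_object C = (THE Z. zero_object C Z)"

definition is_biproduct ::
  "('o, 'm) cat \<Rightarrow> 'o \<Rightarrow> 'o \<Rightarrow> 'o \<Rightarrow> 'm \<Rightarrow> 'm \<Rightarrow> 'm \<Rightarrow> 'm \<Rightarrow> bool" where
  "is_biproduct C X Y S i j p q \<longleftrightarrow> S \<in> Obj C \<and>
     i \<in> carrier (Hom C X S) \<and> j \<in> carrier (Hom C Y S) \<and>
     p \<in> carrier (Hom C S X) \<and> q \<in> carrier (Hom C S Y) \<and>
     Comp C p i = Idn C X \<and> Comp C q j = Idn C Y \<and>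
     Comp C q i = Zero C X Y \<and> Comp C p j = Zero C Y X \<and>
     Add C (Comp C i p) (Comp C j q) = Idn C S"

locale category =
  fixes C :: "('o, 'm) cat"
  assumes Dom_closed: "f \<in> Arr C \<Longrightarrow> Dom C f \<in> Obj C"
    and Cod_closed: "f \<in> Arr C \<Longrightarrow> Cod C f \<in> Obj C"
    and Idn_closed: "X \<in> Obj C \<Longrightarrow> Idn C X \<in> carrier (Hom C X X)"
    and Comp_closed: "\<lbrakk>f \<in> carrier (Hom C X Y); g \<in> carrier (Hom C Y Z)\<rbrakk>
          \<Longrightarrow> Comp C g f \<in> carrier (Hom C X Z)"
    and Comp_Idn: "f \<in> carrier (Hom C X Y) \<Longrightarrow> Comp C f (Idn C X) = f"
    and Idn_Comp: "f \<in> carrier (Hom C X Y) \<Longrightarrow> Comp C (Idn C Y) f = f"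
    and Comp_assoc: "\<lbrakk>f \<in> carrier (Hom C W X); g \<in> carrier (Hom C X Y); h \<in> carrier (Hom C Y Z)\<rbrakk>
          \<Longrightarrow> Comp C h (Comp C g f) = Comp C (Comp C h g) f"

locale additive_category = category +
  assumes Hom_abelian_group: "\<lbrakk>X \<in> Obj C; Y \<in> Obj C\<rbrakk> \<Longrightarrow> abelian_group (Hom C X Y)"
    and Comp_Add_right: "\<lbrakk>f \<in> carrier (Hom C X Y); f' \<in> carrier (Hom C X Y); g \<in> carrier (Hom C Y Z)\<rbrakk>
          \<Longrightarrow> Comp C g (Add C f f') = Add C (Comp C g f) (Comp C g f')"
    and Comp_Add_left: "\<lbrakk>f \<in> carrier (Hom C X Y); g \<in> carrier (Hom C Y Z); g' \<in> carrier (Hom C Y Z)\<rbrakk>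
          \<Longrightarrow> Comp C (Add C g g') f = Add C (Comp C g f) (Comp C g' f)"
    and zero_object_exists: "\<exists>Z. zero_object C Z"
    and biproduct_exists: "\<lbrakk>X \<in> Obj C; Y \<in> Obj C\<rbrakk> \<Longrightarrow> \<exists>S i j p q. is_biproduct C X Y S i j p q"

locale biadditive_functor =
  A: additive_category A + B: additive_category B + C: additive_category C
  for A :: "('a, 'f) cat" and B :: "('b, 'g) cat" and C :: "('c, 'h) cat" +
  fixes FO :: "'a \<Rightarrow> 'b \<Rightarrow> 'c" and FM :: "'f \<Rightarrow> 'g \<Rightarrow> 'h"
  assumes FO_closed: "\<lbrakk>X \<in> Obj A; Y \<in> Obj B\<rbrakk> \<Longrightarrow> FO X Y \<in> Obj C"
    and FM_closed: "\<lbrakk>f \<in> carrier (Hom A X X'); g \<in> carrier (Hom B Y Y')\<rbrakk>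
          \<Longrightarrow> FM f g \<in> carrier (Hom C (FO X Y) (FO X' Y'))"
    and FM_Idn: "\<lbrakk>X \<in> Obj A; Y \<in> Obj B\<rbrakk> \<Longrightarrow> FM (Idn A X) (Idn B Y) = Idn C (FO X Y)"
    and FM_Comp: "\<lbrakk>f \<in> carrier (Hom A X X'); f' \<in> carrier (Hom A X' X'');
            g \<in> carrier (Hom B Y Y'); g' \<in> carrier (Hom B Y' Y'')\<rbrakk>
          \<Longrightarrow> FM (Comp A f' f) (Comp B g' g) = Comp C (FM f' g') (FM f g)"
    and FM_Add_left: "\<lbrakk>f \<in> carrier (Hom A X X'); f' \<in> carrier (Hom A X X'); g \<in> Arr B\<rbrakk>
          \<Longrightarrow> FM (Add A f f') g = Add C (FM f g) (FM f' g)"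
    and FM_Add_right: "\<lbrakk>f \<in> Arr A; g \<in> carrier (Hom B Y Y'); g' \<in> carrier (Hom B Y Y')\<rbrakk>
          \<Longrightarrow> FM f (Add B g g') = Add C (FM f g) (FM f g')"

locale strict_monoidal_category =
  biadditive_functor A A A TO TM
  for A :: "('a, 'f) cat" and TO :: "'a \<Rightarrow> 'a \<Rightarrow> 'a" and TM :: "'f \<Rightarrow> 'f \<Rightarrow> 'f" +
  fixes U :: 'a
  assumes U_closed: "U \<in> Obj A"
    and TO_assoc: "\<lbrakk>X \<in> Obj A; Y \<in> Obj A; Z \<in> Obj A\<rbrakk> \<Longrightarrow> TO (TO X Y) Z = TO X (TO Y Z)"
    and TM_assoc: "\<lbrakk>f \<in> Arr A; g \<in> Arr A; h \<in> Arr A\<rbrakk> \<Longrightarrow> TM (TM f g) h = TM f (TM g h)"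
    and TO_unit: "X \<in> Obj A \<Longrightarrow> TO U X = X" "X \<in> Obj A \<Longrightarrow> TO X U = X"
    and TM_unit: "f \<in> Arr A \<Longrightarrow> TM (Idn A U) f = f" "f \<in> Arr A \<Longrightarrow> TM f (Idn A U) = f"

locale strict_monoidal_action =
  strict_monoidal_category A TO TM U + action: biadditive_functor A C C LO LM
  for A :: "('a, 'f) cat" and TO :: "'a \<Rightarrow> 'a \<Rightarrow> 'a" and TM :: "'f \<Rightarrow> 'f \<Rightarrow> 'f" and U :: 'a
    and C :: "('c, 'g) cat" and LO :: "'a \<Rightarrow> 'c \<Rightarrow> 'c" and LM :: "'f \<Rightarrow> 'g \<Rightarrow> 'g" +
  assumes LO_assoc: "\<lbrakk>X \<in> Obj A; Y \<in> Obj A; Z \<in> Obj C\<rbrakk> \<Longrightarrow> LO (TO X Y) Z = LO X (LO Y Z)"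
    and LM_assoc: "\<lbrakk>f \<in> Arr A; g \<in> Arr A; h \<in> Arr C\<rbrakk> \<Longrightarrow> LM (TM f g) h = LM f (LM g h)"
    and LO_unit: "Z \<in> Obj C \<Longrightarrow> LO U Z = Z"
    and LM_unit: "h \<in> Arr C \<Longrightarrow> LM (Idn A U) h = h"


section \<open>Quotients by ideals\<close>

definition cat_ideal :: "('o, 'm) cat \<Rightarrow> 'm set \<Rightarrow> bool" where
  "cat_ideal K J \<longleftrightarrow> J \<subseteq> Arr K \<and>
     (\<forall>X\<in>Obj K. \<forall>Y\<in>Obj K. Zero K X Y \<in> J) \<and>
     (\<forall>f\<in>J. \<forall>g\<in>J. Dom K f = Dom K g \<longrightarrow> Cod K f = Cod K g \<longrightarrow> Add K f g \<in> J) \<and>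
     (\<forall>f\<in>J. neg K f \<in> J) \<and>
     (\<forall>f\<in>J. \<forall>g\<in>Arr K. Dom K g = Cod K f \<longrightarrow> Comp K g f \<in> J) \<and>
     (\<forall>f\<in>J. \<forall>g\<in>Arr K. Cod K g = Dom K f \<longrightarrow> Comp K f g \<in> J)"

definition quot_class :: "('o, 'm) cat \<Rightarrow> 'm set \<Rightarrow> 'm \<Rightarrow> 'm set" where
  "quot_class K J f = {g \<in> carrier (Hom K (Dom K f) (Cod K f)).
     g \<ominus>\<^bsub>Hom K (Dom K f) (Cod K f)\<^esub> f \<in> J}"

definition quot_rep :: "'m set \<Rightarrow> 'm" where
  "quot_rep c = (SOME f. f \<in> c)"

definition quot_cat :: "('o, 'm) cat \<Rightarrow> 'm set \<Rightarrow> ('o, 'm set) cat" where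
  "quot_cat K J = \<lparr>Obj = Obj K, Arr = quot_class K J ` Arr K,
     Dom = (\<lambda>c. Dom K (quot_rep c)), Cod = (\<lambda>c. Cod K (quot_rep c)),
     Idn = (\<lambda>X. quot_class K J (Idn K X)),
     Comp = (\<lambda>c c'. quot_class K J (Comp K (quot_rep c) (quot_rep c'))),
     Add = (\<lambda>c c'. quot_class K J (Add K (quot_rep c) (quot_rep c'))),
     Zero = (\<lambda>X Y. quot_class K J (Zero K X Y))\<rparr>"

text \<open>A two-place operation on morphisms, with values in \<open>K\<close>, transported to classes.\<close>

definition quot_op :: "('o, 'm) cat \<Rightarrow> 'm set \<Rightarrow> ('f \<Rightarrow> 'g \<Rightarrow> 'm) \<Rightarrow> 'f set \<Rightarrow> 'g set \<Rightarrow> 'm set" where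
  "quot_op K J F c e = quot_class K J (F (quot_rep c) (quot_rep e))"


section \<open>Indices\<close>

text \<open>
  Positions are counted from 0: the coordinate \<open>a\<^sub>i\<close>, \<open>i = 1, 2, \<dots>\<close>, is
  \<open>lookup a (i - 1)\<close>. So the first \<open>k\<close> positions are those with \<open>i < k\<close>.
\<close>

type_synonym idx = "nat \<Rightarrow>\<^sub>0 int"

abbreviation \<epsilon> :: "nat \<Rightarrow> idx" where
  "\<epsilon> i \<equiv> Poly_Mapping.single i 1"

definition ht :: "idx \<Rightarrow> int" where
  "ht a = (\<Sum>i\<in>Poly_Mapping.keys a. Poly_Mapping.lookup a i)"

definition level :: "int \<Rightarrow> idx set" where
  "level k = {a. ht a = k}"

lift_definition \<pi> :: "nat \<Rightarrow> idx \<Rightarrow> idx" is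
  "\<lambda>k (a :: nat \<Rightarrow> int) i. if i < k then a i else 0"
  by (rule finite_subset[rotated]) auto

lift_definition \<sigma> :: "nat \<Rightarrow> idx \<Rightarrow> idx" is
  "\<lambda>k (a :: nat \<Rightarrow> int) i. a (k + i)"
  using finite_vimageI[where h = "\<lambda>i. _ + i"] by (fastforce simp: vimage_def inj_on_def)


section \<open>Pyramids\<close>

record ('o, 'm) pyr =
  pobj :: "idx \<Rightarrow> 'o"
  pdiff :: "idx \<Rightarrow> nat \<Rightarrow> 'm"
  prank :: nat

definition is_pyramid :: "('o, 'm) cat \<Rightarrow> ('o, 'm) pyr \<Rightarrow> bool" where
  "is_pyramid B X \<longleftrightarrow>
     (\<forall>a. pobj X a \<in> Obj B) \<and>
     (\<forall>a i. pdiff X a i \<in> carrier (Hom B (pobj X a) (pobj X (a + \<epsilon> i)))) \<and>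
     (\<forall>a. \<not> (\<forall>i\<ge>prank X. Poly_Mapping.lookup a i = 0) \<longrightarrow> zero_object B (pobj X a)) \<and>
     (\<exists>m. \<forall>a. \<not> (\<forall>i. Poly_Mapping.lookup a i < m) \<longrightarrow> zero_object B (pobj X a)) \<and>
     (\<forall>a i. Comp B (pdiff X (a + \<epsilon> i) i) (pdiff X a i)
              = Zero B (pobj X a) (pobj X (a + \<epsilon> i + \<epsilon> i))) \<and>
     (\<forall>a i j. Comp B (pdiff X (a + \<epsilon> i) j) (pdiff X a i)
              = neg B (Comp B (pdiff X (a + \<epsilon> j) i) (pdiff X a j)))"

text \<open>
  The index sets of the matrices are infinite, but the two vanishing conditions on a pyramid make
  all but finitely many of its objects of each height zero, so only finitely many summands of a matrix product are nonzero.
\<close>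

definition hom_sum :: "('o, 'm) cat \<Rightarrow> 'o \<Rightarrow> 'o \<Rightarrow> (idx \<Rightarrow> 'm) \<Rightarrow> idx set \<Rightarrow> 'm" where
  "hom_sum B X Y f S = finsum (Hom B X Y) f {c \<in> S. f c \<noteq> Zero B X Y}"

text \<open>
  The product \<open>M \<cdot> N\<close>, for entries \<open>N c b : X b \<rightarrow> W c\<close> and \<open>M a c : W c \<rightarrow> Y a\<close>, where \<open>c\<close> runs
  over the indices of height \<open>k\<close>.
\<close>

definition mat_mult :: "('o, 'm) cat \<Rightarrow> (idx \<Rightarrow> 'o) \<Rightarrow> (idx \<Rightarrow> 'o) \<Rightarrow> int \<Rightarrow>
    (idx \<Rightarrow> idx \<Rightarrow> 'm) \<Rightarrow> (idx \<Rightarrow> idx \<Rightarrow> 'm) \<Rightarrow> idx \<Rightarrow> idx \<Rightarrow> 'm" where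
  "mat_mult B X Y k M N a b = hom_sum B (X b) (Y a) (\<lambda>c. Comp B (M a c) (N c b)) (level k)"

text \<open>The matrix \<open>d\<^sup>(\<^sup>k\<^sup>)\<close> is the restriction of this one to \<open>level (k + 1) \<times> level k\<close>.\<close>

definition diff_mat :: "('o, 'm) cat \<Rightarrow> ('o, 'm) pyr \<Rightarrow> idx \<Rightarrow> idx \<Rightarrow> 'm" where
  "diff_mat B X a b = (if \<exists>i. a = b + \<epsilon> i then pdiff X b (THE i. a = b + \<epsilon> i)
     else Zero B (pobj X b) (pobj X a))"

text \<open>
  A morphism carries its source and target; \<open>pent \<alpha> k a b\<close> is the entry in row \<open>a\<close>, column \<open>b\<close> of
  the \<open>k\<close>-th matrix. It is fixed to be \<^const>\<open>undefined\<close> unless both indices have height \<open>k\<close>, so that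
  equality of records is equality of morphisms.
\<close>

record ('o, 'm) pmor =
  psrc :: "('o, 'm) pyr"
  ptgt :: "('o, 'm) pyr"
  pent :: "int \<Rightarrow> idx \<Rightarrow> idx \<Rightarrow> 'm"

definition level_restrict :: "(int \<Rightarrow> idx \<Rightarrow> idx \<Rightarrow> 'm) \<Rightarrow> int \<Rightarrow> idx \<Rightarrow> idx \<Rightarrow> 'm" where
  "level_restrict M k a b = (if a \<in> level k \<and> b \<in> level k then M k a b else undefined)"

definition is_pmor :: "('o, 'm) cat \<Rightarrow> ('o, 'm) pmor \<Rightarrow> bool" where
  "is_pmor B \<alpha> \<longleftrightarrow> (let X = psrc \<alpha>; Y = ptgt \<alpha> in
     is_pyramid B X \<and> is_pyramid B Y \<and> level_restrict (pent \<alpha>) = pent \<alpha> \<and>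
     (\<forall>k. \<forall>a\<in>level k. \<forall>b\<in>level k. pent \<alpha> k a b \<in> carrier (Hom B (pobj X b) (pobj Y a))) \<and>
     (\<forall>k. \<forall>a\<in>level (k + 1). \<forall>b\<in>level k.
        mat_mult B (pobj X) (pobj Y) (k + 1) (pent \<alpha> (k + 1)) (diff_mat B X) a b
      = mat_mult B (pobj X) (pobj Y) k (diff_mat B Y) (pent \<alpha> k) a b))"

definition pyr_id :: "('o, 'm) cat \<Rightarrow> ('o, 'm) pyr \<Rightarrow> ('o, 'm) pmor" where
  "pyr_id B X = \<lparr>psrc = X, ptgt = X, pent = level_restrict (\<lambda>k a b.
     if a = b then Idn B (pobj X a) else Zero B (pobj X b) (pobj X a))\<rparr>"

definition pyr_cat :: "('o, 'm) cat \<Rightarrow> (('o, 'm) pyr, ('o, 'm) pmor) cat" where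
  "pyr_cat B = \<lparr>Obj = {X. is_pyramid B X}, Arr = {\<alpha>. is_pmor B \<alpha>}, Dom = psrc, Cod = ptgt,
     Idn = pyr_id B,
     Comp = (\<lambda>\<beta> \<alpha>. \<lparr>psrc = psrc \<alpha>, ptgt = ptgt \<beta>, pent = level_restrict (\<lambda>k.
        mat_mult B (pobj (psrc \<alpha>)) (pobj (ptgt \<beta>)) k (pent \<beta> k) (pent \<alpha> k))\<rparr>),
     Add = (\<lambda>\<alpha> \<beta>. \<lparr>psrc = psrc \<alpha>, ptgt = ptgt \<alpha>, pent = level_restrict (\<lambda>k a b.
        Add B (pent \<alpha> k a b) (pent \<beta> k a b))\<rparr>),
     Zero = (\<lambda>X Y. \<lparr>psrc = X, ptgt = Y, pent = level_restrict (\<lambda>k a b.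
        Zero B (pobj X b) (pobj Y a))\<rparr>)\<rparr>"


section \<open>The homotopy category\<close>

definition is_homotopy :: "('o, 'm) cat \<Rightarrow> ('o, 'm) pyr \<Rightarrow> ('o, 'm) pyr \<Rightarrow>
    (int \<Rightarrow> idx \<Rightarrow> idx \<Rightarrow> 'm) \<Rightarrow> bool" where
  "is_homotopy B X Y \<chi> \<longleftrightarrow> (\<forall>k. \<forall>a\<in>level (k - 1). \<forall>b\<in>level k.
     \<chi> k a b \<in> carrier (Hom B (pobj X b) (pobj Y a)))"

definition null_homotopic :: "('o, 'm) cat \<Rightarrow> ('o, 'm) pmor set" where
  "null_homotopic B = {\<alpha>. is_pmor B \<alpha> \<and> (\<exists>\<chi>. is_homotopy B (psrc \<alpha>) (ptgt \<alpha>) \<chi> \<and>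
     (\<forall>k. \<forall>a\<in>level k. \<forall>b\<in>level k. pent \<alpha> k a b =
        Add B
          (mat_mult B (pobj (psrc \<alpha>)) (pobj (ptgt \<alpha>)) (k + 1) (\<chi> (k + 1)) (diff_mat B (psrc \<alpha>)) a b)
          (mat_mult B (pobj (psrc \<alpha>)) (pobj (ptgt \<alpha>)) (k - 1) (diff_mat B (ptgt \<alpha>)) (\<chi> k) a b)))}"

definition htp_cat :: "('o, 'm) cat \<Rightarrow> (('o, 'm) pyr, ('o, 'm) pmor set) cat" where
  "htp_cat B = quot_cat (pyr_cat B) (null_homotopic B)"

definition htp_class :: "('o, 'm) cat \<Rightarrow> ('o, 'm) pmor \<Rightarrow> ('o, 'm) pmor set" where
  "htp_class B = quot_class (pyr_cat B) (null_homotopic B)"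

definition htp_op :: "('o, 'm) cat \<Rightarrow> ('f \<Rightarrow> 'g \<Rightarrow> ('o, 'm) pmor) \<Rightarrow>
    'f set \<Rightarrow> 'g set \<Rightarrow> ('o, 'm) pmor set" where
  "htp_op B = quot_op (pyr_cat B) (null_homotopic B)"


section \<open>The product of pyramids induced by a biadditive functor\<close>

text \<open>
  The tensor product of pyramids and the operation \<open>\<star>\<close> are given by the same formulas, applied to
  the tensor product \<open>A \<times> A \<rightarrow> A\<close> and to the action \<open>A \<times> C \<rightarrow> C\<close>. Here they are written for a
  functor \<open>(FO, FM) : A \<times> B \<rightarrow> C\<close>.
\<close>

definition pyr_prod_obj :: "('a, 'f) cat \<Rightarrow> ('b, 'g) cat \<Rightarrow> ('c, 'h) cat \<Rightarrow>
    ('a \<Rightarrow> 'b \<Rightarrow> 'c) \<Rightarrow> ('f \<Rightarrow> 'g \<Rightarrow> 'h) \<Rightarrow> ('a, 'f) pyr \<Rightarrow> ('b, 'g) pyr \<Rightarrow> ('c, 'h) pyr" where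
  "pyr_prod_obj A B C FO FM X Y = (let n = prank X in
     \<lparr>pobj = (\<lambda>a. FO (pobj X (\<pi> n a)) (pobj Y (\<sigma> n a))),
      pdiff = (\<lambda>a i.
        if i < n then FM (pdiff X (\<pi> n a) i) (Idn B (pobj Y (\<sigma> n a)))
        else let f = FM (Idn A (pobj X (\<pi> n a))) (pdiff Y (\<sigma> n a) (i - n))
             in if even (ht (\<pi> n a)) then f else neg C f),
      prank = n + prank Y\<rparr>)"

text \<open>
  For \<open>\<alpha>\<close> the identity of \<open>X\<close> this is the morphism \<open>X \<star> \<beta>\<close>, and for \<open>\<beta>\<close> the identity
  of \<open>Y\<close> it is \<open>\<alpha> \<star> Y\<close>. A bifunctor is determined by these two kinds of values, as
  \<open>\<alpha> \<star> \<beta> = (\<alpha> \<star> ptgt \<beta>) \<cdot> (psrc \<alpha> \<star> \<beta>)\<close>.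
\<close>

definition pyr_prod_mor :: "('a, 'f) cat \<Rightarrow> ('b, 'g) cat \<Rightarrow> ('c, 'h) cat \<Rightarrow>
    ('a \<Rightarrow> 'b \<Rightarrow> 'c) \<Rightarrow> ('f \<Rightarrow> 'g \<Rightarrow> 'h) \<Rightarrow> ('a, 'f) pmor \<Rightarrow> ('b, 'g) pmor \<Rightarrow> ('c, 'h) pmor" where
  "pyr_prod_mor A B C FO FM \<alpha> \<beta> =
     (let n = prank (psrc \<alpha>); n' = prank (ptgt \<alpha>);
          S = pyr_prod_obj A B C FO FM (psrc \<alpha>) (psrc \<beta>);
          T = pyr_prod_obj A B C FO FM (ptgt \<alpha>) (ptgt \<beta>) in
      \<lparr>psrc = S, ptgt = T,
       pent = level_restrict (\<lambda>k a b. let l = ht (\<pi> n' a) in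
         if l = ht (\<pi> n b)
         then FM (pent \<alpha> l (\<pi> n' a) (\<pi> n b)) (pent \<beta> (k - l) (\<sigma> n' a) (\<sigma> n b))
         else Zero C (pobj S b) (pobj T a))\<rparr>)"

definition pyr_unit :: "('a, 'f) cat \<Rightarrow> 'a \<Rightarrow> ('a, 'f) pyr" where
  "pyr_unit A U = (let X = (\<lambda>a. if a = 0 then U else the_zero_object A) in
     \<lparr>pobj = X, pdiff = (\<lambda>a i. Zero A (X a) (X (a + \<epsilon> i))), prank = 0\<rparr>)"

definition tens_obj where "tens_obj A TO TM = pyr_prod_obj A A A TO TM"
definition tens_mor where "tens_mor A TO TM = pyr_prod_mor A A A TO TM"
definition star_obj where "star_obj A C LO LM = pyr_prod_obj A C C LO LM"
definition star_mor where "star_mor A C LO LM = pyr_prod_mor A C C LO LM"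

end

theory Submission
  imports Defs
begin

text \<open>
  A pyramid is a family of objects together with a differential, and its indices carry a height. The
  matrices \<open>\<alpha>\<^sup>(\<^sup>k\<^sup>)\<close> of a morphism, for all \<open>k\<close>, are the blocks of one infinite matrix between the two
  families, and so are the matrices of a differential or of a homotopy. These infinite matrices are
  column-finite, because only finitely many objects of each height are nonzero. Column-finite matrices
  form an additive category (\<open>additive_fam_cat\<close>), in which a morphism of pyramids is a matrix \<open>M\<close> of
  degree 0 with \<open>M d = \<partial> M\<close>, and it is null homotopic if and only if \<open>M = H d + \<partial> H\<close> with \<open>H\<close> of
  degree \<open>-1\<close> (\<open>pyr_homE\<close>, \<open>null_homotopic_iff\<close>). Additivity of the category of pyramids and the ideal
  property of null homotopic morphisms follow by computing with matrices.

  For a biadditive functor, cutting indices into an initial part of length \<open>n\<close> and the rest gives a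
  product \<open>M \<otimes> N\<close> of matrices, entry by entry and without signs. It is biadditive and satisfies
  \<open>(M' \<otimes> N') (M \<otimes> N) = M' M \<otimes> N' N\<close> (\<open>kron_Comp\<close>), since an index is the same as the pair of its parts.
  All signs are in the diagonal matrix \<open>s\<close> with entries \<open>(-1)\<^sup>k\<close> in height \<open>k\<close>: it commutes with matrices
  of even degree, anticommutes with those of odd degree, and satisfies \<open>s s = 1\<close>. The differential of a
  product of pyramids is \<open>d \<otimes> 1 + s \<otimes> \<partial>\<close> (\<open>diff_mat_prod\<close>), so that \<open>M \<otimes> N\<close> commutes with the differentials
  if \<open>M\<close> and \<open>N\<close> do. If \<open>M = H d + d H\<close>, then \<open>H \<otimes> N\<close> is a homotopy from \<open>M \<otimes> N\<close> to zero; if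
  \<open>N = H \<partial> + \<partial> H\<close>, then \<open>s M \<otimes> H\<close> is one (\<open>null_mat_kron_left\<close>, \<open>null_mat_kron_right\<close>). So the product
  is a biadditive functor on pyramids that respects the null homotopic ideals, and it passes to the
  quotients (\<open>biadditive_quotient_pyr_prod\<close>, \<open>biadditive_quot\<close>).

  Strict associativity and the unit laws are equalities of pyramids, checked index by index
  (\<open>prod_assoc\<close>, \<open>prod_unit\<close>, \<open>prod_unit_right\<close>); they hold for classes because they hold for
  representatives. Tensor product and action are treated at once, the tensor product being the action
  of the monoidal category on itself.
\<close>

section \<open>Additive categories\<close>

abbreviation homset :: "('o, 'm) cat \<Rightarrow> 'o \<Rightarrow> 'o \<Rightarrow> 'm set" where
  "homset C X Y \<equiv> carrier (Hom C X Y)"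

lemma homset_iff: "f \<in> homset C X Y \<longleftrightarrow> f \<in> Arr C \<and> Dom C f = X \<and> Cod C f = Y"
  by (simp add: Hom_def)

lemma Hom_add [simp]: "add (Hom C X Y) = Add C"
  by (simp add: Hom_def)

lemma Hom_zero [simp]: "\<zero>\<^bsub>Hom C X Y\<^esub> = Zero C X Y"
  by (simp add: Hom_def)

lemma (in category) homset_Obj:
  assumes "f \<in> homset C X Y"
  shows "X \<in> Obj C" "Y \<in> Obj C"
  using assms Dom_closed Cod_closed by (auto simp: homset_iff)

context additive_category
begin

lemma Arr_homset: "f \<in> Arr C \<Longrightarrow> f \<in> homset C (Dom C f) (Cod C f)"
  by (simp add: homset_iff)

lemma Hom_group: "f \<in> homset C X Y \<Longrightarrow> abelian_group (Hom C X Y)"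
  using Hom_abelian_group homset_Obj by blast

lemma Zero_closed: "\<lbrakk>X \<in> Obj C; Y \<in> Obj C\<rbrakk> \<Longrightarrow> Zero C X Y \<in> homset C X Y"
  using abelian_groupE(2)[OF Hom_abelian_group] by simp

lemma Add_closed: "\<lbrakk>f \<in> homset C X Y; g \<in> homset C X Y\<rbrakk> \<Longrightarrow> Add C f g \<in> homset C X Y"
  using abelian_groupE(1)[OF Hom_group] by force

lemma Add_assoc: "\<lbrakk>f \<in> homset C X Y; g \<in> homset C X Y; h \<in> homset C X Y\<rbrakk>
    \<Longrightarrow> Add C (Add C f g) h = Add C f (Add C g h)"
  using abelian_groupE(3)[OF Hom_group] by force

lemma Add_commute: "\<lbrakk>f \<in> homset C X Y; g \<in> homset C X Y\<rbrakk> \<Longrightarrow> Add C f g = Add C g f"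
  using abelian_groupE(4)[OF Hom_group] by force

lemma Add_interchange:
  assumes "f \<in> homset C X Y" "g \<in> homset C X Y" "h \<in> homset C X Y" "k \<in> homset C X Y"
  shows "Add C (Add C f g) (Add C h k) = Add C (Add C f h) (Add C g k)"
proof -
  interpret abelian_group "Hom C X Y" by (rule Hom_group[OF assms(1)])
  show ?thesis using assms a_assoc a_comm a_lcomm a_closed by simp
qed

lemma Zero_Add: "f \<in> homset C X Y \<Longrightarrow> Add C (Zero C X Y) f = f"
  using abelian_groupE(5)[OF Hom_group] by force

lemma Add_Zero: "f \<in> homset C X Y \<Longrightarrow> Add C f (Zero C X Y) = f"
  using Zero_Add Add_commute Zero_closed homset_Obj by metis

lemma neg_eq: "f \<in> homset C X Y \<Longrightarrow> neg C f = \<ominus>\<^bsub>Hom C X Y\<^esub> f"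
  by (simp add: neg_def homset_iff)

lemma neg_closed: "f \<in> homset C X Y \<Longrightarrow> neg C f \<in> homset C X Y"
  using abelian_group.a_inv_closed[OF Hom_group] by (metis neg_eq)

lemma neg_Add: "f \<in> homset C X Y \<Longrightarrow> Add C (neg C f) f = Zero C X Y"
  using abelian_group.l_neg[OF Hom_group] by (metis neg_eq Hom_add Hom_zero)

lemma Add_neg: "f \<in> homset C X Y \<Longrightarrow> Add C f (neg C f) = Zero C X Y"
  using neg_Add neg_closed Add_commute by metis

lemma neg_unique:
  assumes "f \<in> homset C X Y" "g \<in> homset C X Y" "Add C f g = Zero C X Y"
  shows "f = neg C g"
  using abelian_group.minus_equality[OF Hom_group[OF assms(1)], of f g] assms neg_eq by simp

lemma neg_neg: "f \<in> homset C X Y \<Longrightarrow> neg C (neg C f) = f"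
  using neg_unique Add_neg neg_closed by metis

lemma neg_Zero: "\<lbrakk>X \<in> Obj C; Y \<in> Obj C\<rbrakk> \<Longrightarrow> neg C (Zero C X Y) = Zero C X Y"
  using neg_unique Zero_Add Zero_closed by metis

lemma neg_Add_distrib:
  assumes "f \<in> homset C X Y" "g \<in> homset C X Y"
  shows "neg C (Add C f g) = Add C (neg C f) (neg C g)"
proof (rule neg_unique[symmetric])
  show "Add C (Add C (neg C f) (neg C g)) (Add C f g) = Zero C X Y"
    using Add_interchange[OF neg_closed[OF assms(1)] neg_closed[OF assms(2)] assms]
      neg_Add[OF assms(1)] neg_Add[OF assms(2)] Zero_Add Zero_closed homset_Obj[OF assms(1)] by simp
qed (use assms Add_closed neg_closed in blast)+

lemma Add_idem_Zero: "\<lbrakk>f \<in> homset C X Y; Add C f f = f\<rbrakk> \<Longrightarrow> f = Zero C X Y"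
  by (metis Add_assoc Add_neg Add_Zero neg_closed)

lemma minus_eq:
  "\<lbrakk>f \<in> homset C X Y; g \<in> homset C X Y\<rbrakk> \<Longrightarrow> f \<ominus>\<^bsub>Hom C X Y\<^esub> g = Add C f (neg C g)"
  by (simp add: a_minus_def neg_eq)

end

text \<open>An additive map between groups of morphisms, possibly of two different categories.\<close>

locale additive_map =
  C: additive_category C + D: additive_category D
  for C :: "('a, 'f) cat" and D :: "('b, 'g) cat" +
  fixes X Y :: 'a and X' Y' :: 'b and \<phi> :: "'f \<Rightarrow> 'g"
  assumes XY: "X \<in> Obj C" "Y \<in> Obj C"
    and map_closed: "f \<in> homset C X Y \<Longrightarrow> \<phi> f \<in> homset D X' Y'"
    and map_Add: "\<lbrakk>f \<in> homset C X Y; g \<in> homset C X Y\<rbrakk> \<Longrightarrow> \<phi> (Add C f g) = Add D (\<phi> f) (\<phi> g)"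
begin

lemma map_Zero: "\<phi> (Zero C X Y) = Zero D X' Y'"
  using C.Zero_closed[OF XY] map_closed map_Add C.Zero_Add D.Add_idem_Zero by metis

lemma map_neg: "f \<in> homset C X Y \<Longrightarrow> \<phi> (neg C f) = neg D (\<phi> f)"
  using D.neg_unique map_closed map_Add map_Zero C.neg_Add C.neg_closed by metis

lemma map_finsum:
  assumes "finite F" "\<And>c. c \<in> F \<Longrightarrow> f c \<in> homset C X Y"
  shows "\<phi> (finsum (Hom C X Y) f F) = finsum (Hom D X' Y') (\<lambda>c. \<phi> (f c)) F"
proof -
  interpret G: abelian_group "Hom C X Y" by (rule C.Hom_abelian_group[OF XY])
  have "X' \<in> Obj D" "Y' \<in> Obj D"
    using map_closed[OF C.Zero_closed[OF XY]] D.homset_Obj by auto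
  then interpret H: abelian_group "Hom D X' Y'" by (rule D.Hom_abelian_group)
  show ?thesis using assms
  proof (induction F)
    case empty
    then show ?case by (simp add: map_Zero)
  next
    case (insert x F)
    have f: "f \<in> F \<rightarrow> homset C X Y" "f x \<in> homset C X Y" using insert by auto
    have g: "(\<lambda>c. \<phi> (f c)) \<in> F \<rightarrow> homset D X' Y'" "\<phi> (f x) \<in> homset D X' Y'"
      using f map_closed by auto
    show ?case
      using insert f g by (simp add: G.finsum_insert H.finsum_insert map_Add G.finsum_closed)
  qed
qed

end

context additive_category
begin

lemma additive_map_Comp_left:
  assumes "g \<in> homset C Y Z" "X \<in> Obj C"
  shows "additive_map C C X Y X Z (Comp C g)"
  by unfold_locales (use assms homset_Obj in \<open>blast intro: Comp_closed Comp_Add_right\<close>)+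

lemma additive_map_Comp_right:
  assumes "f \<in> homset C X Y" "Z \<in> Obj C"
  shows "additive_map C C Y Z X Z (\<lambda>g. Comp C g f)"
  by unfold_locales (use assms homset_Obj in \<open>blast intro: Comp_closed Comp_Add_left\<close>)+

lemma Comp_Zero_right: "\<lbrakk>g \<in> homset C Y Z; X \<in> Obj C\<rbrakk> \<Longrightarrow> Comp C g (Zero C X Y) = Zero C X Z"
  by (rule additive_map.map_Zero[OF additive_map_Comp_left])

lemma Comp_Zero_left: "\<lbrakk>f \<in> homset C X Y; Z \<in> Obj C\<rbrakk> \<Longrightarrow> Comp C (Zero C Y Z) f = Zero C X Z"
  by (rule additive_map.map_Zero[OF additive_map_Comp_right])

lemma Comp_neg_right:
  "\<lbrakk>f \<in> homset C X Y; g \<in> homset C Y Z\<rbrakk> \<Longrightarrow> Comp C g (neg C f) = neg C (Comp C g f)"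
  using additive_map.map_neg[OF additive_map_Comp_left] homset_Obj by blast

lemma Comp_neg_left:
  "\<lbrakk>f \<in> homset C X Y; g \<in> homset C Y Z\<rbrakk> \<Longrightarrow> Comp C (neg C g) f = neg C (Comp C g f)"
  using additive_map.map_neg[OF additive_map_Comp_right] homset_Obj by blast

lemma homset_zero_object:
  assumes "f \<in> homset C X Y" "zero_object C X \<or> zero_object C Y"
  shows "f = Zero C X Y"
proof -
  have "X \<in> Obj C" "Y \<in> Obj C" using homset_Obj assms by auto
  then have "\<exists>!f. f \<in> homset C X Y" using assms(2) by (auto simp: zero_object_def)
  then show ?thesis using assms(1) Zero_closed \<open>X \<in> Obj C\<close> \<open>Y \<in> Obj C\<close> by blast
qed

lemma zero_object_iff: "zero_object C X \<longleftrightarrow> X \<in> Obj C \<and> Idn C X = Zero C X X"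
proof (intro iffI conjI)
  assume "zero_object C X"
  then show "X \<in> Obj C" by (simp add: zero_object_def)
  then show "Idn C X = Zero C X X" using homset_zero_object Idn_closed \<open>zero_object C X\<close> by blast
next
  assume X: "X \<in> Obj C \<and> Idn C X = Zero C X X"
  have "f = Zero C Y X" if "f \<in> homset C Y X" for f Y
    using that X Idn_Comp Comp_Zero_left by metis
  moreover have "f = Zero C X Y" if "f \<in> homset C X Y" for f Y
    using that X Comp_Idn Comp_Zero_right by metis
  ultimately show "zero_object C X"
    unfolding zero_object_def using X Zero_closed by metis
qed

lemma finsum_product:
  assumes "X \<in> Obj C" "Y \<in> Obj C" "finite F" "finite G"
    and "\<And>c e. \<lbrakk>c \<in> F; e \<in> G\<rbrakk> \<Longrightarrow> f c e \<in> homset C X Y"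
  shows "finsum (Hom C X Y) (\<lambda>c. finsum (Hom C X Y) (f c) G) F
       = finsum (Hom C X Y) (\<lambda>(c, e). f c e) (F \<times> G)"
proof -
  interpret abelian_group "Hom C X Y" by (rule Hom_abelian_group[OF assms(1,2)])
  show ?thesis using assms(3,5)
  proof (induction F)
    case empty
    then show ?case by simp
  next
    case (insert x F)
    have fin: "(\<lambda>c. finsum (Hom C X Y) (f c) G) \<in> F \<rightarrow> homset C X Y"
        "finsum (Hom C X Y) (f x) G \<in> homset C X Y"
      using insert.prems by (auto intro!: finsum_closed)
    have "finsum (Hom C X Y) (\<lambda>(c, e). f c e) (insert x F \<times> G)
        = finsum (Hom C X Y) (\<lambda>(c, e). f c e) (Pair x ` G \<union> F \<times> G)"
      by (rule arg_cong) auto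
    also have "\<dots> = finsum (Hom C X Y) (\<lambda>(c, e). f c e) (Pair x ` G) \<oplus>\<^bsub>Hom C X Y\<^esub>
        finsum (Hom C X Y) (\<lambda>(c, e). f c e) (F \<times> G)"
      using insert assms(4) by (intro finsum_Un_disjoint) auto
    also have "finsum (Hom C X Y) (\<lambda>(c, e). f c e) (Pair x ` G) = finsum (Hom C X Y) (f x) G"
      using insert.prems by (subst finsum_reindex) (auto simp: inj_on_def)
    finally show ?case using insert fin by (simp add: finsum_insert)
  qed
qed

lemma finsum_swap:
  assumes "X \<in> Obj C" "Y \<in> Obj C" "finite F" "finite G"
    and "\<And>c e. \<lbrakk>c \<in> F; e \<in> G\<rbrakk> \<Longrightarrow> f c e \<in> homset C X Y"
  shows "finsum (Hom C X Y) (\<lambda>c. finsum (Hom C X Y) (f c) G) F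
       = finsum (Hom C X Y) (\<lambda>e. finsum (Hom C X Y) (\<lambda>c. f c e) F) G"
proof -
  interpret abelian_group "Hom C X Y" by (rule Hom_abelian_group[OF assms(1,2)])
  have "finsum (Hom C X Y) (\<lambda>(c, e). f c e) (prod.swap ` (G \<times> F))
      = finsum (Hom C X Y) (\<lambda>p. (\<lambda>(c, e). f c e) (prod.swap p)) (G \<times> F)"
    by (rule finsum_reindex) (use assms(5) in auto)
  then show ?thesis
    using finsum_product[OF assms] finsum_product[OF assms(1,2,4,3), of "\<lambda>e c. f c e"] assms(5)
    by (simp add: product_swap case_prod_unfold)
qed

end

section \<open>Families of objects and column-finite matrices\<close>

text \<open>
  Column-finite matrices, indexed by \<open>\<int>\<close>-valued sequences of finite support, between arbitrary
  families of objects; such a matrix is a total function, so that matrices of all degrees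
  (differentials, morphisms, homotopies) live in one additive category.
\<close>

definition is_mat :: "('o, 'm) cat \<Rightarrow> (idx \<Rightarrow> 'o) \<Rightarrow> (idx \<Rightarrow> 'o) \<Rightarrow> (idx \<Rightarrow> idx \<Rightarrow> 'm) \<Rightarrow> bool" where
  "is_mat B X Y M \<longleftrightarrow> (\<forall>a. X a \<in> Obj B) \<and> (\<forall>a. Y a \<in> Obj B) \<and>
     (\<forall>a b. M a b \<in> homset B (X b) (Y a)) \<and> (\<forall>b. finite {a. M a b \<noteq> Zero B (X b) (Y a)})"

text \<open>
  The category of families of objects and column-finite matrices. The source and the target of a
  matrix can be read off from any row, respectively any column; those of index \<open>0\<close> are used.
\<close>

definition fam_cat :: "('o, 'm) cat \<Rightarrow> (idx \<Rightarrow> 'o, idx \<Rightarrow> idx \<Rightarrow> 'm) cat" where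
  "fam_cat B = \<lparr>Obj = {X. \<forall>a. X a \<in> Obj B}, Arr = {M. \<exists>X Y. is_mat B X Y M},
     Dom = (\<lambda>M b. Dom B (M 0 b)), Cod = (\<lambda>M a. Cod B (M a 0)),
     Idn = (\<lambda>X a b. if a = b then Idn B (X a) else Zero B (X b) (X a)),
     Comp = (\<lambda>M N a b. hom_sum B (Dom B (N 0 b)) (Cod B (M a 0)) (\<lambda>c. Comp B (M a c) (N c b)) UNIV),
     Add = (\<lambda>M N a b. Add B (M a b) (N a b)),
     Zero = (\<lambda>X Y a b. Zero B (X b) (Y a))\<rparr>"

abbreviation fam_Comp ("(_ \<odot>\<^sub>_ _)" [70, 1000, 71] 70) where
  "M \<odot>\<^sub>B N \<equiv> Comp (fam_cat B) M N"

abbreviation fam_Add ("(_ \<boxplus>\<^sub>_ _)" [65, 1000, 66] 65) where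
  "M \<boxplus>\<^sub>B N \<equiv> Add (fam_cat B) M N"

text \<open>The diagonal matrix with entries \<open>f a : X a \<rightarrow> Y a\<close>.\<close>

definition diag_mat ::
  "('o, 'm) cat \<Rightarrow> (idx \<Rightarrow> 'o) \<Rightarrow> (idx \<Rightarrow> 'o) \<Rightarrow> (idx \<Rightarrow> 'm) \<Rightarrow> idx \<Rightarrow> idx \<Rightarrow> 'm" where
  "diag_mat B X Y f a b = (if a = b then f a else Zero B (X b) (Y a))"

lemma fam_simps [simp]:
  "Obj (fam_cat B) = {X. \<forall>a. X a \<in> Obj B}"
  "Add (fam_cat B) M N = (\<lambda>a b. Add B (M a b) (N a b))"
  "Zero (fam_cat B) X Y = (\<lambda>a b. Zero B (X b) (Y a))"
  by (simp_all add: fam_cat_def)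

lemma fam_Idn: "Idn (fam_cat B) X = diag_mat B X X (\<lambda>a. Idn B (X a))"
  by (auto simp: fam_cat_def diag_mat_def fun_eq_iff)

lemma is_mat_hom: "is_mat B X Y M \<Longrightarrow> M a b \<in> homset B (X b) (Y a)"
  by (simp add: is_mat_def)

lemma fam_hom: "M \<in> homset (fam_cat B) X Y \<longleftrightarrow> is_mat B X Y M"
proof -
  have "Dom (fam_cat B) M = V" "Cod (fam_cat B) M = W" if "is_mat B V W M" for V W
  proof -
    have "Dom B (M a b) = V b" "Cod B (M a b) = W a" for a b
      using is_mat_hom[OF that, of a b] by (simp_all add: homset_iff)
    then show "Dom (fam_cat B) M = V" "Cod (fam_cat B) M = W" by (simp_all add: fam_cat_def)
  qed
  moreover have "M \<in> Arr (fam_cat B) \<longleftrightarrow> (\<exists>V W. is_mat B V W M)" by (simp add: fam_cat_def)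
  ultimately show ?thesis unfolding homset_iff by blast
qed

lemma is_mat_Obj: "is_mat B X Y M \<Longrightarrow> X a \<in> Obj B" "is_mat B X Y M \<Longrightarrow> Y a \<in> Obj B"
  by (simp_all add: is_mat_def)

lemma is_mat_finite: "is_mat B X Y M \<Longrightarrow> finite {a. M a b \<noteq> Zero B (X b) (Y a)}"
  by (simp add: is_mat_def)

context additive_category
begin

lemma hom_sum_eq:
  assumes "X \<in> Obj C" "Y \<in> Obj C" "finite F" "F \<subseteq> S"
    and "\<And>c. c \<in> F \<Longrightarrow> f c \<in> homset C X Y" "\<And>c. c \<in> S - F \<Longrightarrow> f c = Zero C X Y"
  shows "hom_sum C X Y f S = finsum (Hom C X Y) f F"
proof -
  interpret abelian_group "Hom C X Y" by (rule Hom_abelian_group[OF assms(1,2)])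
  show ?thesis unfolding hom_sum_def
    using assms by (intro add.finprod_mono_neutral_cong_left) auto
qed

text \<open>The sum in a matrix product may be taken over any finite set that contains the support of the column.\<close>

lemma fam_Comp_entry:
  assumes "is_mat C X Y N" "is_mat C Y Z M" "finite F"
    and "\<And>c. c \<notin> F \<Longrightarrow> N c b = Zero C (X b) (Y c)"
  shows "(M \<odot>\<^sub>C N) a b = finsum (Hom C (X b) (Z a)) (\<lambda>c. Comp C (M a c) (N c b)) F"
proof -
  note N = is_mat_hom[OF assms(1)] and M = is_mat_hom[OF assms(2)]
  have "Dom C (N 0 b) = X b" "Cod C (M a 0) = Z a"
    using N M unfolding homset_iff by blast+
  then have "(M \<odot>\<^sub>C N) a b = hom_sum C (X b) (Z a) (\<lambda>c. Comp C (M a c) (N c b)) UNIV"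
    by (simp add: fam_cat_def)
  also have "\<dots> = finsum (Hom C (X b) (Z a)) (\<lambda>c. Comp C (M a c) (N c b)) F"
  proof (rule hom_sum_eq)
    show "Comp C (M a c) (N c b) = Zero C (X b) (Z a)" if "c \<in> UNIV - F" for c
      using that assms(4)[of c] Comp_Zero_right[OF M] is_mat_Obj[OF assms(1)] by simp
  qed (use assms is_mat_Obj Comp_closed[OF N M] in blast)+
  finally show ?thesis .
qed

lemma fam_Comp_closed:
  assumes "is_mat C X Y N" "is_mat C Y Z M"
  shows "is_mat C X Z (M \<odot>\<^sub>C N)"
proof -
  note N = is_mat_hom[OF assms(1)] and M = is_mat_hom[OF assms(2)]
  let ?F = "\<lambda>b. {c. N c b \<noteq> Zero C (X b) (Y c)}"
  have entry: "(M \<odot>\<^sub>C N) a b = finsum (Hom C (X b) (Z a)) (\<lambda>c. Comp C (M a c) (N c b)) (?F b)"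
    for a b by (rule fam_Comp_entry[OF assms is_mat_finite[OF assms(1)]]) auto
  have closed: "(M \<odot>\<^sub>C N) a b \<in> homset C (X b) (Z a)" for a b
  proof -
    interpret abelian_group "Hom C (X b) (Z a)"
      using Hom_abelian_group is_mat_Obj assms by blast
    show ?thesis unfolding entry using Comp_closed[OF N M] by (intro finsum_closed) auto
  qed
  have "{a. (M \<odot>\<^sub>C N) a b \<noteq> Zero C (X b) (Z a)}
      \<subseteq> (\<Union>c\<in>?F b. {a. M a c \<noteq> Zero C (Y c) (Z a)})" for b
  proof (intro subsetI, rule ccontr)
    fix a assume "a \<in> {a. (M \<odot>\<^sub>C N) a b \<noteq> Zero C (X b) (Z a)}"
      and "a \<notin> (\<Union>c\<in>?F b. {a. M a c \<noteq> Zero C (Y c) (Z a)})"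
    moreover from this(2) have "Comp C (M a c) (N c b) = Zero C (X b) (Z a)" if "c \<in> ?F b" for c
      using that Comp_Zero_left[OF N] is_mat_Obj[OF assms(2)] by auto
    moreover interpret abelian_group "Hom C (X b) (Z a)"
      using Hom_abelian_group is_mat_Obj assms by blast
    have "finsum (Hom C (X b) (Z a)) (\<lambda>c. Comp C (M a c) (N c b)) (?F b) = Zero C (X b) (Z a)"
      if "\<And>c. c \<in> ?F b \<Longrightarrow> Comp C (M a c) (N c b) = Zero C (X b) (Z a)"
      using add.finprod_one_eqI[of "?F b"] that by simp
    ultimately show False using entry by simp
  qed
  then have "finite {a. (M \<odot>\<^sub>C N) a b \<noteq> Zero C (X b) (Z a)}" for b
    by (rule finite_subset) (use is_mat_finite assms in blast)
  then show ?thesis using closed is_mat_Obj assms by (simp add: is_mat_def)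
qed

lemma fam_Comp_assoc:
  assumes "is_mat C W X P" "is_mat C X Y N" "is_mat C Y Z M"
  shows "M \<odot>\<^sub>C (N \<odot>\<^sub>C P) = (M \<odot>\<^sub>C N) \<odot>\<^sub>C P"
proof (intro ext)
  fix a b
  note P = is_mat_hom[OF assms(1)] and N = is_mat_hom[OF assms(2)] and M = is_mat_hom[OF assms(3)]
  note obj = is_mat_Obj[OF assms(1)] is_mat_Obj[OF assms(3)]
  \<comment> \<open>finite index sets that contain the support of column \<open>b\<close> of \<open>P\<close>, respectively of \<open>N P\<close>\<close>
  let ?E = "{e. P e b \<noteq> Zero C (W b) (X e)}"
  let ?F = "\<Union>e\<in>?E. {c. N c e \<noteq> Zero C (X e) (Y c)}"
  have E: "finite ?E" and F: "finite ?F" using is_mat_finite assms by blast+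
  let ?t = "\<lambda>c e. Comp C (Comp C (M a c) (N c e)) (P e b)"
  have t: "?t c e \<in> homset C (W b) (Z a)" for c e
    using Comp_closed[OF P Comp_closed[OF N M]] .
  let ?sum = "finsum (Hom C (W b) (Z a))"
  interpret H: abelian_group "Hom C (W b) (Z a)" using Hom_abelian_group obj by blast
  have NP: "(N \<odot>\<^sub>C P) c b = finsum (Hom C (W b) (Y c)) (\<lambda>e. Comp C (N c e) (P e b)) ?E" for c
    by (rule fam_Comp_entry[OF assms(1,2) E]) auto
  have MN: "(M \<odot>\<^sub>C N) a e = finsum (Hom C (X e) (Z a)) (\<lambda>c. Comp C (M a c) (N c e)) ?F"
    if "e \<in> ?E" for e
    by (rule fam_Comp_entry[OF assms(2,3) F]) (use that in auto)
  have NP0: "(N \<odot>\<^sub>C P) c b = Zero C (W b) (Y c)" if "c \<notin> ?F" for c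
  proof -
    interpret abelian_group "Hom C (W b) (Y c)"
      using Hom_abelian_group obj is_mat_Obj[OF assms(2)] by blast
    show ?thesis unfolding NP
      using that Comp_Zero_left[OF P] is_mat_Obj[OF assms(2)]
      by (subst add.finprod_one_eqI) auto
  qed
  have "(M \<odot>\<^sub>C (N \<odot>\<^sub>C P)) a b
      = ?sum (\<lambda>c. Comp C (M a c) ((N \<odot>\<^sub>C P) c b)) ?F"
    by (rule fam_Comp_entry[OF fam_Comp_closed[OF assms(1,2)] assms(3) F NP0])
  also have "\<dots> = ?sum (\<lambda>c. ?sum (\<lambda>e. ?t c e) ?E) ?F"
  proof (rule H.finsum_cong'[OF refl])
    fix c
    have "Comp C (M a c) ((N \<odot>\<^sub>C P) c b)
        = ?sum (\<lambda>e. Comp C (M a c) (Comp C (N c e) (P e b))) ?E"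
      unfolding NP
      by (rule additive_map.map_finsum[OF additive_map_Comp_left[OF M obj(1)] E])
        (rule Comp_closed[OF P N])
    then show "Comp C (M a c) ((N \<odot>\<^sub>C P) c b) = ?sum (\<lambda>e. ?t c e) ?E"
      using Comp_assoc[OF P N M] by simp
  qed (use t in \<open>auto intro!: H.finsum_closed\<close>)
  also have "\<dots> = ?sum (\<lambda>e. ?sum (\<lambda>c. ?t c e) ?F) ?E"
    using obj F E t by (rule_tac finsum_swap) auto
  also have "\<dots> = ?sum (\<lambda>e. Comp C ((M \<odot>\<^sub>C N) a e) (P e b)) ?E"
  proof (rule H.finsum_cong'[OF refl])
    fix e assume e: "e \<in> ?E"
    show "?sum (\<lambda>c. ?t c e) ?F = Comp C ((M \<odot>\<^sub>C N) a e) (P e b)"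
      unfolding MN[OF e]
      by (rule additive_map.map_finsum[OF additive_map_Comp_right[OF P obj(4)] F, symmetric])
        (rule Comp_closed[OF N M])
  qed (use Comp_closed[OF P is_mat_hom[OF fam_Comp_closed[OF assms(2,3)]]] in auto)
  also have "\<dots> = ((M \<odot>\<^sub>C N) \<odot>\<^sub>C P) a b"
    by (rule fam_Comp_entry[OF assms(1) fam_Comp_closed[OF assms(2,3)] E, symmetric]) auto
  finally show "(M \<odot>\<^sub>C (N \<odot>\<^sub>C P)) a b
      = ((M \<odot>\<^sub>C N) \<odot>\<^sub>C P) a b" .
qed

lemma is_mat_diag:
  assumes "\<And>a. f a \<in> homset C (X a) (Y a)"
  shows "is_mat C X Y (diag_mat C X Y f)"
proof -
  have XY: "X a \<in> Obj C" "Y a \<in> Obj C" for a using homset_Obj assms by blast+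
  have "finite {a. diag_mat C X Y f a b \<noteq> Zero C (X b) (Y a)}" for b
    by (rule finite_subset[of _ "{b}"]) (auto simp: diag_mat_def)
  then show ?thesis using assms XY Zero_closed by (auto simp: is_mat_def diag_mat_def)
qed

lemma Comp_diag_right:
  assumes "\<And>a. f a \<in> homset C (X a) (Y a)" "is_mat C Y Z M"
  shows "(M \<odot>\<^sub>C diag_mat C X Y f) a b = Comp C (M a b) (f b)"
proof -
  note M = is_mat_hom[OF assms(2)]
  have XZ: "X b \<in> Obj C" "Z a \<in> Obj C" using homset_Obj(1)[OF assms(1)] is_mat_Obj(2)[OF assms(2)] by blast+
  interpret abelian_group "Hom C (X b) (Z a)" by (rule Hom_abelian_group[OF XZ])
  have "(M \<odot>\<^sub>C diag_mat C X Y f) a b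
      = finsum (Hom C (X b) (Z a)) (\<lambda>c. Comp C (M a c) (diag_mat C X Y f c b)) {b}"
    by (rule fam_Comp_entry[OF is_mat_diag[OF assms(1)] assms(2)]) (auto simp: diag_mat_def)
  then show ?thesis
    using Comp_closed[OF assms(1) M] Add_Zero[OF Comp_closed[OF assms(1) M]] by (simp add: diag_mat_def)
qed

lemma Comp_diag_left:
  assumes "is_mat C X Y M" "\<And>a. f a \<in> homset C (Y a) (Z a)"
  shows "(diag_mat C Y Z f \<odot>\<^sub>C M) a b = Comp C (f a) (M a b)"
proof -
  note M = is_mat_hom[OF assms(1)]
  have XZ: "X b \<in> Obj C" "Z a \<in> Obj C" using homset_Obj(2)[OF assms(2)] is_mat_Obj(1)[OF assms(1)] by blast+
  interpret abelian_group "Hom C (X b) (Z a)" by (rule Hom_abelian_group[OF XZ])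
  let ?F = "insert a {c. M c b \<noteq> Zero C (X b) (Y c)}"
  have F: "finite ?F" using is_mat_finite[OF assms(1)] by simp
  have "(diag_mat C Y Z f \<odot>\<^sub>C M) a b
      = finsum (Hom C (X b) (Z a)) (\<lambda>c. Comp C (diag_mat C Y Z f a c) (M c b)) ?F"
    by (rule fam_Comp_entry[OF assms(1) is_mat_diag[OF assms(2)] F]) auto
  also have "\<dots> = finsum (Hom C (X b) (Z a)) (\<lambda>c. Comp C (diag_mat C Y Z f a c) (M c b)) {a}"
  proof (rule add.finprod_mono_neutral_cong_right[OF F])
    show "Comp C (diag_mat C Y Z f a c) (M c b) = \<zero>\<^bsub>Hom C (X b) (Z a)\<^esub>" if "c \<in> ?F - {a}" for c
      using that Comp_Zero_left[OF M XZ(2)] by (auto simp: diag_mat_def)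
    show "(\<lambda>c. Comp C (diag_mat C Y Z f a c) (M c b)) \<in> ?F \<rightarrow> homset C (X b) (Z a)"
      using Comp_closed[OF M is_mat_hom[OF is_mat_diag[of f Y Z, OF assms(2)]]] by blast
  qed auto
  also have "\<dots> = Comp C (f a) (M a b)"
    using Comp_closed[OF M assms(2)] Add_Zero[OF Comp_closed[OF M assms(2)]] by (simp add: diag_mat_def)
  finally show ?thesis .
qed

lemma Comp_diag_diag:
  assumes "\<And>a. f a \<in> homset C (X a) (Y a)" "\<And>a. g a \<in> homset C (Y a) (Z a)"
  shows "diag_mat C Y Z g \<odot>\<^sub>C diag_mat C X Y f = diag_mat C X Z (\<lambda>a. Comp C (g a) (f a))"
proof (intro ext)
  fix a b
  show "(diag_mat C Y Z g \<odot>\<^sub>C diag_mat C X Y f) a b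
      = diag_mat C X Z (\<lambda>a. Comp C (g a) (f a)) a b"
    using Comp_diag_left[OF is_mat_diag[OF assms(1)] assms(2)] Comp_Zero_right[OF assms(2)]
      homset_Obj[OF assms(1)]
    by (simp add: diag_mat_def)
qed

lemma fam_Add_closed:
  assumes "is_mat C X Y M" "is_mat C X Y N"
  shows "is_mat C X Y (\<lambda>a b. Add C (M a b) (N a b))"
proof -
  have "{a. Add C (M a b) (N a b) \<noteq> Zero C (X b) (Y a)}
      \<subseteq> {a. M a b \<noteq> Zero C (X b) (Y a)} \<union> {a. N a b \<noteq> Zero C (X b) (Y a)}" for b
    using Zero_Add[OF Zero_closed[OF is_mat_Obj[OF assms(1)]]] by auto
  then have "finite {a. Add C (M a b) (N a b) \<noteq> Zero C (X b) (Y a)}" for b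
    by (rule finite_subset) (use is_mat_finite assms in blast)
  then show ?thesis
    using assms Add_closed by (simp add: is_mat_def)
qed

lemma fam_neg_closed:
  assumes "is_mat C X Y M"
  shows "is_mat C X Y (\<lambda>a b. neg C (M a b))"
proof -
  have "{a. neg C (M a b) \<noteq> Zero C (X b) (Y a)} \<subseteq> {a. M a b \<noteq> Zero C (X b) (Y a)}" for b
    using neg_Zero is_mat_Obj[OF assms] by auto
  then have "finite {a. neg C (M a b) \<noteq> Zero C (X b) (Y a)}" for b
    by (rule finite_subset) (use is_mat_finite assms in blast)
  then show ?thesis
    using assms neg_closed by (simp add: is_mat_def)
qed

lemma fam_Zero_closed:
  assumes "\<And>a. X a \<in> Obj C" "\<And>a. Y a \<in> Obj C"
  shows "is_mat C X Y (\<lambda>a b. Zero C (X b) (Y a))"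
  using assms Zero_closed by (simp add: is_mat_def)

lemma fam_Comp_Add_right:
  assumes "is_mat C X Y N" "is_mat C X Y N'" "is_mat C Y Z M"
  shows "(M \<odot>\<^sub>C (\<lambda>a b. Add C (N a b) (N' a b))) a b
       = Add C ((M \<odot>\<^sub>C N) a b) ((M \<odot>\<^sub>C N') a b)"
proof -
  note N = is_mat_hom[OF assms(1)] and N' = is_mat_hom[OF assms(2)] and M = is_mat_hom[OF assms(3)]
  interpret abelian_group "Hom C (X b) (Z a)"
    by (rule Hom_abelian_group[OF is_mat_Obj(1)[OF assms(1)] is_mat_Obj(2)[OF assms(3)]])
  let ?F = "{c. N c b \<noteq> Zero C (X b) (Y c)} \<union> {c. N' c b \<noteq> Zero C (X b) (Y c)}"
  have F: "finite ?F" using is_mat_finite assms by blast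
  have "(M \<odot>\<^sub>C (\<lambda>a b. Add C (N a b) (N' a b))) a b
      = finsum (Hom C (X b) (Z a)) (\<lambda>c. Comp C (M a c) (Add C (N c b) (N' c b))) ?F"
    by (rule fam_Comp_entry[OF fam_Add_closed[OF assms(1,2)] assms(3) F])
      (use Zero_Add[OF Zero_closed[OF is_mat_Obj[OF assms(1)]]] in auto)
  also have "\<dots> = finsum (Hom C (X b) (Z a))
      (\<lambda>c. Comp C (M a c) (N c b) \<oplus>\<^bsub>Hom C (X b) (Z a)\<^esub> Comp C (M a c) (N' c b)) ?F"
    using Comp_Add_right[OF N N' M] by simp
  also have "\<dots> = finsum (Hom C (X b) (Z a)) (\<lambda>c. Comp C (M a c) (N c b)) ?F \<oplus>\<^bsub>Hom C (X b) (Z a)\<^esub>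
      finsum (Hom C (X b) (Z a)) (\<lambda>c. Comp C (M a c) (N' c b)) ?F"
    by (rule finsum_addf) (use Comp_closed N N' M in blast)+
  finally show ?thesis
    using fam_Comp_entry[OF assms(1,3) F, of b a] fam_Comp_entry[OF assms(2,3) F, of b a] by simp
qed

lemma fam_Comp_Add_left:
  assumes "is_mat C X Y N" "is_mat C Y Z M" "is_mat C Y Z M'"
  shows "((\<lambda>a b. Add C (M a b) (M' a b)) \<odot>\<^sub>C N) a b
       = Add C ((M \<odot>\<^sub>C N) a b) ((M' \<odot>\<^sub>C N) a b)"
proof -
  note N = is_mat_hom[OF assms(1)] and M = is_mat_hom[OF assms(2)] and M' = is_mat_hom[OF assms(3)]
  interpret abelian_group "Hom C (X b) (Z a)"
    by (rule Hom_abelian_group[OF is_mat_Obj(1)[OF assms(1)] is_mat_Obj(2)[OF assms(3)]])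
  let ?F = "{c. N c b \<noteq> Zero C (X b) (Y c)}"
  have F: "finite ?F" using is_mat_finite assms by blast
  have "((\<lambda>a b. Add C (M a b) (M' a b)) \<odot>\<^sub>C N) a b
      = finsum (Hom C (X b) (Z a)) (\<lambda>c. Comp C (Add C (M a c) (M' a c)) (N c b)) ?F"
    by (rule fam_Comp_entry[OF assms(1) fam_Add_closed[OF assms(2,3)] F]) auto
  also have "\<dots> = finsum (Hom C (X b) (Z a))
      (\<lambda>c. Comp C (M a c) (N c b) \<oplus>\<^bsub>Hom C (X b) (Z a)\<^esub> Comp C (M' a c) (N c b)) ?F"
    using Comp_Add_left[OF N M M'] by simp
  also have "\<dots> = finsum (Hom C (X b) (Z a)) (\<lambda>c. Comp C (M a c) (N c b)) ?F \<oplus>\<^bsub>Hom C (X b) (Z a)\<^esub>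
      finsum (Hom C (X b) (Z a)) (\<lambda>c. Comp C (M' a c) (N c b)) ?F"
    by (rule finsum_addf) (use Comp_closed N M M' in blast)+
  finally show ?thesis
    using fam_Comp_entry[OF assms(1,2) F, of b a] fam_Comp_entry[OF assms(1,3) F, of b a] by simp
qed

lemma fam_biproduct:
  assumes "\<And>a. is_biproduct C (X a) (Y a) (S a) (i a) (j a) (p a) (q a)"
  shows "is_biproduct (fam_cat C) X Y S
    (diag_mat C X S i) (diag_mat C Y S j) (diag_mat C S X p) (diag_mat C S Y q)"
proof -
  have S: "S a \<in> Obj C" and i: "i a \<in> homset C (X a) (S a)" and j: "j a \<in> homset C (Y a) (S a)"
    and p: "p a \<in> homset C (S a) (X a)" and q: "q a \<in> homset C (S a) (Y a)"
    and eqs: "Comp C (p a) (i a) = Idn C (X a)" "Comp C (q a) (j a) = Idn C (Y a)"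
      "Comp C (q a) (i a) = Zero C (X a) (Y a)" "Comp C (p a) (j a) = Zero C (Y a) (X a)"
      "Add C (Comp C (i a) (p a)) (Comp C (j a) (q a)) = Idn C (S a)" for a
    using assms unfolding is_biproduct_def by blast+
  have "Add C (diag_mat C S S (\<lambda>a. Comp C (i a) (p a)) a b) (diag_mat C S S (\<lambda>a. Comp C (j a) (q a)) a b)
      = diag_mat C S S (\<lambda>a. Idn C (S a)) a b" for a b
    using eqs(5) Zero_Add[OF Zero_closed[OF S S]] by (simp add: diag_mat_def)
  moreover have "diag_mat C X Y (\<lambda>a. Zero C (X a) (Y a)) = (\<lambda>a b. Zero C (X b) (Y a))"
    "diag_mat C Y X (\<lambda>a. Zero C (Y a) (X a)) = (\<lambda>a b. Zero C (Y b) (X a))"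
    by (auto simp: diag_mat_def fun_eq_iff)
  ultimately show ?thesis
    using S is_mat_diag i j p q
    by (simp add: is_biproduct_def fam_hom fam_Idn Comp_diag_diag eqs)
qed


lemma additive_fam_cat: "additive_category (fam_cat C)"
proof (intro additive_category.intro category.intro additive_category_axioms.intro)
  fix M assume "M \<in> Arr (fam_cat C)"
  then have "M \<in> homset (fam_cat C) (Dom (fam_cat C) M) (Cod (fam_cat C) M)" by (simp add: homset_iff)
  then show "Dom (fam_cat C) M \<in> Obj (fam_cat C)" "Cod (fam_cat C) M \<in> Obj (fam_cat C)"
    by (simp_all add: fam_hom is_mat_def)
next
  fix X assume "X \<in> Obj (fam_cat C)"
  then show "Idn (fam_cat C) X \<in> homset (fam_cat C) X X"
    by (simp add: fam_hom fam_Idn is_mat_diag Idn_closed)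
next
  fix M N X Y Z assume "M \<in> homset (fam_cat C) X Y" "N \<in> homset (fam_cat C) Y Z"
  then show "N \<odot>\<^sub>C M \<in> homset (fam_cat C) X Z"
    by (simp add: fam_hom fam_Comp_closed)
next
  fix M X Y assume "M \<in> homset (fam_cat C) X Y"
  then have M: "is_mat C X Y M" by (simp add: fam_hom)
  have I: "Idn C (X a) \<in> homset C (X a) (X a)" "Idn C (Y a) \<in> homset C (Y a) (Y a)" for a
    using Idn_closed is_mat_Obj[OF M] by auto
  show "M \<odot>\<^sub>C Idn (fam_cat C) X = M"
    by (intro ext) (simp add: fam_Idn Comp_diag_right[OF I(1) M] Comp_Idn[OF is_mat_hom[OF M]])
  show "Idn (fam_cat C) Y \<odot>\<^sub>C M = M"
    by (intro ext) (simp add: fam_Idn Comp_diag_left[OF M I(2)] Idn_Comp[OF is_mat_hom[OF M]])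
next
  fix M N P W X Y Z
  assume "P \<in> homset (fam_cat C) W X" "N \<in> homset (fam_cat C) X Y" "M \<in> homset (fam_cat C) Y Z"
  then show "M \<odot>\<^sub>C (N \<odot>\<^sub>C P) = (M \<odot>\<^sub>C N) \<odot>\<^sub>C P"
    by (simp add: fam_hom fam_Comp_assoc)
next
  fix X Y assume "X \<in> Obj (fam_cat C)" "Y \<in> Obj (fam_cat C)"
  then have XY: "X a \<in> Obj C" "Y a \<in> Obj C" for a by auto
  show "abelian_group (Hom (fam_cat C) X Y)"
  proof (rule abelian_groupI, goal_cases)
    case (6 M)
    then have M: "is_mat C X Y M" by (simp add: fam_hom)
    have "(\<lambda>a b. Add C (neg C (M a b)) (M a b)) = (\<lambda>a b. Zero C (X b) (Y a))"
      using neg_Add[OF is_mat_hom[OF M]] by simp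
    then show ?case using fam_neg_closed[OF M] unfolding fam_hom[symmetric] by auto
  qed (use XY in \<open>auto simp: fam_hom fam_Add_closed fam_Zero_closed fun_eq_iff
      intro: Add_assoc[OF is_mat_hom is_mat_hom is_mat_hom] Add_commute[OF is_mat_hom is_mat_hom]
        Zero_Add[OF is_mat_hom]\<close>)
next
  fix M N N' X Y Z
  assume "N \<in> homset (fam_cat C) X Y" "N' \<in> homset (fam_cat C) X Y" "M \<in> homset (fam_cat C) Y Z"
  then show "M \<odot>\<^sub>C Add (fam_cat C) N N' = Add (fam_cat C) (M \<odot>\<^sub>C N) (M \<odot>\<^sub>C N')"
    by (intro ext) (simp add: fam_hom fam_Comp_Add_right)
next
  fix M M' N X Y Z
  assume "N \<in> homset (fam_cat C) X Y" "M \<in> homset (fam_cat C) Y Z" "M' \<in> homset (fam_cat C) Y Z"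
  then show "Add (fam_cat C) M M' \<odot>\<^sub>C N = Add (fam_cat C) (M \<odot>\<^sub>C N) (M' \<odot>\<^sub>C N)"
    by (intro ext) (simp add: fam_hom fam_Comp_Add_left)
next
  obtain Z where Z: "zero_object C Z" using zero_object_exists by blast
  then have ZO: "Z \<in> Obj C" by (simp add: zero_object_def)
  have "\<exists>!M. M \<in> homset (fam_cat C) X Y" if "X \<in> Obj (fam_cat C)" "Y \<in> Obj (fam_cat C)"
    "\<And>a b. zero_object C (X b) \<or> zero_object C (Y a)" for X Y
  proof
    show "(\<lambda>a b. Zero C (X b) (Y a)) \<in> homset (fam_cat C) X Y"
      using that fam_Zero_closed by (simp add: fam_hom)
    show "M = (\<lambda>a b. Zero C (X b) (Y a))" if "M \<in> homset (fam_cat C) X Y" for M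
      using homset_zero_object[OF is_mat_hom] \<open>\<And>a b. zero_object C (X b) \<or> zero_object C (Y a)\<close> that
      by (auto simp: fam_hom fun_eq_iff)
  qed
  then have "zero_object (fam_cat C) (\<lambda>_. Z)" using Z ZO by (simp add: zero_object_def[of "fam_cat C"])
  then show "\<exists>Z. zero_object (fam_cat C) Z" by blast
next
  fix X Y assume "X \<in> Obj (fam_cat C)" "Y \<in> Obj (fam_cat C)"
  then have XY: "X a \<in> Obj C" "Y a \<in> Obj C" for a by auto
  have "\<forall>a. \<exists>S i j p q. is_biproduct C (X a) (Y a) S i j p q" using biproduct_exists XY by blast
  then obtain S i j p q where S: "\<And>a. is_biproduct C (X a) (Y a) (S a) (i a) (j a) (p a) (q a)"
    by metis
  then show "\<exists>S i j p q. is_biproduct (fam_cat C) X Y S i j p q"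
    using fam_biproduct by blast
qed

end

(* From here on, equations between matrices are derived from the category axioms; entries are unfolded on demand. *)
declare fam_simps(2,3) [simp del]

section \<open>Indices\<close>

abbreviation coord :: "idx \<Rightarrow> nat \<Rightarrow> int" where
  "coord \<equiv> Poly_Mapping.lookup"

lemma lookup_pi [simp]: "coord (\<pi> k a) i = (if i < k then coord a i else 0)"
  by transfer simp

lemma lookup_sigma [simp]: "coord (\<sigma> k a) i = coord a (k + i)"
  by transfer simp

lemma lookup_eps: "coord (\<epsilon> i) j = (if j = i then 1 else 0)"
  by (simp add: lookup_single when_def)

lemma eps_inject [simp]: "\<epsilon> i = \<epsilon> j \<longleftrightarrow> i = j"
  by (metis lookup_eps zero_neq_one)

lemma ht_superset: "\<lbrakk>finite S; Poly_Mapping.keys a \<subseteq> S\<rbrakk> \<Longrightarrow> ht a = (\<Sum>i\<in>S. coord a i)"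
  unfolding ht_def by (rule sum.mono_neutral_left) (auto simp: in_keys_iff)

lemma ht_add: "ht (a + b) = ht a + ht b"
proof -
  let ?S = "Poly_Mapping.keys a \<union> Poly_Mapping.keys b"
  have "finite ?S" by simp
  moreover have "Poly_Mapping.keys (a + b) \<subseteq> ?S" by (rule Poly_Mapping.keys_add)
  ultimately show ?thesis
    by (simp add: ht_superset[of ?S] lookup_add sum.distrib)
qed

lemma ht_0 [simp]: "ht 0 = 0"
  by (simp add: ht_def)

lemma ht_eps [simp]: "ht (\<epsilon> i) = 1"
  by (simp add: ht_def lookup_eps)

lemma pi_add: "\<pi> n (a + b) = \<pi> n a + \<pi> n b"
  by (rule poly_mapping_eqI) (simp add: lookup_add)

lemma sigma_add: "\<sigma> n (a + b) = \<sigma> n a + \<sigma> n b"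
  by (rule poly_mapping_eqI) (simp add: lookup_add)

lemma pi_eps [simp]: "\<pi> n (\<epsilon> i) = (if i < n then \<epsilon> i else 0)"
  by (rule poly_mapping_eqI) (auto simp: lookup_eps)

lemma sigma_eps [simp]: "\<sigma> n (\<epsilon> i) = (if i < n then 0 else \<epsilon> (i - n))"
  by (rule poly_mapping_eqI) (auto simp: lookup_eps)

lemma pi_0 [simp]: "\<pi> 0 a = 0" and sigma_0 [simp]: "\<sigma> 0 a = a"
  by (rule poly_mapping_eqI; simp)+

lemma pi_pi: "\<pi> n (\<pi> (n + m) a) = \<pi> n a"
  by (rule poly_mapping_eqI) simp

lemma sigma_pi: "\<sigma> n (\<pi> (n + m) a) = \<pi> m (\<sigma> n a)"
  by (rule poly_mapping_eqI) simp

lemma sigma_sigma: "\<sigma> m (\<sigma> n a) = \<sigma> (n + m) a"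
  by (rule poly_mapping_eqI) (simp add: add.assoc)

lemma pi_idem [simp]: "\<pi> n (\<pi> n a) = \<pi> n a"
  using pi_pi[of n 0] by simp

lemma idx_split_eqI: "\<lbrakk>\<pi> n a = \<pi> n b; \<sigma> n a = \<sigma> n b\<rbrakk> \<Longrightarrow> a = b"
proof (rule poly_mapping_eqI)
  fix i assume eq: "\<pi> n a = \<pi> n b" "\<sigma> n a = \<sigma> n b"
  show "coord a i = coord b i"
  proof (cases "i < n")
    case True
    then show ?thesis using lookup_pi[of n a i] lookup_pi[of n b i] eq by simp
  next
    case False
    then show ?thesis using lookup_sigma[of n a "i - n"] lookup_sigma[of n b "i - n"] eq by simp
  qed
qed

text \<open>The index with first \<open>n\<close> coordinates those of \<open>u\<close>, followed by the coordinates of \<open>v\<close>.\<close>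

lift_definition idx_join :: "nat \<Rightarrow> idx \<Rightarrow> idx \<Rightarrow> idx" is
  "\<lambda>n (u :: nat \<Rightarrow> int) v i. if i < n then u i else v (i - n)"
proof -
  fix n and u v :: "nat \<Rightarrow> int"
  assume "finite {i. v i \<noteq> 0}"
  then have "finite ({..<n} \<union> (\<lambda>i. i + n) ` {i. v i \<noteq> 0})" by simp
  moreover have "{i. (if i < n then u i else v (i - n)) \<noteq> 0} \<subseteq> {..<n} \<union> (\<lambda>i. i + n) ` {i. v i \<noteq> 0}"
    by (force intro: image_eqI[where x = "_ - n"])
  ultimately show "finite {i. (if i < n then u i else v (i - n)) \<noteq> 0}" by (rule rev_finite_subset)
qed

lemma lookup_join [simp]: "coord (idx_join n u v) i = (if i < n then coord u i else coord v (i - n))"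
  by transfer simp

lemma pi_join: "\<pi> n (idx_join n u v) = \<pi> n u" and sigma_join [simp]: "\<sigma> n (idx_join n u v) = v"
  by (rule poly_mapping_eqI; simp)+

lemma join_split [simp]: "idx_join n (\<pi> n a) (\<sigma> n a) = a"
  by (rule idx_split_eqI[of n]) (simp_all add: pi_join)

lemma ht_split: "ht a = ht (\<pi> n a) + ht (\<sigma> n a)"
proof -
  let ?K = "Poly_Mapping.keys a"
  have "ht (\<pi> n a) = (\<Sum>i\<in>?K. coord (\<pi> n a) i)"
    by (rule ht_superset) (auto simp: in_keys_iff split: if_splits)
  also have "\<dots> = (\<Sum>i\<in>?K \<inter> {..<n}. coord a i)"
    by (rule sum.mono_neutral_cong_right) auto
  finally have 1: "ht (\<pi> n a) = (\<Sum>i\<in>?K \<inter> {..<n}. coord a i)" .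
  have "(\<Sum>i\<in>?K - {..<n}. coord a i) = (\<Sum>i\<in>Poly_Mapping.keys (\<sigma> n a). coord (\<sigma> n a) i)"
    by (rule sum.reindex_bij_witness[of _ "\<lambda>i. n + i" "\<lambda>i. i - n"]) (auto simp: in_keys_iff)
  then have 2: "ht (\<sigma> n a) = (\<Sum>i\<in>?K - {..<n}. coord a i)" by (simp add: ht_def)
  show ?thesis unfolding 1 2 by (simp add: ht_def sum.Int_Diff[of ?K _ "{..<n}"])
qed

lemma finite_bounded_level:
  "finite {a. ht a = k \<and> (\<forall>i\<ge>n. coord a i = 0) \<and> (\<forall>i. coord a i < m)}" (is "finite ?S")
proof -
  let ?M = "\<bar>m\<bar>"
  have bound: "coord a j \<in> {k - int n * ?M .. ?M}" if a: "a \<in> ?S" and j: "j < n" for a j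
  proof -
    from a have van: "\<And>i. n \<le> i \<Longrightarrow> coord a i = 0" and lt: "\<And>i. coord a i < m" and k: "ht a = k"
      by simp_all
    have le: "coord a i \<le> ?M" for i using lt[of i] by linarith
    have "Poly_Mapping.keys a \<subseteq> {..<n}" using van by (auto simp: in_keys_iff not_less[symmetric])
    then have "k = (\<Sum>i<n. coord a i)" using k ht_superset[of "{..<n}" a] by simp
    also have "\<dots> = coord a j + (\<Sum>i\<in>{..<n} - {j}. coord a i)"
      using j by (simp add: sum.remove)
    also have "(\<Sum>i\<in>{..<n} - {j}. coord a i) \<le> of_nat (card ({..<n} - {j})) * ?M"
      by (rule sum_bounded_above) (rule le)
    also have "\<dots> \<le> int n * ?M" by (intro mult_right_mono) (simp_all add: j)
    finally have "k - int n * ?M \<le> coord a j" by simp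
    then show ?thesis using le by simp
  qed
  let ?T = "{f. \<forall>x. (x \<in> {..<n} \<longrightarrow> f x \<in> {k - int n * ?M .. ?M}) \<and> (x \<notin> {..<n} \<longrightarrow> f x = 0)}"
  have "finite ?T" by (rule finite_set_of_finite_funs) auto
  moreover have "coord ` ?S \<subseteq> ?T" using bound by (auto simp: not_less)
  ultimately have "finite (coord ` ?S)" by (rule rev_finite_subset)
  then show ?thesis by (rule finite_imageD) (auto simp: inj_on_def poly_mapping_eqI)
qed

section \<open>Pyramids as families with a differential\<close>

text \<open>
  A homogeneous matrix of degree \<open>p\<close> raises the height by \<open>p\<close>: differentials have degree 1,
  morphisms degree 0 and homotopies degree \<open>-1\<close>.
\<close>

definition homog ::
  "('o, 'm) cat \<Rightarrow> int \<Rightarrow> (idx \<Rightarrow> 'o) \<Rightarrow> (idx \<Rightarrow> 'o) \<Rightarrow> (idx \<Rightarrow> idx \<Rightarrow> 'm) \<Rightarrow> bool" where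
  "homog B p X Y M \<longleftrightarrow> M \<in> homset (fam_cat B) X Y \<and>
     (\<forall>a b. ht a \<noteq> ht b + p \<longrightarrow> M a b = Zero B (X b) (Y a))"

text \<open>
  The morphism record with the entries of the full matrix \<open>M\<close>. All its blocks \<open>M\<^sup>(\<^sup>k\<^sup>)\<close> are read off from
  \<open>M\<close>; entries between indices of different heights are dropped.
\<close>

definition pmor_of ::
  "('o, 'm) pyr \<Rightarrow> ('o, 'm) pyr \<Rightarrow> (idx \<Rightarrow> idx \<Rightarrow> 'm) \<Rightarrow> ('o, 'm) pmor" where
  "pmor_of X Y M = \<lparr>psrc = X, ptgt = Y, pent = level_restrict (\<lambda>k. M)\<rparr>"

text \<open>The matrices \<open>M\<close> for which \<^const>\<open>pmor_of\<close> is a morphism of pyramids.\<close>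

definition chain_map ::
  "('o, 'm) cat \<Rightarrow> ('o, 'm) pyr \<Rightarrow> ('o, 'm) pyr \<Rightarrow> (idx \<Rightarrow> idx \<Rightarrow> 'm) \<Rightarrow> bool" where
  "chain_map B X Y M \<longleftrightarrow> is_pyramid B X \<and> is_pyramid B Y \<and> homog B 0 (pobj X) (pobj Y) M \<and>
     M \<odot>\<^sub>B diff_mat B X = diff_mat B Y \<odot>\<^sub>B M"

text \<open>Null homotopy, with the homotopy written as one matrix \<open>H\<close> of degree \<open>-1\<close>.\<close>

definition null_mat ::
  "('o, 'm) cat \<Rightarrow> ('o, 'm) pyr \<Rightarrow> ('o, 'm) pyr \<Rightarrow> (idx \<Rightarrow> idx \<Rightarrow> 'm) \<Rightarrow> bool" where
  "null_mat B X Y M \<longleftrightarrow> (\<exists>H. homog B (-1) (pobj X) (pobj Y) H \<and>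
     M = (H \<odot>\<^sub>B diff_mat B X) \<boxplus>\<^sub>B (diff_mat B Y \<odot>\<^sub>B H))"

lemma homog_hom: "homog B p X Y M \<Longrightarrow> M \<in> homset (fam_cat B) X Y"
  by (simp add: homog_def)

lemma homog_mat: "homog B p X Y M \<Longrightarrow> is_mat B X Y M"
  by (simp add: homog_def fam_hom)

lemma homog_entry: "homog B p X Y M \<Longrightarrow> M a b \<in> homset B (X b) (Y a)"
  by (rule is_mat_hom[OF homog_mat])

lemma homog_zero: "\<lbrakk>homog B p X Y M; ht a \<noteq> ht b + p\<rbrakk> \<Longrightarrow> M a b = Zero B (X b) (Y a)"
  by (simp add: homog_def)

lemma homog_ext:
  assumes "homog B p X Y M" "homog B p X Y N" "\<And>a b. ht a = ht b + p \<Longrightarrow> M a b = N a b"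
  shows "M = N"
proof (intro ext)
  fix a b show "M a b = N a b"
    using assms(3) homog_zero[OF assms(1)] homog_zero[OF assms(2)] by (cases "ht a = ht b + p") auto
qed

lemma pyramid_Obj: "is_pyramid B X \<Longrightarrow> pobj X a \<in> Obj B"
  by (simp add: is_pyramid_def)

lemma pyramid_diff: "is_pyramid B X \<Longrightarrow> pdiff X a i \<in> homset B (pobj X a) (pobj X (a + \<epsilon> i))"
  by (simp add: is_pyramid_def)

lemma pyramid_rank: "\<lbrakk>is_pyramid B X; prank X \<le> i; coord a i \<noteq> 0\<rbrakk> \<Longrightarrow> zero_object B (pobj X a)"
  unfolding is_pyramid_def by blast

lemma pyramid_bounded: "is_pyramid B X \<Longrightarrow> \<exists>m. \<forall>a i. m \<le> coord a i \<longrightarrow> zero_object B (pobj X a)"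
  unfolding is_pyramid_def by (meson not_less)

lemma pyramid_diff_diff: "is_pyramid B X \<Longrightarrow>
    Comp B (pdiff X (a + \<epsilon> i) i) (pdiff X a i) = Zero B (pobj X a) (pobj X (a + \<epsilon> i + \<epsilon> i))"
  unfolding is_pyramid_def by blast

lemma pyramid_anticommute: "is_pyramid B X \<Longrightarrow>
    Comp B (pdiff X (a + \<epsilon> i) j) (pdiff X a i) = neg B (Comp B (pdiff X (a + \<epsilon> j) i) (pdiff X a j))"
  unfolding is_pyramid_def by blast

lemma pyramidI:
  assumes "\<And>a. pobj X a \<in> Obj B"
    and "\<And>a i. pdiff X a i \<in> homset B (pobj X a) (pobj X (a + \<epsilon> i))"
    and "\<And>a i. \<lbrakk>prank X \<le> i; coord a i \<noteq> 0\<rbrakk> \<Longrightarrow> zero_object B (pobj X a)"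
    and "\<And>a i. m \<le> coord a i \<Longrightarrow> zero_object B (pobj X a)"
    and "\<And>a i. Comp B (pdiff X (a + \<epsilon> i) i) (pdiff X a i) = Zero B (pobj X a) (pobj X (a + \<epsilon> i + \<epsilon> i))"
    and "\<And>a i j. Comp B (pdiff X (a + \<epsilon> i) j) (pdiff X a i)
           = neg B (Comp B (pdiff X (a + \<epsilon> j) i) (pdiff X a j))"
  shows "is_pyramid B X"
  unfolding is_pyramid_def using assms by (meson not_less)

text \<open>
  The vanishing conditions leave finitely many nonzero objects in each height: the coordinates are
  bounded above, and hence also below once their sum is given.
\<close>

lemma pyramid_finite_level:
  assumes "is_pyramid B X"
  shows "finite {a. ht a = k \<and> \<not> zero_object B (pobj X a)}"
proof -
  obtain m where m: "\<And>a i. m \<le> coord a i \<Longrightarrow> zero_object B (pobj X a)"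
    using pyramid_bounded[OF assms] by blast
  have "{a. ht a = k \<and> \<not> zero_object B (pobj X a)}
      \<subseteq> {a. ht a = k \<and> (\<forall>i\<ge>prank X. coord a i = 0) \<and> (\<forall>i. coord a i < m)}"
    using m pyramid_rank[OF assms] by (auto simp: not_le[symmetric])
  then show ?thesis by (rule finite_subset) (rule finite_bounded_level)
qed

lemma diff_mat_eps [simp]: "diff_mat B X (b + \<epsilon> i) b = pdiff X b i"
  by (simp add: diff_mat_def)

lemma diff_mat_zero: "(\<And>i. a \<noteq> b + \<epsilon> i) \<Longrightarrow> diff_mat B X a b = Zero B (pobj X b) (pobj X a)"
  by (simp add: diff_mat_def)

lemma level_iff [simp]: "a \<in> level k \<longleftrightarrow> ht a = k"
  by (simp add: level_def)

lemma pmor_of_simps [simp]: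
  "psrc (pmor_of X Y M) = X" "ptgt (pmor_of X Y M) = Y"
  "pent (pmor_of X Y M) = level_restrict (\<lambda>k. M)"
  by (simp_all add: pmor_of_def)

lemma level_restrict_simp [simp]: "\<lbrakk>ht a = k; ht b = k\<rbrakk> \<Longrightarrow> level_restrict M k a b = M k a b"
  by (simp add: level_restrict_def)

lemma level_restrict_idem [simp]: "level_restrict (level_restrict M) = level_restrict M"
  by (auto simp: level_restrict_def fun_eq_iff)

lemma level_restrict_cong:
  assumes "\<And>k a b. \<lbrakk>ht a = k; ht b = k\<rbrakk> \<Longrightarrow> M k a b = N k a b"
  shows "level_restrict M = level_restrict N"
  using assms by (auto simp: level_restrict_def fun_eq_iff)

lemma pyr_cat_simps [simp]:
  "Obj (pyr_cat B) = {X. is_pyramid B X}" "Arr (pyr_cat B) = {\<alpha>. is_pmor B \<alpha>}"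
  "Dom (pyr_cat B) = psrc" "Cod (pyr_cat B) = ptgt"
  by (simp_all add: pyr_cat_def)

lemma pyr_Idn: "Idn (pyr_cat B) X = pmor_of X X (Idn (fam_cat B) (pobj X))"
  by (auto simp: pyr_cat_def pyr_id_def pmor_of_def fam_cat_def)

lemma pyr_Zero: "Zero (pyr_cat B) X Y = pmor_of X Y (Zero (fam_cat B) (pobj X) (pobj Y))"
  by (simp add: pyr_cat_def pmor_of_def fam_simps)

lemma pyr_Add: "Add (pyr_cat B) (pmor_of X Y M) (pmor_of X Y N) = pmor_of X Y (M \<boxplus>\<^sub>B N)"
  unfolding pmor_of_def fam_simps pyr_cat_def by (simp cong: level_restrict_cong)

context additive_category
begin

abbreviation Fam :: "(idx \<Rightarrow> 'a, idx \<Rightarrow> idx \<Rightarrow> 'b) cat" where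
  "Fam \<equiv> fam_cat C"

abbreviation Pyr :: "(('a, 'b) pyr, ('a, 'b) pmor) cat" where
  "Pyr \<equiv> pyr_cat C"

interpretation fam: additive_category "fam_cat C" by (rule additive_fam_cat)

text \<open>Between pyramids, column-finiteness of a homogeneous matrix is automatic.\<close>

lemma homogI:
  assumes "is_pyramid C X" "is_pyramid C Y"
    and "\<And>a b. M a b \<in> homset C (pobj X b) (pobj Y a)"
    and "\<And>a b. ht a \<noteq> ht b + p \<Longrightarrow> M a b = Zero C (pobj X b) (pobj Y a)"
  shows "homog C p (pobj X) (pobj Y) M"
proof -
  have "{a. M a b \<noteq> Zero C (pobj X b) (pobj Y a)} \<subseteq> {a. ht a = ht b + p \<and> \<not> zero_object C (pobj Y a)}" for b
    using assms(4) homset_zero_object[OF assms(3)] by blast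
  then have "finite {a. M a b \<noteq> Zero C (pobj X b) (pobj Y a)}" for b
    by (rule finite_subset) (rule pyramid_finite_level[OF assms(2)])
  then show ?thesis
    using assms pyramid_Obj by (auto simp: homog_def fam_hom is_mat_def)
qed

lemma homog_Comp:
  assumes "homog C q X Y N" "homog C p Y Z M"
  shows "homog C (p + q) X Z (M \<odot>\<^sub>C N)"
proof -
  note N = homog_mat[OF assms(1)] and M = homog_mat[OF assms(2)]
  have "(M \<odot>\<^sub>C N) a b = Zero C (X b) (Z a)" if "ht a \<noteq> ht b + (p + q)" for a b
  proof -
    interpret abelian_group "Hom C (X b) (Z a)"
      using Hom_abelian_group is_mat_Obj M N by blast
    have *: "Comp C (M a c) (N c b) = Zero C (X b) (Z a)" for c
    proof (cases "ht c = ht b + q")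
      case True
      then have "M a c = Zero C (Y c) (Z a)" using that by (intro homog_zero[OF assms(2)]) simp
      then show ?thesis using Comp_Zero_left[OF is_mat_hom[OF N]] is_mat_Obj[OF M] by simp
    next
      case False
      then have "N c b = Zero C (X b) (Y c)" by (rule homog_zero[OF assms(1)])
      then show ?thesis using Comp_Zero_right[OF is_mat_hom[OF M]] is_mat_Obj[OF N] by simp
    qed
    have "(M \<odot>\<^sub>C N) a b = finsum (Hom C (X b) (Z a)) (\<lambda>c. Comp C (M a c) (N c b))
        {c. N c b \<noteq> Zero C (X b) (Y c)}"
      by (rule fam_Comp_entry[OF N M is_mat_finite[OF N]]) auto
    then show ?thesis using * finsum_zero[simplified] by simp
  qed
  then show ?thesis using fam_Comp_closed[OF N M] by (simp add: homog_def fam_hom)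
qed

lemma homog_Add:
  assumes "homog C p X Y M" "homog C p X Y N"
  shows "homog C p X Y (M \<boxplus>\<^sub>C N)"
  using assms fam.Add_closed[OF homog_hom[OF assms(1)] homog_hom[OF assms(2)]]
    Zero_Add[OF Zero_closed] is_mat_Obj[OF homog_mat[OF assms(1)]]
  by (simp add: homog_def fam_simps)

lemma fam_neg: "M \<in> homset Fam X Y \<Longrightarrow> neg Fam M = (\<lambda>a b. neg C (M a b))"
proof (rule fam.neg_unique[symmetric])
  assume M: "M \<in> homset Fam X Y"
  then show "(\<lambda>a b. neg C (M a b)) \<in> homset Fam X Y" "M \<in> homset Fam X Y"
    using fam_neg_closed by (simp_all add: fam_hom)
  show "(\<lambda>a b. neg C (M a b)) \<boxplus>\<^sub>C M = Zero Fam X Y"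
    using neg_Add[OF is_mat_hom] M by (simp add: fam_simps fam_hom)
qed

lemma homog_neg:
  assumes "homog C p X Y M"
  shows "homog C p X Y (neg Fam M)"
proof -
  note mat = homog_mat[OF assms]
  have "neg C (M a b) = Zero C (X b) (Y a)" if "ht a \<noteq> ht b + p" for a b
    using homog_zero[OF assms that] neg_Zero[OF is_mat_Obj[OF mat]] by simp
  then show ?thesis
    using fam_neg_closed[OF mat] by (simp add: homog_def fam_neg[OF homog_hom[OF assms]] fam_hom)
qed

lemma homog_diff_mat:
  assumes "is_pyramid C X"
  shows "homog C 1 (pobj X) (pobj X) (diff_mat C X)"
proof (rule homogI[OF assms assms])
  fix a b
  show "diff_mat C X a b \<in> homset C (pobj X b) (pobj X a)"
  proof (cases "\<exists>i. a = b + \<epsilon> i")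
    case True
    then show ?thesis using pyramid_diff[OF assms] by auto
  next
    case False
    then show ?thesis using Zero_closed pyramid_Obj[OF assms] diff_mat_zero by metis
  qed
  show "diff_mat C X a b = Zero C (pobj X b) (pobj X a)" if "ht a \<noteq> ht b + 1"
    using that by (intro diff_mat_zero) (auto simp: ht_add)
qed

lemma diff_mat_hom: "is_pyramid C X \<Longrightarrow> diff_mat C X \<in> homset Fam (pobj X) (pobj X)"
  by (rule homog_hom[OF homog_diff_mat])

text \<open>
  A product of matrices over the indices of one height is a product of full matrices, as soon as
  the contributions of the other heights vanish.
\<close>

lemma mat_mult_eq:
  assumes "is_mat C X Y N" "is_mat C Y Z M"
    and "\<And>c. ht c \<noteq> k \<Longrightarrow> N c b = Zero C (X b) (Y c)"
    and "\<And>c. ht c = k \<Longrightarrow> M' a c = M a c" "\<And>c. ht c = k \<Longrightarrow> N' c b = N c b"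
  shows "mat_mult C X Z k M' N' a b = (M \<odot>\<^sub>C N) a b"
proof -
  let ?F = "{c. N c b \<noteq> Zero C (X b) (Y c)}"
  have F: "finite ?F" using is_mat_finite[OF assms(1)] by simp
  have sub: "?F \<subseteq> level k" unfolding level_def using assms(3) by blast
  have "mat_mult C X Z k M' N' a b = hom_sum C (X b) (Z a) (\<lambda>c. Comp C (M a c) (N c b)) (level k)"
    using assms(4,5) unfolding mat_mult_def hom_sum_def
    by (intro abelian_monoid.finsum_cong'[OF abelian_group.axioms(1)[OF Hom_abelian_group]])
      (auto simp: is_mat_Obj[OF assms(1)] is_mat_Obj[OF assms(2)]
        intro: Comp_closed[OF is_mat_hom[OF assms(1)] is_mat_hom[OF assms(2)]])
  also have "\<dots> = finsum (Hom C (X b) (Z a)) (\<lambda>c. Comp C (M a c) (N c b)) ?F"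
  proof (rule hom_sum_eq[OF _ _ F sub])
    show "Comp C (M a c) (N c b) = Zero C (X b) (Z a)" if "c \<in> level k - ?F" for c
      using that Comp_Zero_right[OF is_mat_hom[OF assms(2)]] is_mat_Obj[OF assms(1)] by simp
  qed (use is_mat_Obj assms Comp_closed[OF is_mat_hom[OF assms(1)] is_mat_hom[OF assms(2)]] in blast)+
  also have "\<dots> = (M \<odot>\<^sub>C N) a b"
    by (rule fam_Comp_entry[OF assms(1,2) F, symmetric]) auto
  finally show ?thesis .
qed

lemma chain_map_homog: "chain_map C X Y M \<Longrightarrow> homog C 0 (pobj X) (pobj Y) M"
  by (simp add: chain_map_def)

lemma chain_map_hom: "chain_map C X Y M \<Longrightarrow> M \<in> homset Fam (pobj X) (pobj Y)"
  by (rule homog_hom[OF chain_map_homog])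

lemma chain_map_commute: "chain_map C X Y M \<Longrightarrow> M \<odot>\<^sub>C diff_mat C X = diff_mat C Y \<odot>\<^sub>C M"
  by (simp add: chain_map_def)

lemma chain_map_pyramid: "chain_map C X Y M \<Longrightarrow> is_pyramid C X" "chain_map C X Y M \<Longrightarrow> is_pyramid C Y"
  by (simp_all add: chain_map_def)

text \<open>
  The products with a differential that occur in the definitions of a morphism (\<open>p = 0\<close>) and of a null
  homotopic one (\<open>p = -1\<close>), in terms of full matrices.
\<close>

lemma mat_mult_diff:
  assumes "is_pyramid C X" "is_pyramid C Y" "homog C p (pobj X) (pobj Y) M"
    and "\<And>k a b. \<lbrakk>ht b = k; ht a = k + p\<rbrakk> \<Longrightarrow> \<mu> k a b = M a b" "ht b = k" "ht a = k + p + 1"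
  shows "mat_mult C (pobj X) (pobj Y) (k + 1) (\<mu> (k + 1)) (diff_mat C X) a b = (M \<odot>\<^sub>C diff_mat C X) a b"
    and "mat_mult C (pobj X) (pobj Y) (k + p) (diff_mat C Y) (\<mu> k) a b = (diff_mat C Y \<odot>\<^sub>C M) a b"
proof -
  note D = homog_diff_mat[OF assms(1)] homog_diff_mat[OF assms(2)]
  show "mat_mult C (pobj X) (pobj Y) (k + 1) (\<mu> (k + 1)) (diff_mat C X) a b = (M \<odot>\<^sub>C diff_mat C X) a b"
    using assms(4-) by (intro mat_mult_eq[OF homog_mat[OF D(1)] homog_mat[OF assms(3)]] homog_zero[OF D(1)])
      auto
  show "mat_mult C (pobj X) (pobj Y) (k + p) (diff_mat C Y) (\<mu> k) a b = (diff_mat C Y \<odot>\<^sub>C M) a b"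
    using assms(4-) by (intro mat_mult_eq[OF homog_mat[OF assms(3)] homog_mat[OF D(2)]] homog_zero[OF assms(3)])
      auto
qed

lemma pmor_of_Arr:
  assumes "chain_map C X Y M"
  shows "pmor_of X Y M \<in> homset Pyr X Y"
proof -
  note hom = chain_map_homog[OF assms] and pyr = chain_map_pyramid[OF assms]
  note eqs = mat_mult_diff[OF pyr hom, of "level_restrict (\<lambda>k. M)"]
  have "is_pmor C (pmor_of X Y M)"
    unfolding is_pmor_def Let_def pmor_of_simps
  proof (intro conjI allI ballI)
    fix k a b assume "a \<in> level (k + 1)" "b \<in> level k"
    then show "mat_mult C (pobj X) (pobj Y) (k + 1) (level_restrict (\<lambda>k. M) (k + 1)) (diff_mat C X) a b
        = mat_mult C (pobj X) (pobj Y) k (diff_mat C Y) (level_restrict (\<lambda>k. M) k) a b"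
      using eqs(1)[of b k a] eqs(2)[of b k a] chain_map_commute[OF assms] by simp
  qed (use pyr homog_entry[OF hom] in auto)
  then show ?thesis by (simp add: homset_iff)
qed

lemma pyr_homE:
  assumes "\<alpha> \<in> homset Pyr X Y"
  obtains M where "chain_map C X Y M" "\<alpha> = pmor_of X Y M"
proof -
  have src: "psrc \<alpha> = X" "ptgt \<alpha> = Y" and "is_pmor C \<alpha>" using assms by (auto simp: homset_iff)
  then have pyr: "is_pyramid C X" "is_pyramid C Y" and res: "level_restrict (pent \<alpha>) = pent \<alpha>"
    and ent: "\<And>k a b. \<lbrakk>ht a = k; ht b = k\<rbrakk> \<Longrightarrow> pent \<alpha> k a b \<in> homset C (pobj X b) (pobj Y a)"
    and comm: "\<And>k a b. \<lbrakk>ht a = k + 1; ht b = k\<rbrakk> \<Longrightarrow>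
        mat_mult C (pobj X) (pobj Y) (k + 1) (pent \<alpha> (k + 1)) (diff_mat C X) a b
      = mat_mult C (pobj X) (pobj Y) k (diff_mat C Y) (pent \<alpha> k) a b"
    unfolding is_pmor_def Let_def by auto
  \<comment> \<open>the full matrix: the given blocks, extended by zero to pairs of indices of different heights\<close>
  define M where "M a b = (if ht a = ht b then pent \<alpha> (ht b) a b else Zero C (pobj X b) (pobj Y a))" for a b
  have hom: "homog C 0 (pobj X) (pobj Y) M"
    by (rule homogI[OF pyr]) (use ent Zero_closed[OF pyramid_Obj[OF pyr(1)] pyramid_Obj[OF pyr(2)]] in \<open>auto simp: M_def\<close>)
  note eqs = mat_mult_diff[OF pyr hom, of "pent \<alpha>"]
  have "M \<odot>\<^sub>C diff_mat C X = diff_mat C Y \<odot>\<^sub>C M"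
  proof (rule homog_ext)
    show "homog C 1 (pobj X) (pobj Y) (M \<odot>\<^sub>C diff_mat C X)"
      using homog_Comp[OF homog_diff_mat[OF pyr(1)] hom] by simp
    show "homog C 1 (pobj X) (pobj Y) (diff_mat C Y \<odot>\<^sub>C M)"
      using homog_Comp[OF hom homog_diff_mat[OF pyr(2)]] by simp
    fix a b assume "ht a = ht b + 1"
    then show "(M \<odot>\<^sub>C diff_mat C X) a b = (diff_mat C Y \<odot>\<^sub>C M) a b"
      using eqs(1)[of b "ht b" a] eqs(2)[of b "ht b" a] comm[of a "ht b" b] by (simp add: M_def)
  qed
  moreover have "level_restrict (\<lambda>k. M) = pent \<alpha>"
    by (subst res[symmetric]) (rule level_restrict_cong, simp add: M_def)
  ultimately show ?thesis
    using that[of M] pyr hom src by (simp add: chain_map_def pmor_of_def)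
qed

lemma pyr_Comp:
  assumes "chain_map C X Y M" "chain_map C Y Z N"
  shows "Comp Pyr (pmor_of Y Z N) (pmor_of X Y M) = pmor_of X Z (N \<odot>\<^sub>C M)"
proof -
  note M = chain_map_homog[OF assms(1)] and N = chain_map_homog[OF assms(2)]
  have "mat_mult C (pobj X) (pobj Z) k (level_restrict (\<lambda>k. N) k) (level_restrict (\<lambda>k. M) k) a b
      = (N \<odot>\<^sub>C M) a b" if "ht a = k" "ht b = k" for k a b
    using that by (intro mat_mult_eq[OF homog_mat[OF M] homog_mat[OF N]] homog_zero[OF M]) auto
  then show ?thesis
    by (auto simp: pyr_cat_def pmor_of_def intro: level_restrict_cong)
qed

lemma chain_map_Comp:
  assumes "chain_map C X Y M" "chain_map C Y Z N"
  shows "chain_map C X Z (N \<odot>\<^sub>C M)"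
proof -
  note hom = chain_map_hom[OF assms(1)] chain_map_hom[OF assms(2)]
  note D = diff_mat_hom[OF chain_map_pyramid(1)[OF assms(1)]] diff_mat_hom[OF chain_map_pyramid(2)[OF assms(1)]]
    diff_mat_hom[OF chain_map_pyramid(2)[OF assms(2)]]
  have "(N \<odot>\<^sub>C M) \<odot>\<^sub>C diff_mat C X = N \<odot>\<^sub>C (M \<odot>\<^sub>C diff_mat C X)"
    using fam.Comp_assoc[OF D(1) hom] by simp
  also have "\<dots> = N \<odot>\<^sub>C (diff_mat C Y \<odot>\<^sub>C M)" using chain_map_commute[OF assms(1)] by simp
  also have "\<dots> = (N \<odot>\<^sub>C diff_mat C Y) \<odot>\<^sub>C M" by (rule fam.Comp_assoc[OF hom(1) D(2) hom(2)])
  also have "\<dots> = (diff_mat C Z \<odot>\<^sub>C N) \<odot>\<^sub>C M" using chain_map_commute[OF assms(2)] by simp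
  also have "\<dots> = diff_mat C Z \<odot>\<^sub>C (N \<odot>\<^sub>C M)" using fam.Comp_assoc[OF hom D(3)] by simp
  finally show ?thesis
    using assms homog_Comp[OF chain_map_homog[OF assms(1)] chain_map_homog[OF assms(2)]]
    by (simp add: chain_map_def)
qed

lemma chain_map_Add:
  assumes "chain_map C X Y M" "chain_map C X Y N"
  shows "chain_map C X Y (M \<boxplus>\<^sub>C N)"
proof -
  note hom = chain_map_hom[OF assms(1)] chain_map_hom[OF assms(2)]
  note D = diff_mat_hom[OF chain_map_pyramid(1)[OF assms(1)]] diff_mat_hom[OF chain_map_pyramid(2)[OF assms(1)]]
  show ?thesis
    using assms homog_Add[OF chain_map_homog[OF assms(1)] chain_map_homog[OF assms(2)]]
      fam.Comp_Add_right[OF hom D(2)] fam.Comp_Add_left[OF D(1) hom]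
    by (simp add: chain_map_def)
qed

lemma chain_map_neg:
  assumes "chain_map C X Y M"
  shows "chain_map C X Y (neg Fam M)"
proof -
  note hom = chain_map_hom[OF assms]
  note D = diff_mat_hom[OF chain_map_pyramid(1)[OF assms]] diff_mat_hom[OF chain_map_pyramid(2)[OF assms]]
  show ?thesis
    using assms homog_neg[OF chain_map_homog[OF assms]]
      fam.Comp_neg_right[OF hom D(2)] fam.Comp_neg_left[OF D(1) hom]
    by (simp add: chain_map_def)
qed

lemma pobj_fam: "is_pyramid C X \<Longrightarrow> pobj X \<in> Obj Fam"
  using pyramid_Obj[of C X] by simp

lemma chain_map_Zero:
  assumes "is_pyramid C X" "is_pyramid C Y"
  shows "chain_map C X Y (Zero Fam (pobj X) (pobj Y))"
proof -
  note obj = pobj_fam[OF assms(1)] pobj_fam[OF assms(2)]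
  note D = diff_mat_hom[OF assms(1)] diff_mat_hom[OF assms(2)]
  have "homog C 0 (pobj X) (pobj Y) (Zero Fam (pobj X) (pobj Y))"
    using fam.Zero_closed[OF obj] by (simp add: homog_def fam_simps)
  then show ?thesis
    using assms obj fam.Comp_Zero_left[OF D(1)] fam.Comp_Zero_right[OF D(2)] by (simp add: chain_map_def)
qed

lemma chain_map_Idn:
  assumes "is_pyramid C X"
  shows "chain_map C X X (Idn Fam (pobj X))"
proof -
  note obj = pobj_fam[OF assms] and D = diff_mat_hom[OF assms]
  have "homog C 0 (pobj X) (pobj X) (Idn Fam (pobj X))"
    using fam.Idn_closed[OF obj] by (auto simp: homog_def fam_Idn diag_mat_def)
  then show ?thesis
    using assms fam.Comp_Idn[OF D] fam.Idn_Comp[OF D] by (simp add: chain_map_def)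
qed

end

section \<open>The category of pyramids is additive\<close>

text \<open>
  The morphism \<open>f \<oplus> g\<close> between two biproducts, given by the projections \<open>p\<close>, \<open>q\<close> of its source and
  the injections \<open>i\<close>, \<open>j\<close> of its target.
\<close>

definition bimap :: "('o, 'm) cat \<Rightarrow> 'm \<Rightarrow> 'm \<Rightarrow> 'm \<Rightarrow> 'm \<Rightarrow> 'm \<Rightarrow> 'm \<Rightarrow> 'm" where
  "bimap B i j p q f g = Add B (Comp B i (Comp B f p)) (Comp B j (Comp B g q))"

context additive_category
begin

lemma bimap:
  assumes "is_biproduct C X Y S i j p q" "is_biproduct C X' Y' S' i' j' p' q'"
    and f: "f \<in> homset C X X'" and g: "g \<in> homset C Y Y'"
  shows bimap_closed: "bimap C i' j' p q f g \<in> homset C S S'"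
    and bimap_inj1: "Comp C (bimap C i' j' p q f g) i = Comp C i' f"
    and bimap_inj2: "Comp C (bimap C i' j' p q f g) j = Comp C j' g"
    and bimap_proj1: "Comp C p' (bimap C i' j' p q f g) = Comp C f p"
    and bimap_proj2: "Comp C q' (bimap C i' j' p q f g) = Comp C g q"
proof -
  note b = assms(1,2)[unfolded is_biproduct_def]
  have obj: "S \<in> Obj C" "X \<in> Obj C" "Y \<in> Obj C" "S' \<in> Obj C" "X' \<in> Obj C" "Y' \<in> Obj C"
    using b homset_Obj[OF f] homset_Obj[OF g] by auto
  have i: "i \<in> homset C X S" "i' \<in> homset C X' S'" and j: "j \<in> homset C Y S" "j' \<in> homset C Y' S'"
    and p: "p \<in> homset C S X" "p' \<in> homset C S' X'" and q: "q \<in> homset C S Y" "q' \<in> homset C S' Y'"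
    using b by auto
  have fp: "Comp C f p \<in> homset C S X'" and gq: "Comp C g q \<in> homset C S Y'"
    using Comp_closed p q f g by blast+
  have ifp: "Comp C i' (Comp C f p) \<in> homset C S S'" and jgq: "Comp C j' (Comp C g q) \<in> homset C S S'"
    using Comp_closed fp gq i j by blast+
  show "bimap C i' j' p q f g \<in> homset C S S'"
    unfolding bimap_def by (rule Add_closed[OF ifp jgq])
  have *: "Comp C (Comp C u (Comp C f p)) v = Comp C u (Comp C f (Comp C p v))"
    if "v \<in> homset C V S" "u \<in> homset C X' U" for u v U V
    using Comp_assoc[OF that(1) fp that(2)] Comp_assoc[OF that(1) p(1) f] by simp
  have **: "Comp C (Comp C u (Comp C g q)) v = Comp C u (Comp C g (Comp C q v))"
    if "v \<in> homset C V S" "u \<in> homset C Y' U" for u v U V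
    using Comp_assoc[OF that(1) gq that(2)] Comp_assoc[OF that(1) q(1) g] by simp
  show "Comp C (bimap C i' j' p q f g) i = Comp C i' f"
    unfolding bimap_def Comp_Add_left[OF i(1) ifp jgq] *[OF i(1) i(2)] **[OF i(1) j(2)]
    using b Comp_Idn[OF f] Comp_Zero_right[OF g] Comp_Zero_right[OF j(2)]
      Add_Zero[OF Comp_closed[OF f i(2)]] obj by simp
  show "Comp C (bimap C i' j' p q f g) j = Comp C j' g"
    unfolding bimap_def Comp_Add_left[OF j(1) ifp jgq] *[OF j(1) i(2)] **[OF j(1) j(2)]
    using b Comp_Idn[OF g] Comp_Zero_right[OF f] Comp_Zero_right[OF i(2)]
      Zero_Add[OF Comp_closed[OF g j(2)]] obj by simp
  show "Comp C p' (bimap C i' j' p q f g) = Comp C f p"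
    unfolding bimap_def Comp_Add_right[OF ifp jgq p(2)] Comp_assoc[OF fp i(2) p(2)] Comp_assoc[OF gq j(2) p(2)]
    using b Idn_Comp[OF fp] Comp_Zero_left[OF gq] Add_Zero[OF fp] obj by simp
  show "Comp C q' (bimap C i' j' p q f g) = Comp C g q"
    unfolding bimap_def Comp_Add_right[OF ifp jgq q(2)] Comp_assoc[OF fp i(2) q(2)] Comp_assoc[OF gq j(2) q(2)]
    using b Idn_Comp[OF gq] Comp_Zero_left[OF fp] Zero_Add[OF gq] obj by simp
qed

lemma bimap_Comp:
  assumes "is_biproduct C X Y S i j p q" "is_biproduct C X' Y' S' i' j' p' q'"
      "is_biproduct C X'' Y'' S'' i'' j'' p'' q''"
    and f: "f \<in> homset C X X'" "f' \<in> homset C X' X''" and g: "g \<in> homset C Y Y'" "g' \<in> homset C Y' Y''"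
  shows "Comp C (bimap C i'' j'' p' q' f' g') (bimap C i' j' p q f g)
       = bimap C i'' j'' p q (Comp C f' f) (Comp C g' g)"
proof -
  note b = assms(1,2,3)[unfolded is_biproduct_def]
  have i: "i'' \<in> homset C X'' S''" and j: "j'' \<in> homset C Y'' S''"
    and p: "p \<in> homset C S X" "p' \<in> homset C S' X'" and q: "q \<in> homset C S Y" "q' \<in> homset C S' Y'"
    using b by auto
  let ?h = "bimap C i' j' p q f g"
  have h: "?h \<in> homset C S S'" by (rule bimap_closed[OF assms(1,2) f(1) g(1)])
  have "Comp C (bimap C i'' j'' p' q' f' g') ?h
      = Add C (Comp C (Comp C i'' (Comp C f' p')) ?h) (Comp C (Comp C j'' (Comp C g' q')) ?h)"
    unfolding bimap_def[of _ i''] using Comp_closed f g p q i j by (intro Comp_Add_left[OF h]) blast+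
  also have "Comp C (Comp C i'' (Comp C f' p')) ?h = Comp C i'' (Comp C f' (Comp C p' ?h))"
    using Comp_assoc[OF h Comp_closed[OF p(2) f(2)] i] Comp_assoc[OF h p(2) f(2)] by simp
  also have "\<dots> = Comp C i'' (Comp C (Comp C f' f) p)"
    using bimap_proj1[OF assms(1,2) f(1) g(1)] Comp_assoc[OF p(1) f] by simp
  also have "Comp C (Comp C j'' (Comp C g' q')) ?h = Comp C j'' (Comp C g' (Comp C q' ?h))"
    using Comp_assoc[OF h Comp_closed[OF q(2) g(2)] j] Comp_assoc[OF h q(2) g(2)] by simp
  also have "\<dots> = Comp C j'' (Comp C (Comp C g' g) q)"
    using bimap_proj2[OF assms(1,2) f(1) g(1)] Comp_assoc[OF q(1) g] by simp
  finally show ?thesis by (simp add: bimap_def)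
qed

lemma bimap_Zero:
  assumes "is_biproduct C X Y S i j p q" "is_biproduct C X' Y' S' i' j' p' q'"
  shows "bimap C i' j' p q (Zero C X X') (Zero C Y Y') = Zero C S S'"
proof -
  note b = assms(1,2)[unfolded is_biproduct_def]
  have ij: "i' \<in> homset C X' S'" "j' \<in> homset C Y' S'" and pq: "p \<in> homset C S X" "q \<in> homset C S Y"
    using b by auto
  have "X' \<in> Obj C" "Y' \<in> Obj C" "S \<in> Obj C" "S' \<in> Obj C"
    using homset_Obj[OF ij(1)] homset_Obj[OF ij(2)] homset_Obj[OF pq(1)] by auto
  then show ?thesis
    using Comp_Zero_left[OF pq(1)] Comp_Zero_left[OF pq(2)] Comp_Zero_right[OF ij(1)]
      Comp_Zero_right[OF ij(2)] Zero_Add[OF Zero_closed]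
    by (simp add: bimap_def)
qed

lemma bimap_neg:
  assumes "is_biproduct C X Y S i j p q" "is_biproduct C X' Y' S' i' j' p' q'"
    and f: "f \<in> homset C X X'" and g: "g \<in> homset C Y Y'"
  shows "bimap C i' j' p q (neg C f) (neg C g) = neg C (bimap C i' j' p q f g)"
proof -
  note b = assms(1,2)[unfolded is_biproduct_def]
  have ij: "i' \<in> homset C X' S'" "j' \<in> homset C Y' S'" and pq: "p \<in> homset C S X" "q \<in> homset C S Y"
    using b by auto
  have fg: "Comp C f p \<in> homset C S X'" "Comp C g q \<in> homset C S Y'"
    using Comp_closed pq f g by blast+
  show ?thesis
    unfolding bimap_def Comp_neg_left[OF pq(1) f] Comp_neg_left[OF pq(2) g]
      Comp_neg_right[OF fg(1) ij(1)] Comp_neg_right[OF fg(2) ij(2)]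
    by (rule neg_Add_distrib[OF Comp_closed[OF fg(1) ij(1)] Comp_closed[OF fg(2) ij(2)], symmetric])
qed

lemma biproduct_zero_object:
  assumes "is_biproduct C X Y S i j p q" "zero_object C X" "zero_object C Y"
  shows "zero_object C S"
proof -
  note b = assms(1)[unfolded is_biproduct_def]
  have ij: "i \<in> homset C X S" "j \<in> homset C Y S" and pq: "p \<in> homset C S X" "q \<in> homset C S Y"
    and S: "S \<in> Obj C"
    using b by auto
  have "p = Zero C S X" "q = Zero C S Y" using homset_zero_object pq assms(2,3) by blast+
  then have "Idn C S = Zero C S S"
    using b Comp_Zero_right[OF ij(1) S] Comp_Zero_right[OF ij(2) S] Zero_Add[OF Zero_closed[OF S S]] by simp
  then show ?thesis using S by (simp add: zero_object_iff)
qed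

interpretation fam: additive_category "fam_cat C" by (rule additive_fam_cat)

text \<open>Degreewise morphisms that commute with the differentials form a diagonal morphism of pyramids.\<close>

lemma chain_map_diagI:
  assumes "is_pyramid C X" "is_pyramid C Y" "\<And>a. f a \<in> homset C (pobj X a) (pobj Y a)"
    and "\<And>a i. Comp C (f (a + \<epsilon> i)) (pdiff X a i) = Comp C (pdiff Y a i) (f a)"
  shows "chain_map C X Y (diag_mat C (pobj X) (pobj Y) f)"
proof -
  let ?F = "diag_mat C (pobj X) (pobj Y) f"
  note D = homog_mat[OF homog_diff_mat[OF assms(1)]] homog_mat[OF homog_diff_mat[OF assms(2)]]
  have "?F \<odot>\<^sub>C diff_mat C X = diff_mat C Y \<odot>\<^sub>C ?F"
  proof (intro ext)
    fix a b
    have "Comp C (f a) (diff_mat C X a b) = Comp C (diff_mat C Y a b) (f b)"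
    proof (cases "\<exists>i. a = b + \<epsilon> i")
      case True
      then show ?thesis using assms(4) by auto
    next
      case False
      then show ?thesis
        using diff_mat_zero[of a b C X] diff_mat_zero[of a b C Y] Comp_Zero_left[OF assms(3)] Comp_Zero_right[OF assms(3)]
          pyramid_Obj[OF assms(1)] pyramid_Obj[OF assms(2)] by auto
    qed
    then show "(?F \<odot>\<^sub>C diff_mat C X) a b = (diff_mat C Y \<odot>\<^sub>C ?F) a b"
      using Comp_diag_left[OF D(1) assms(3)] Comp_diag_right[OF assms(3) D(2)] by simp
  qed
  moreover have "homog C 0 (pobj X) (pobj Y) ?F"
    using is_mat_diag[OF assms(3)] by (auto simp: homog_def fam_hom diag_mat_def)
  ultimately show ?thesis using assms by (simp add: chain_map_def)
qed

lemma pyr_homsE: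
  assumes "\<alpha> \<in> homset Pyr X Y"
  obtains M where "chain_map C X Y M" "M \<in> homset Fam (pobj X) (pobj Y)" "\<alpha> = pmor_of X Y M"
  using pyr_homE[OF assms] chain_map_hom by metis

lemma pyr_abelian_group:
  assumes "is_pyramid C X" "is_pyramid C Y"
  shows "abelian_group (Hom Pyr X Y)"
proof (rule abelian_groupI, simp_all)
  fix \<alpha> assume "\<alpha> \<in> homset Pyr X Y"
  then obtain M where M: "chain_map C X Y M" "M \<in> homset Fam (pobj X) (pobj Y)" "\<alpha> = pmor_of X Y M"
    by (rule pyr_homsE)
  show "Add Pyr (Zero Pyr X Y) \<alpha> = \<alpha>"
    by (simp add: M(3) pyr_Zero pyr_Add fam.Zero_Add[OF M(2)])
  show "\<exists>\<beta>\<in>homset Pyr X Y. Add Pyr \<beta> \<alpha> = Zero Pyr X Y"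
    using pmor_of_Arr[OF chain_map_neg[OF M(1)]]
    by (rule bexI[rotated]) (simp add: M(3) pyr_Zero pyr_Add fam.neg_Add[OF M(2)])
  fix \<beta> assume "\<beta> \<in> homset Pyr X Y"
  then obtain N where N: "chain_map C X Y N" "N \<in> homset Fam (pobj X) (pobj Y)" "\<beta> = pmor_of X Y N"
    by (rule pyr_homsE)
  show "Add Pyr \<alpha> \<beta> \<in> homset Pyr X Y"
    by (simp add: M(3) N(3) pyr_Add pmor_of_Arr chain_map_Add M(1) N(1))
  show "Add Pyr \<alpha> \<beta> = Add Pyr \<beta> \<alpha>"
    by (simp add: M(3) N(3) pyr_Add fam.Add_commute[OF M(2) N(2)])
  fix \<gamma> assume "\<gamma> \<in> homset Pyr X Y"
  then obtain P where P: "chain_map C X Y P" "P \<in> homset Fam (pobj X) (pobj Y)" "\<gamma> = pmor_of X Y P"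
    by (rule pyr_homsE)
  show "Add Pyr (Add Pyr \<alpha> \<beta>) \<gamma> = Add Pyr \<alpha> (Add Pyr \<beta> \<gamma>)"
    by (simp add: M(3) N(3) P(3) pyr_Add fam.Add_assoc[OF M(2) N(2) P(2)])
next
  show "Zero Pyr X Y \<in> homset Pyr X Y"
    by (simp add: pyr_Zero pmor_of_Arr chain_map_Zero assms)
qed

lemma pyr_zero_object: "\<exists>Z. zero_object Pyr Z"
proof -
  obtain Z where Z: "zero_object C Z" using zero_object_exists by blast
  then have ZO: "Z \<in> Obj C" by (simp add: zero_object_def)
  let ?Z = "\<lparr>pobj = (\<lambda>_. Z), pdiff = (\<lambda>_ _. Zero C Z Z), prank = 0\<rparr>"
  have pyr: "is_pyramid C ?Z"
    using Z ZO Comp_Zero_left[OF Zero_closed] neg_Zero Zero_closed by (intro pyramidI) auto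
  have uniq: "\<exists>!\<alpha>. \<alpha> \<in> homset Pyr X Y" if XY: "is_pyramid C X" "is_pyramid C Y"
    and zero: "\<And>a b. zero_object C (pobj X b) \<or> zero_object C (pobj Y a)" for X Y
  proof
    show "pmor_of X Y (Zero Fam (pobj X) (pobj Y)) \<in> homset Pyr X Y"
      by (intro pmor_of_Arr chain_map_Zero XY)
    fix \<alpha> assume "\<alpha> \<in> homset Pyr X Y"
    then obtain M where M: "chain_map C X Y M" "\<alpha> = pmor_of X Y M" by (rule pyr_homE)
    then have "M = Zero Fam (pobj X) (pobj Y)"
      using homset_zero_object[OF homog_entry[OF chain_map_homog[OF M(1)]] zero]
      by (simp add: fam_simps fun_eq_iff)
    then show "\<alpha> = pmor_of X Y (Zero Fam (pobj X) (pobj Y))" using M by simp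
  qed
  have "zero_object Pyr ?Z"
    using pyr uniq Z by (simp add: zero_object_def[of Pyr])
  then show ?thesis by blast
qed

lemma pyr_biproduct:
  assumes "is_pyramid C X" "is_pyramid C Y"
  shows "\<exists>S i j p q. is_biproduct Pyr X Y S i j p q"
proof -
  have "\<forall>a. \<exists>S i j p q. is_biproduct C (pobj X a) (pobj Y a) S i j p q"
    using biproduct_exists pyramid_Obj assms by blast
  then obtain S i j p q
    where b: "\<And>a. is_biproduct C (pobj X a) (pobj Y a) (S a) (i a) (j a) (p a) (q a)" by metis
  \<comment> \<open>the direct sum, taken index by index; the larger of the two ranks serves for both summands\<close>
  define T where "T = \<lparr>pobj = S, pdiff = (\<lambda>a n. bimap C (i (a + \<epsilon> n)) (j (a + \<epsilon> n)) (p a) (q a)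
      (pdiff X a n) (pdiff Y a n)), prank = max (prank X) (prank Y)\<rparr>"
  have T: "pobj T = S" "prank T = max (prank X) (prank Y)" and dT: "pdiff T a n =
      bimap C (i (a + \<epsilon> n)) (j (a + \<epsilon> n)) (p a) (q a) (pdiff X a n) (pdiff Y a n)" for a n
    by (simp_all add: T_def)
  obtain m m' where m: "\<And>a n. m \<le> coord a n \<Longrightarrow> zero_object C (pobj X a)"
    and m': "\<And>a n. m' \<le> coord a n \<Longrightarrow> zero_object C (pobj Y a)"
    using pyramid_bounded[OF assms(1)] pyramid_bounded[OF assms(2)] by blast
  note dX = pyramid_diff[OF assms(1)] and dY = pyramid_diff[OF assms(2)]
  have dd: "Comp C (pdiff T (a + \<epsilon> n) k) (pdiff T a n)
      = bimap C (i (a + \<epsilon> n + \<epsilon> k)) (j (a + \<epsilon> n + \<epsilon> k)) (p a) (q a)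
          (Comp C (pdiff X (a + \<epsilon> n) k) (pdiff X a n)) (Comp C (pdiff Y (a + \<epsilon> n) k) (pdiff Y a n))" for a n k
    unfolding dT by (rule bimap_Comp[OF b b b dX dX dY dY])
  have "is_pyramid C T"
  proof (rule pyramidI)
    show "pobj T a \<in> Obj C" for a using b[of a] by (simp add: T is_biproduct_def)
    show "pdiff T a n \<in> homset C (pobj T a) (pobj T (a + \<epsilon> n))" for a n
      unfolding T dT by (rule bimap_closed[OF b b dX dY])
    show "zero_object C (pobj T a)" if "prank T \<le> n" "coord a n \<noteq> 0" for a n
      unfolding T using that pyramid_rank[OF assms(1)] pyramid_rank[OF assms(2)]
      by (intro biproduct_zero_object[OF b]) (auto simp: T)
    show "zero_object C (pobj T a)" if "max m m' \<le> coord a n" for a n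
      unfolding T using that m[of a n] m'[of a n] by (intro biproduct_zero_object[OF b]) auto
    show "Comp C (pdiff T (a + \<epsilon> n) n) (pdiff T a n) = Zero C (pobj T a) (pobj T (a + \<epsilon> n + \<epsilon> n))" for a n
      unfolding dd T pyramid_diff_diff[OF assms(1)] pyramid_diff_diff[OF assms(2)]
      by (rule bimap_Zero[OF b b])
    show "Comp C (pdiff T (a + \<epsilon> n) k) (pdiff T a n) = neg C (Comp C (pdiff T (a + \<epsilon> k) n) (pdiff T a k))" for a n k
    proof -
      have "a + \<epsilon> n + \<epsilon> k = a + \<epsilon> k + \<epsilon> n" by (simp add: ac_simps)
      moreover have "bimap C (i (a + \<epsilon> k + \<epsilon> n)) (j (a + \<epsilon> k + \<epsilon> n)) (p a) (q a)
          (neg C (Comp C (pdiff X (a + \<epsilon> k) n) (pdiff X a k))) (neg C (Comp C (pdiff Y (a + \<epsilon> k) n) (pdiff Y a k)))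
        = neg C (bimap C (i (a + \<epsilon> k + \<epsilon> n)) (j (a + \<epsilon> k + \<epsilon> n)) (p a) (q a)
          (Comp C (pdiff X (a + \<epsilon> k) n) (pdiff X a k)) (Comp C (pdiff Y (a + \<epsilon> k) n) (pdiff Y a k)))"
        by (rule bimap_neg[OF b b Comp_closed[OF dX dX] Comp_closed[OF dY dY]])
      ultimately show ?thesis
        unfolding dd pyramid_anticommute[OF assms(1), of a n k] pyramid_anticommute[OF assms(2), of a n k]
        by metis
    qed
  qed
  note pyr = assms this
  have hom: "\<And>a. i a \<in> homset C (pobj X a) (pobj T a)" "\<And>a. j a \<in> homset C (pobj Y a) (pobj T a)"
    "\<And>a. p a \<in> homset C (pobj T a) (pobj X a)" "\<And>a. q a \<in> homset C (pobj T a) (pobj Y a)"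
    using b unfolding is_biproduct_def T by auto
  have chain: "chain_map C X T (diag_mat C (pobj X) (pobj T) i)" "chain_map C Y T (diag_mat C (pobj Y) (pobj T) j)"
    "chain_map C T X (diag_mat C (pobj T) (pobj X) p)" "chain_map C T Y (diag_mat C (pobj T) (pobj Y) q)"
    using pyr hom bimap_inj1[OF b b dX dY] bimap_inj2[OF b b dX dY]
      bimap_proj1[OF b b dX dY] bimap_proj2[OF b b dX dY]
    by (intro chain_map_diagI; simp add: dT)+
  have "is_biproduct Pyr X Y T (pmor_of X T (diag_mat C (pobj X) (pobj T) i))
      (pmor_of Y T (diag_mat C (pobj Y) (pobj T) j)) (pmor_of T X (diag_mat C (pobj T) (pobj X) p))
      (pmor_of T Y (diag_mat C (pobj T) (pobj Y) q))"
    using fam_biproduct[of "pobj X" "pobj Y" "pobj T", OF b[folded T(1)]] pyr chain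
    unfolding is_biproduct_def
    by (simp add: pmor_of_Arr pyr_Comp pyr_Idn pyr_Zero pyr_Add)
  then show ?thesis by blast
qed

lemma additive_pyr_cat: "additive_category Pyr"
proof (intro additive_category.intro category.intro additive_category_axioms.intro)
  fix \<alpha> assume "\<alpha> \<in> Arr Pyr"
  then show "Dom Pyr \<alpha> \<in> Obj Pyr" "Cod Pyr \<alpha> \<in> Obj Pyr"
    by (simp_all add: is_pmor_def Let_def)
next
  fix X assume "X \<in> Obj Pyr"
  then show "Idn Pyr X \<in> homset Pyr X X"
    by (simp add: pyr_Idn pmor_of_Arr chain_map_Idn)
next
  fix \<alpha> \<beta> X Y Z assume "\<alpha> \<in> homset Pyr X Y" "\<beta> \<in> homset Pyr Y Z"
  then show "Comp Pyr \<beta> \<alpha> \<in> homset Pyr X Z"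
    by (elim pyr_homE) (simp add: pyr_Comp pmor_of_Arr chain_map_Comp)
next
  fix \<alpha> X Y assume "\<alpha> \<in> homset Pyr X Y"
  then obtain M where M: "chain_map C X Y M" "\<alpha> = pmor_of X Y M" by (rule pyr_homE)
  show "Comp Pyr \<alpha> (Idn Pyr X) = \<alpha>" "Comp Pyr (Idn Pyr Y) \<alpha> = \<alpha>"
    using pyr_Comp[OF chain_map_Idn M(1)] pyr_Comp[OF M(1) chain_map_Idn] chain_map_pyramid[OF M(1)]
      fam.Comp_Idn[OF chain_map_hom[OF M(1)]] fam.Idn_Comp[OF chain_map_hom[OF M(1)]]
    by (simp_all add: M(2) pyr_Idn)
next
  fix \<alpha> \<beta> \<gamma> W X Y Z
  assume "\<alpha> \<in> homset Pyr W X" "\<beta> \<in> homset Pyr X Y" "\<gamma> \<in> homset Pyr Y Z"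
  then obtain M N P where M: "chain_map C W X M" "\<alpha> = pmor_of W X M"
    and N: "chain_map C X Y N" "\<beta> = pmor_of X Y N" and P: "chain_map C Y Z P" "\<gamma> = pmor_of Y Z P"
    by (metis pyr_homE)
  show "Comp Pyr \<gamma> (Comp Pyr \<beta> \<alpha>) = Comp Pyr (Comp Pyr \<gamma> \<beta>) \<alpha>"
    using fam.Comp_assoc[OF chain_map_hom[OF M(1)] chain_map_hom[OF N(1)] chain_map_hom[OF P(1)]]
    by (simp add: M(2) N(2) P(2) pyr_Comp[OF M(1) N(1)] pyr_Comp[OF N(1) P(1)]
      pyr_Comp[OF M(1) chain_map_Comp[OF N(1) P(1)]] pyr_Comp[OF chain_map_Comp[OF M(1) N(1)] P(1)])
next
  fix X Y assume "X \<in> Obj Pyr" "Y \<in> Obj Pyr"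
  then show "abelian_group (Hom Pyr X Y)" "\<exists>S i j p q. is_biproduct Pyr X Y S i j p q"
    by (simp_all add: pyr_abelian_group pyr_biproduct)
next
  fix \<alpha> \<alpha>' \<beta> X Y Z
  assume "\<alpha> \<in> homset Pyr X Y" "\<alpha>' \<in> homset Pyr X Y" "\<beta> \<in> homset Pyr Y Z"
  then obtain M M' N where M: "chain_map C X Y M" "\<alpha> = pmor_of X Y M"
    and M': "chain_map C X Y M'" "\<alpha>' = pmor_of X Y M'" and N: "chain_map C Y Z N" "\<beta> = pmor_of Y Z N"
    by (metis pyr_homE)
  show "Comp Pyr \<beta> (Add Pyr \<alpha> \<alpha>') = Add Pyr (Comp Pyr \<beta> \<alpha>) (Comp Pyr \<beta> \<alpha>')"
    using fam.Comp_Add_right[OF chain_map_hom[OF M(1)] chain_map_hom[OF M'(1)] chain_map_hom[OF N(1)]]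
    by (simp add: M(2) M'(2) N(2) pyr_Add pyr_Comp[OF _ N(1)] M(1) M'(1) chain_map_Add)
next
  fix \<alpha> \<beta> \<beta>' X Y Z
  assume "\<alpha> \<in> homset Pyr X Y" "\<beta> \<in> homset Pyr Y Z" "\<beta>' \<in> homset Pyr Y Z"
  then obtain M N N' where M: "chain_map C X Y M" "\<alpha> = pmor_of X Y M"
    and N: "chain_map C Y Z N" "\<beta> = pmor_of Y Z N" and N': "chain_map C Y Z N'" "\<beta>' = pmor_of Y Z N'"
    by (metis pyr_homE)
  show "Comp Pyr (Add Pyr \<beta> \<beta>') \<alpha> = Add Pyr (Comp Pyr \<beta> \<alpha>) (Comp Pyr \<beta>' \<alpha>)"
    using fam.Comp_Add_left[OF chain_map_hom[OF M(1)] chain_map_hom[OF N(1)] chain_map_hom[OF N'(1)]]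
    by (simp add: M(2) N(2) N'(2) pyr_Add pyr_Comp[OF M(1)] N(1) N'(1) chain_map_Add)
qed (rule pyr_zero_object)

end

section \<open>The ideal of null homotopic morphisms\<close>

context additive_category
begin

interpretation fam: additive_category "fam_cat C" by (rule additive_fam_cat)
interpretation pyr: additive_category "pyr_cat C" by (rule additive_pyr_cat)

lemma pyr_neg:
  assumes "chain_map C X Y M"
  shows "neg Pyr (pmor_of X Y M) = pmor_of X Y (neg Fam M)"
  using pyr.neg_unique[OF pmor_of_Arr[OF chain_map_neg[OF assms]] pmor_of_Arr[OF assms]]
    fam.neg_Add[OF chain_map_hom[OF assms]] by (simp add: pyr_Add pyr_Zero)

lemma null_homotopic_iff:
  assumes "chain_map C X Y M"
  shows "pmor_of X Y M \<in> null_homotopic C \<longleftrightarrow> null_mat C X Y M"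
proof -
  note pyr = chain_map_pyramid[OF assms] and M = chain_map_homog[OF assms]
  note D = homog_diff_mat[OF pyr(1)] homog_diff_mat[OF pyr(2)]
  let ?P = "\<lambda>\<chi> k a b. M a b =
        Add C (mat_mult C (pobj X) (pobj Y) (k + 1) (\<chi> (k + 1)) (diff_mat C X) a b)
          (mat_mult C (pobj X) (pobj Y) (k - 1) (diff_mat C Y) (\<chi> k) a b)"
  have "is_pmor C (pmor_of X Y M)" using pmor_of_Arr[OF assms] by (simp add: homset_iff)
  then have null: "pmor_of X Y M \<in> null_homotopic C \<longleftrightarrow> (\<exists>\<chi>. is_homotopy C X Y \<chi> \<and>
     (\<forall>k a b. ht a = k \<longrightarrow> ht b = k \<longrightarrow> ?P \<chi> k a b))"
    unfolding null_homotopic_def by (simp add: Ball_def)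
  show ?thesis unfolding null
  proof (rule iffI, elim exE conjE)
    fix \<chi>
    assume \<chi>: "is_homotopy C X Y \<chi>" and eq: "\<forall>k a b. ht a = k \<longrightarrow> ht b = k \<longrightarrow> ?P \<chi> k a b"
    define H where "H a b = (if ht a = ht b - 1 then \<chi> (ht b) a b else Zero C (pobj X b) (pobj Y a))" for a b
    have H: "homog C (-1) (pobj X) (pobj Y) H"
      by (rule homogI[OF pyr])
        (use \<chi> Zero_closed[OF pyramid_Obj[OF pyr(1)] pyramid_Obj[OF pyr(2)]] in \<open>auto simp: H_def is_homotopy_def\<close>)
    note eqs = mat_mult_diff[OF pyr H, of \<chi>]
    have "M = (H \<odot>\<^sub>C diff_mat C X) \<boxplus>\<^sub>C (diff_mat C Y \<odot>\<^sub>C H)"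
    proof (rule homog_ext[OF M])
      show "homog C 0 (pobj X) (pobj Y) ((H \<odot>\<^sub>C diff_mat C X) \<boxplus>\<^sub>C (diff_mat C Y \<odot>\<^sub>C H))"
        using homog_Comp[OF D(1) H] homog_Comp[OF H D(2)] by (intro homog_Add) simp_all
      fix a b assume "ht a = ht b + 0"
      then show "M a b = ((H \<odot>\<^sub>C diff_mat C X) \<boxplus>\<^sub>C (diff_mat C Y \<odot>\<^sub>C H)) a b"
        using eqs(1)[of b "ht b" a] eqs(2)[of b "ht b" a] eq by (simp add: H_def fam_simps)
    qed
    then show "null_mat C X Y M" using H unfolding null_mat_def by blast
  next
    assume "null_mat C X Y M"
    then obtain H where H: "homog C (-1) (pobj X) (pobj Y) H"
      and eq: "M = (H \<odot>\<^sub>C diff_mat C X) \<boxplus>\<^sub>C (diff_mat C Y \<odot>\<^sub>C H)"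
      unfolding null_mat_def by blast
    note eqs = mat_mult_diff[OF pyr H, of "\<lambda>_. H"]
    have "is_homotopy C X Y (\<lambda>_. H)" using homog_entry[OF H] by (simp add: is_homotopy_def)
    moreover have "?P (\<lambda>_. H) k a b" if "ht a = k" "ht b = k" for k a b
      using eqs(1)[of b k a] eqs(2)[of b k a] that by (subst eq) (simp add: fam_simps)
    ultimately show "\<exists>\<chi>. is_homotopy C X Y \<chi> \<and> (\<forall>k a b. ht a = k \<longrightarrow> ht b = k \<longrightarrow> ?P \<chi> k a b)"
      by (intro exI[of _ "\<lambda>_. H"]) simp
  qed
qed

lemma null_homotopicE:
  assumes "\<alpha> \<in> null_homotopic C"
  obtains M where "chain_map C (psrc \<alpha>) (ptgt \<alpha>) M" "null_mat C (psrc \<alpha>) (ptgt \<alpha>) M"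
    "\<alpha> = pmor_of (psrc \<alpha>) (ptgt \<alpha>) M"
proof -
  have "\<alpha> \<in> homset Pyr (psrc \<alpha>) (ptgt \<alpha>)"
    using assms by (simp add: null_homotopic_def homset_iff)
  then obtain M where "chain_map C (psrc \<alpha>) (ptgt \<alpha>) M" "\<alpha> = pmor_of (psrc \<alpha>) (ptgt \<alpha>) M"
    by (rule pyr_homE)
  then show ?thesis using that null_homotopic_iff assms by metis
qed

lemma null_mat_Zero:
  assumes "is_pyramid C X" "is_pyramid C Y"
  shows "null_mat C X Y (Zero Fam (pobj X) (pobj Y))"
proof -
  note obj = pobj_fam[OF assms(1)] pobj_fam[OF assms(2)]
  note D = diff_mat_hom[OF assms(1)] diff_mat_hom[OF assms(2)]
  let ?O = "Zero Fam (pobj X) (pobj Y)"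
  have "homog C (-1) (pobj X) (pobj Y) ?O"
    using fam.Zero_closed[OF obj] by (simp add: homog_def fam_simps)
  moreover have "?O = (?O \<odot>\<^sub>C diff_mat C X) \<boxplus>\<^sub>C (diff_mat C Y \<odot>\<^sub>C ?O)"
    using fam.Comp_Zero_left[OF D(1)] fam.Comp_Zero_right[OF D(2)] obj fam.Zero_Add[OF fam.Zero_closed[OF obj]]
    by simp
  ultimately show ?thesis unfolding null_mat_def by blast
qed

lemma null_mat_Add:
  assumes "is_pyramid C X" "is_pyramid C Y" "null_mat C X Y M" "null_mat C X Y N"
  shows "null_mat C X Y (M \<boxplus>\<^sub>C N)"
proof -
  note D = diff_mat_hom[OF assms(1)] diff_mat_hom[OF assms(2)]
  obtain H K where H: "homog C (-1) (pobj X) (pobj Y) H"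
      "M = (H \<odot>\<^sub>C diff_mat C X) \<boxplus>\<^sub>C (diff_mat C Y \<odot>\<^sub>C H)"
    and K: "homog C (-1) (pobj X) (pobj Y) K"
      "N = (K \<odot>\<^sub>C diff_mat C X) \<boxplus>\<^sub>C (diff_mat C Y \<odot>\<^sub>C K)"
    using assms(3,4) unfolding null_mat_def by blast
  note hom = homog_hom[OF H(1)] homog_hom[OF K(1)]
  have "M \<boxplus>\<^sub>C N = ((H \<boxplus>\<^sub>C K) \<odot>\<^sub>C diff_mat C X) \<boxplus>\<^sub>C (diff_mat C Y \<odot>\<^sub>C (H \<boxplus>\<^sub>C K))"
    unfolding H(2) K(2) fam.Comp_Add_left[OF D(1) hom] fam.Comp_Add_right[OF hom D(2)]
    using fam.Comp_closed D hom by (intro fam.Add_interchange) blast+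
  then show ?thesis using homog_Add[OF H(1) K(1)] unfolding null_mat_def by blast
qed

lemma null_mat_neg:
  assumes "is_pyramid C X" "is_pyramid C Y" "null_mat C X Y M"
  shows "null_mat C X Y (neg Fam M)"
proof -
  note D = diff_mat_hom[OF assms(1)] diff_mat_hom[OF assms(2)]
  obtain H where H: "homog C (-1) (pobj X) (pobj Y) H"
      "M = (H \<odot>\<^sub>C diff_mat C X) \<boxplus>\<^sub>C (diff_mat C Y \<odot>\<^sub>C H)"
    using assms(3) unfolding null_mat_def by blast
  note hom = homog_hom[OF H(1)]
  have "neg Fam M = (neg Fam H \<odot>\<^sub>C diff_mat C X) \<boxplus>\<^sub>C (diff_mat C Y \<odot>\<^sub>C neg Fam H)"
    unfolding H(2) fam.Comp_neg_left[OF D(1) hom] fam.Comp_neg_right[OF hom D(2)]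
    using fam.Comp_closed D hom by (intro fam.neg_Add_distrib) blast+
  then show ?thesis using homog_neg[OF H(1)] unfolding null_mat_def by blast
qed

lemma null_mat_Comp_left:
  assumes "null_mat C X Y M" "is_pyramid C X" "chain_map C Y Z N"
  shows "null_mat C X Z (N \<odot>\<^sub>C M)"
proof -
  note D = diff_mat_hom[OF assms(2)] diff_mat_hom[OF chain_map_pyramid(1)[OF assms(3)]]
    diff_mat_hom[OF chain_map_pyramid(2)[OF assms(3)]]
  obtain H where H: "homog C (-1) (pobj X) (pobj Y) H"
      "M = (H \<odot>\<^sub>C diff_mat C X) \<boxplus>\<^sub>C (diff_mat C Y \<odot>\<^sub>C H)"
    using assms(1) unfolding null_mat_def by blast
  note h = homog_hom[OF H(1)] and n = chain_map_hom[OF assms(3)]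
  have "N \<odot>\<^sub>C M = (N \<odot>\<^sub>C (H \<odot>\<^sub>C diff_mat C X)) \<boxplus>\<^sub>C (N \<odot>\<^sub>C (diff_mat C Y \<odot>\<^sub>C H))"
    unfolding H(2) by (rule fam.Comp_Add_right[OF fam.Comp_closed[OF D(1) h] fam.Comp_closed[OF h D(2)] n])
  also have "N \<odot>\<^sub>C (H \<odot>\<^sub>C diff_mat C X) = (N \<odot>\<^sub>C H) \<odot>\<^sub>C diff_mat C X"
    by (rule fam.Comp_assoc[OF D(1) h n])
  also have "N \<odot>\<^sub>C (diff_mat C Y \<odot>\<^sub>C H) = diff_mat C Z \<odot>\<^sub>C (N \<odot>\<^sub>C H)"
    using fam.Comp_assoc[OF h D(2) n] fam.Comp_assoc[OF h n D(3)] chain_map_commute[OF assms(3)] by simp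
  finally show ?thesis
    using homog_Comp[OF H(1) chain_map_homog[OF assms(3)]] unfolding null_mat_def by auto
qed

lemma null_mat_Comp_right:
  assumes "null_mat C Y Z M" "is_pyramid C Z" "chain_map C X Y N"
  shows "null_mat C X Z (M \<odot>\<^sub>C N)"
proof -
  note D = diff_mat_hom[OF chain_map_pyramid(1)[OF assms(3)]] diff_mat_hom[OF chain_map_pyramid(2)[OF assms(3)]]
    diff_mat_hom[OF assms(2)]
  obtain H where H: "homog C (-1) (pobj Y) (pobj Z) H"
      "M = (H \<odot>\<^sub>C diff_mat C Y) \<boxplus>\<^sub>C (diff_mat C Z \<odot>\<^sub>C H)"
    using assms(1) unfolding null_mat_def by blast
  note h = homog_hom[OF H(1)] and n = chain_map_hom[OF assms(3)]
  have "M \<odot>\<^sub>C N = ((H \<odot>\<^sub>C diff_mat C Y) \<odot>\<^sub>C N) \<boxplus>\<^sub>C ((diff_mat C Z \<odot>\<^sub>C H) \<odot>\<^sub>C N)"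
    unfolding H(2) by (rule fam.Comp_Add_left[OF n fam.Comp_closed[OF D(2) h] fam.Comp_closed[OF h D(3)]])
  also have "(diff_mat C Z \<odot>\<^sub>C H) \<odot>\<^sub>C N = diff_mat C Z \<odot>\<^sub>C (H \<odot>\<^sub>C N)"
    using fam.Comp_assoc[OF n h D(3)] by simp
  also have "(H \<odot>\<^sub>C diff_mat C Y) \<odot>\<^sub>C N = (H \<odot>\<^sub>C N) \<odot>\<^sub>C diff_mat C X"
    using fam.Comp_assoc[OF n D(2) h] fam.Comp_assoc[OF D(1) n h] chain_map_commute[OF assms(3)] by simp
  finally show ?thesis
    using homog_Comp[OF chain_map_homog[OF assms(3)] H(1)] unfolding null_mat_def by auto
qed

lemma cat_ideal_null_homotopic: "cat_ideal Pyr (null_homotopic C)"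
  unfolding cat_ideal_def pyr_cat_simps
proof (intro conjI ballI impI subsetI)
  fix \<alpha> assume "\<alpha> \<in> null_homotopic C"
  then show "\<alpha> \<in> {\<alpha>. is_pmor C \<alpha>}" by (simp add: null_homotopic_def)
  from \<open>\<alpha> \<in> null_homotopic C\<close> obtain M where M: "chain_map C (psrc \<alpha>) (ptgt \<alpha>) M"
    "null_mat C (psrc \<alpha>) (ptgt \<alpha>) M" "\<alpha> = pmor_of (psrc \<alpha>) (ptgt \<alpha>) M"
    by (rule null_homotopicE)
  note pyr = chain_map_pyramid[OF M(1)]
  show "neg Pyr \<alpha> \<in> null_homotopic C"
    using null_mat_neg[OF pyr M(2)] null_homotopic_iff[OF chain_map_neg[OF M(1)]]
    by (subst M(3)) (simp add: pyr_neg[OF M(1)])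
  {
    fix \<beta> assume "\<beta> \<in> null_homotopic C" and eq: "psrc \<alpha> = psrc \<beta>" "ptgt \<alpha> = ptgt \<beta>"
    from this(1) obtain N where N: "chain_map C (psrc \<alpha>) (ptgt \<alpha>) N" "null_mat C (psrc \<alpha>) (ptgt \<alpha>) N"
      "\<beta> = pmor_of (psrc \<alpha>) (ptgt \<alpha>) N"
      unfolding eq by (rule null_homotopicE)
    show "Add Pyr \<alpha> \<beta> \<in> null_homotopic C"
      using null_mat_Add[OF pyr M(2) N(2)] null_homotopic_iff[OF chain_map_Add[OF M(1) N(1)]]
      by (subst M(3), subst N(3)) (simp add: pyr_Add)
  next
    fix \<beta> assume "\<beta> \<in> {\<alpha>. is_pmor C \<alpha>}" and eq: "psrc \<beta> = ptgt \<alpha>"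
    then have "\<beta> \<in> homset Pyr (ptgt \<alpha>) (ptgt \<beta>)" by (simp add: homset_iff)
    then obtain N where N: "chain_map C (ptgt \<alpha>) (ptgt \<beta>) N" "\<beta> = pmor_of (ptgt \<alpha>) (ptgt \<beta>) N"
      by (rule pyr_homE)
    show "Comp Pyr \<beta> \<alpha> \<in> null_homotopic C"
      using null_mat_Comp_left[OF M(2) pyr(1) N(1)] null_homotopic_iff[OF chain_map_Comp[OF M(1) N(1)]]
      by (subst M(3), subst N(2)) (simp add: pyr_Comp[OF M(1) N(1)])
  next
    fix \<beta> assume "\<beta> \<in> {\<alpha>. is_pmor C \<alpha>}" and eq: "ptgt \<beta> = psrc \<alpha>"
    then have "\<beta> \<in> homset Pyr (psrc \<beta>) (psrc \<alpha>)" by (simp add: homset_iff)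
    then obtain N where N: "chain_map C (psrc \<beta>) (psrc \<alpha>) N" "\<beta> = pmor_of (psrc \<beta>) (psrc \<alpha>) N"
      by (rule pyr_homE)
    show "Comp Pyr \<alpha> \<beta> \<in> null_homotopic C"
      using null_mat_Comp_right[OF M(2) pyr(2) N(1)] null_homotopic_iff[OF chain_map_Comp[OF N(1) M(1)]]
      by (subst M(3), subst N(2)) (simp add: pyr_Comp[OF N(1) M(1)])
  }
next
  fix X Y assume "X \<in> {X. is_pyramid C X}" "Y \<in> {X. is_pyramid C X}"
  then show "Zero Pyr X Y \<in> null_homotopic C"
    using null_mat_Zero null_homotopic_iff[OF chain_map_Zero] by (simp add: pyr_Zero)
qed

end

section \<open>Quotients of additive categories\<close>

text \<open>
  An additive category with an ideal \<open>J\<close>. The quotient \<open>Q\<close> has the same objects; its morphisms are the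
  classes \<open>cls f\<close>, and its operations are defined by chosen representatives, so that their
  compatibility with classes is proved below.
\<close>

locale additive_quotient = additive_category C
  for C :: "('o, 'm) cat" +
  fixes J :: "'m set"
  assumes ideal: "cat_ideal C J"
begin

abbreviation Q :: "('o, 'm set) cat" where
  "Q \<equiv> quot_cat C J"

abbreviation cls :: "'m \<Rightarrow> 'm set" where
  "cls \<equiv> quot_class C J"

lemma ideal_Zero: "\<lbrakk>X \<in> Obj C; Y \<in> Obj C\<rbrakk> \<Longrightarrow> Zero C X Y \<in> J"
  using ideal by (simp add: cat_ideal_def)

lemma ideal_Add: "\<lbrakk>f \<in> homset C X Y; g \<in> homset C X Y; f \<in> J; g \<in> J\<rbrakk> \<Longrightarrow> Add C f g \<in> J"
  using ideal by (simp add: cat_ideal_def homset_iff)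

lemma ideal_neg: "f \<in> J \<Longrightarrow> neg C f \<in> J"
  using ideal by (simp add: cat_ideal_def)

lemma ideal_Comp_left: "\<lbrakk>f \<in> homset C X Y; g \<in> homset C Y Z; f \<in> J\<rbrakk> \<Longrightarrow> Comp C g f \<in> J"
  using ideal by (simp add: cat_ideal_def homset_iff)

lemma ideal_Comp_right: "\<lbrakk>f \<in> homset C X Y; g \<in> homset C Y Z; g \<in> J\<rbrakk> \<Longrightarrow> Comp C g f \<in> J"
  using ideal by (simp add: cat_ideal_def homset_iff)

lemma quot_class_eq:
  assumes "f \<in> homset C X Y"
  shows "cls f = {g \<in> homset C X Y. Add C g (neg C f) \<in> J}"
  using assms minus_eq[OF _ assms] unfolding quot_class_def homset_iff by auto

lemma quot_class_self: "f \<in> homset C X Y \<Longrightarrow> f \<in> cls f"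
  using quot_class_eq Add_neg ideal_Zero homset_Obj by (metis (no_types, lifting) mem_Collect_eq)

lemma quot_class_eqI:
  assumes "f \<in> homset C X Y" "g \<in> homset C X Y" "Add C f (neg C g) \<in> J"
  shows "cls f = cls g"
proof -
  have sub: "cls f \<subseteq> cls g"
    if "f \<in> homset C X Y" "g \<in> homset C X Y" "Add C f (neg C g) \<in> J" for f g
  proof
    fix h assume "h \<in> cls f"
    then have h: "h \<in> homset C X Y" "Add C h (neg C f) \<in> J" using quot_class_eq[OF that(1)] by auto
    have nf: "neg C f \<in> homset C X Y" and ng: "neg C g \<in> homset C X Y" using neg_closed that by auto
    have "Add C (Add C h (neg C f)) (Add C f (neg C g)) \<in> J"
      using h(2) that(3) Add_closed[OF h(1) nf] Add_closed[OF that(1) ng] by (rule_tac ideal_Add)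
    also have "Add C (Add C h (neg C f)) (Add C f (neg C g)) = Add C h (neg C g)"
      using Add_assoc[OF h(1) nf Add_closed[OF that(1) ng]] Add_assoc[OF nf that(1) ng, symmetric]
        neg_Add[OF that(1)] Zero_Add[OF ng] by simp
    finally show "h \<in> cls g" using h(1) quot_class_eq[OF that(2)] by simp
  qed
  have "Add C g (neg C f) = neg C (Add C f (neg C g))"
    using neg_Add_distrib[OF assms(1) neg_closed[OF assms(2)]] neg_neg[OF assms(2)]
      Add_commute[OF neg_closed[OF assms(1)] assms(2)] by simp
  then have "Add C g (neg C f) \<in> J" using ideal_neg[OF assms(3)] by simp
  then show ?thesis using sub assms by blast
qed

lemma quot_class_mem:
  assumes "f \<in> homset C X Y" "g \<in> cls f"
  shows "g \<in> homset C X Y" "Add C g (neg C f) \<in> J" "cls g = cls f"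
  using assms quot_class_eq quot_class_eqI by auto

lemma quot_rep:
  assumes "f \<in> homset C X Y"
  shows "quot_rep (cls f) \<in> homset C X Y"
    "Add C (quot_rep (cls f)) (neg C f) \<in> J"
    "cls (quot_rep (cls f)) = cls f"
proof -
  have "quot_rep (cls f) \<in> cls f"
    unfolding quot_rep_def using quot_class_self[OF assms] by (rule someI)
  from quot_class_mem[OF assms this] show "quot_rep (cls f) \<in> homset C X Y"
    "Add C (quot_rep (cls f)) (neg C f) \<in> J"
    "cls (quot_rep (cls f)) = cls f" .
qed

lemma quot_Obj [simp]: "Obj Q = Obj C"
  by (simp add: quot_cat_def)

lemma quot_Idn: "Idn Q X = cls (Idn C X)"
  by (simp add: quot_cat_def)

lemma quot_Zero: "Zero Q X Y = cls (Zero C X Y)"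
  by (simp add: quot_cat_def)

lemma quot_hom: "homset Q X Y = cls ` homset C X Y"
proof -
  have "Dom C (quot_rep (cls f)) = Dom C f" "Cod C (quot_rep (cls f)) = Cod C f"
    if "f \<in> Arr C" for f
    using quot_rep(1)[OF Arr_homset[OF that]] by (simp_all add: homset_iff)
  then show ?thesis by (auto simp: homset_iff quot_cat_def)
qed

lemma quot_Arr: "Arr Q = cls ` Arr C"
  by (simp add: quot_cat_def)

end

text \<open>An additive map that sends one ideal into the other is compatible with classes.\<close>

lemma quot_class_map:
  assumes "additive_map C D X Y X' Y' \<phi>" "additive_quotient C J" "additive_quotient D J'"
    and \<phi>: "\<And>h. \<lbrakk>h \<in> homset C X Y; h \<in> J\<rbrakk> \<Longrightarrow> \<phi> h \<in> J'"
    and f: "f \<in> homset C X Y"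
  shows "quot_class D J' (\<phi> (quot_rep (quot_class C J f))) = quot_class D J' (\<phi> f)"
proof -
  interpret additive_map C D X Y X' Y' \<phi> by fact
  interpret QC: additive_quotient C J by fact
  interpret QD: additive_quotient D J' by fact
  let ?r = "quot_rep (quot_class C J f)"
  note r = QC.quot_rep[OF f]
  have "Add D (\<phi> ?r) (neg D (\<phi> f)) = \<phi> (Add C ?r (neg C f))"
    using map_Add[OF r(1) C.neg_closed[OF f]] map_neg[OF f] by simp
  then have "Add D (\<phi> ?r) (neg D (\<phi> f)) \<in> J'"
    using \<phi>[OF C.Add_closed[OF r(1) C.neg_closed[OF f]] r(2)] by simp
  then show ?thesis using QD.quot_class_eqI[OF map_closed[OF r(1)] map_closed[OF f]] by simp
qed

text \<open>Hence so is a biadditive operation that respects ideals in both arguments: change one argument at a time.\<close>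

lemma quot_op_class:
  assumes "additive_quotient A JA" "additive_quotient B JB" "additive_quotient C JC"
    and f: "f \<in> homset A X X'" and g: "g \<in> homset B Y Y'"
    and left: "\<And>g. g \<in> homset B Y Y' \<Longrightarrow> additive_map A C X X' Z Z' (\<lambda>f. F f g)"
    and right: "additive_map B C Y Y' Z Z' (F f)"
    and idl: "\<And>h g. \<lbrakk>h \<in> homset A X X'; g \<in> homset B Y Y'; h \<in> JA\<rbrakk> \<Longrightarrow> F h g \<in> JC"
    and idr: "\<And>h. \<lbrakk>h \<in> homset B Y Y'; h \<in> JB\<rbrakk> \<Longrightarrow> F f h \<in> JC"
  shows "quot_op C JC F (quot_class A JA f) (quot_class B JB g) = quot_class C JC (F f g)"
proof -
  interpret QB: additive_quotient B JB by fact
  note r = QB.quot_rep(1)[OF g]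
  show ?thesis
    unfolding quot_op_def using quot_class_map[OF left[OF r] assms(1,3) _ f] idl[OF _ r]
      quot_class_map[OF right assms(2,3) idr g] by simp
qed

context additive_quotient
begin

lemma quot_Comp:
  assumes f: "f \<in> homset C X Y" and g: "g \<in> homset C Y Z"
  shows "Comp Q (cls g) (cls f) = cls (Comp C g f)"
proof -
  note obj = homset_Obj[OF f] homset_Obj[OF g]
  have "quot_op C J (Comp C) (cls g) (cls f) = cls (Comp C g f)"
    using additive_quotient_axioms additive_quotient_axioms additive_quotient_axioms g f
  proof (rule quot_op_class)
    show "additive_map C C Y Z X Z (\<lambda>g. Comp C g f)" if "f \<in> homset C X Y" for f
      by (rule additive_map_Comp_right[OF that obj(4)])
    show "additive_map C C X Y X Z (Comp C g)" by (rule additive_map_Comp_left[OF g obj(1)])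
  qed (use ideal_Comp_left ideal_Comp_right g in blast)+
  then show ?thesis by (simp add: quot_op_def quot_cat_def)
qed

lemma quot_Add:
  assumes f: "f \<in> homset C X Y" and g: "g \<in> homset C X Y"
  shows "Add Q (cls f) (cls g) = cls (Add C f g)"
proof -
  let ?f = "quot_rep (cls f)" and ?g = "quot_rep (cls g)"
  note rf = quot_rep[OF f] and rg = quot_rep[OF g]
  have "Add C (Add C ?f ?g) (neg C (Add C f g)) = Add C (Add C ?f (neg C f)) (Add C ?g (neg C g))"
    using neg_Add_distrib[OF f g] Add_interchange[OF rf(1) rg(1) neg_closed[OF f] neg_closed[OF g]] by simp
  also have "\<dots> \<in> J"
    by (rule ideal_Add[OF Add_closed[OF rf(1) neg_closed[OF f]] Add_closed[OF rg(1) neg_closed[OF g]] rf(2) rg(2)])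
  finally show ?thesis
    using quot_class_eqI[OF Add_closed[OF rf(1) rg(1)] Add_closed[OF f g]] by (simp add: quot_cat_def)
qed

lemma quot_class_hom: "f \<in> homset C X Y \<Longrightarrow> cls f \<in> homset Q X Y"
  by (simp add: quot_hom)

lemma additive_quot_cat: "additive_category Q"
proof (intro additive_category.intro category.intro additive_category_axioms.intro)
  fix c assume "c \<in> Arr Q"
  then obtain f where "f \<in> Arr C" "c = cls f" by (auto simp: quot_Arr)
  then have "c \<in> homset Q (Dom C f) (Cod C f)" "Dom C f \<in> Obj C" "Cod C f \<in> Obj C"
    using quot_class_hom[OF Arr_homset] Dom_closed Cod_closed by auto
  then show "Dom Q c \<in> Obj Q" "Cod Q c \<in> Obj Q"
    by (auto simp: homset_iff)
next
  fix X assume "X \<in> Obj Q"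
  then show "Idn Q X \<in> homset Q X X"
    by (simp add: quot_Idn quot_class_hom Idn_closed)
next
  fix c e X Y Z assume "c \<in> homset Q X Y" "e \<in> homset Q Y Z"
  then show "Comp Q e c \<in> homset Q X Z"
    unfolding quot_hom[of X Y] quot_hom[of Y Z] using quot_Comp quot_class_hom Comp_closed by auto
next
  fix c X Y assume "c \<in> homset Q X Y"
  then obtain f where f: "f \<in> homset C X Y" "c = cls f" by (auto simp: quot_hom)
  show "Comp Q c (Idn Q X) = c" "Comp Q (Idn Q Y) c = c"
    using quot_Comp[OF Idn_closed f(1)] quot_Comp[OF f(1) Idn_closed] Comp_Idn[OF f(1)] Idn_Comp[OF f(1)]
      homset_Obj[OF f(1)] by (simp_all add: f(2) quot_Idn)
next
  fix c e k W X Y Z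
  assume "c \<in> homset Q W X" "e \<in> homset Q X Y" "k \<in> homset Q Y Z"
  then obtain f g h where f: "f \<in> homset C W X" "c = cls f"
    and g: "g \<in> homset C X Y" "e = cls g" and h: "h \<in> homset C Y Z" "k = cls h"
    by (auto simp: quot_hom)
  show "Comp Q k (Comp Q e c) = Comp Q (Comp Q k e) c"
    using Comp_assoc[OF f(1) g(1) h(1)]
    by (simp add: f(2) g(2) h(2) quot_Comp[OF f(1) g(1)] quot_Comp[OF g(1) h(1)]
      quot_Comp[OF Comp_closed[OF f(1) g(1)] h(1)] quot_Comp[OF f(1) Comp_closed[OF g(1) h(1)]])
next
  fix X Y assume "X \<in> Obj Q" "Y \<in> Obj Q"
  then have XY: "X \<in> Obj C" "Y \<in> Obj C" by auto
  show "abelian_group (Hom Q X Y)"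
  proof (rule abelian_groupI, simp_all)
    fix c assume "c \<in> homset Q X Y"
    then obtain f where f: "f \<in> homset C X Y" "c = cls f" by (auto simp: quot_hom)
    show "Add Q (Zero Q X Y) c = c"
      by (simp add: f(2) quot_Zero quot_Add[OF Zero_closed[OF XY] f(1)] Zero_Add[OF f(1)])
    show "\<exists>e\<in>homset Q X Y. Add Q e c = Zero Q X Y"
      using quot_class_hom[OF neg_closed[OF f(1)]]
      by (rule bexI[rotated]) (simp add: f(2) quot_Zero quot_Add[OF neg_closed[OF f(1)] f(1)] neg_Add[OF f(1)])
    fix e assume "e \<in> homset Q X Y"
    then obtain g where g: "g \<in> homset C X Y" "e = cls g" by (auto simp: quot_hom)
    show "Add Q c e \<in> homset Q X Y"
      by (simp add: f(2) g(2) quot_Add[OF f(1) g(1)] quot_class_hom Add_closed[OF f(1) g(1)])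
    show "Add Q c e = Add Q e c"
      by (simp add: f(2) g(2) quot_Add[OF f(1) g(1)] quot_Add[OF g(1) f(1)] Add_commute[OF f(1) g(1)])
    fix k assume "k \<in> homset Q X Y"
    then obtain h where h: "h \<in> homset C X Y" "k = cls h" by (auto simp: quot_hom)
    show "Add Q (Add Q c e) k = Add Q c (Add Q e k)"
      using Add_assoc[OF f(1) g(1) h(1)]
      by (simp add: f(2) g(2) h(2) quot_Add[OF f(1) g(1)] quot_Add[OF g(1) h(1)]
        quot_Add[OF Add_closed[OF f(1) g(1)] h(1)] quot_Add[OF f(1) Add_closed[OF g(1) h(1)]])
  next
    show "Zero Q X Y \<in> homset Q X Y"
      by (simp add: quot_Zero quot_class_hom Zero_closed XY)
  qed
  obtain S i j p q where b: "is_biproduct C X Y S i j p q" using biproduct_exists XY by blast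
  then have S: "S \<in> Obj C" and h: "i \<in> homset C X S" "j \<in> homset C Y S" "p \<in> homset C S X" "q \<in> homset C S Y"
    by (auto simp: is_biproduct_def)
  have "is_biproduct Q X Y S (cls i) (cls j) (cls p) (cls q)"
    using b S h unfolding is_biproduct_def
    by (simp add: quot_class_hom quot_Comp[OF h(1) h(3)] quot_Comp[OF h(1) h(4)] quot_Comp[OF h(2) h(3)]
      quot_Comp[OF h(2) h(4)] quot_Comp[OF h(3) h(1)] quot_Comp[OF h(4) h(2)]
      quot_Add[OF Comp_closed[OF h(3) h(1)] Comp_closed[OF h(4) h(2)]] quot_Idn quot_Zero)
  then show "\<exists>S i j p q. is_biproduct Q X Y S i j p q" by blast
next
  fix c c' e X Y Z
  assume "c \<in> homset Q X Y" "c' \<in> homset Q X Y" "e \<in> homset Q Y Z"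
  then obtain f f' g where f: "f \<in> homset C X Y" "c = cls f"
    and f': "f' \<in> homset C X Y" "c' = cls f'" and g: "g \<in> homset C Y Z" "e = cls g"
    by (auto simp: quot_hom)
  show "Comp Q e (Add Q c c') = Add Q (Comp Q e c) (Comp Q e c')"
    using Comp_Add_right[OF f(1) f'(1) g(1)]
    by (simp add: f(2) f'(2) g(2) quot_Add[OF f(1) f'(1)] quot_Comp[OF f(1) g(1)] quot_Comp[OF f'(1) g(1)]
      quot_Comp[OF Add_closed[OF f(1) f'(1)] g(1)] quot_Add[OF Comp_closed[OF f(1) g(1)] Comp_closed[OF f'(1) g(1)]])
next
  fix c e e' X Y Z
  assume "c \<in> homset Q X Y" "e \<in> homset Q Y Z" "e' \<in> homset Q Y Z"
  then obtain f g g' where f: "f \<in> homset C X Y" "c = cls f"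
    and g: "g \<in> homset C Y Z" "e = cls g" and g': "g' \<in> homset C Y Z" "e' = cls g'"
    by (auto simp: quot_hom)
  show "Comp Q (Add Q e e') c = Add Q (Comp Q e c) (Comp Q e' c)"
    using Comp_Add_left[OF f(1) g(1) g'(1)]
    by (simp add: f(2) g(2) g'(2) quot_Add[OF g(1) g'(1)] quot_Comp[OF f(1) g(1)] quot_Comp[OF f(1) g'(1)]
      quot_Comp[OF f(1) Add_closed[OF g(1) g'(1)]] quot_Add[OF Comp_closed[OF f(1) g(1)] Comp_closed[OF f(1) g'(1)]])
next
  obtain Z where Z: "zero_object C Z" using zero_object_exists by blast
  have "\<exists>!c. c \<in> homset Q X Y" if "\<exists>!f. f \<in> homset C X Y" for X Y
    using that unfolding quot_hom by blast
  then have "zero_object Q Z" using Z by (simp add: zero_object_def)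
  then show "\<exists>Z. zero_object Q Z" by blast
qed

end

context biadditive_functor
begin

lemma additive_map_FM_left:
  assumes "g \<in> homset B Y Y'" "X \<in> Obj A" "X' \<in> Obj A"
  shows "additive_map A C X X' (FO X Y) (FO X' Y') (\<lambda>f. FM f g)"
proof unfold_locales
  show "FM (Add A f f') g = Add C (FM f g) (FM f' g)" if "f \<in> homset A X X'" "f' \<in> homset A X X'" for f f'
    using FM_Add_left[OF that] assms(1) by (simp add: homset_iff)
qed (use assms FM_closed in blast)+

lemma additive_map_FM_right:
  assumes "f \<in> homset A X X'" "Y \<in> Obj B" "Y' \<in> Obj B"
  shows "additive_map B C Y Y' (FO X Y) (FO X' Y') (FM f)"
proof unfold_locales
  show "FM f (Add B g g') = Add C (FM f g) (FM f g')" if "g \<in> homset B Y Y'" "g' \<in> homset B Y Y'" for g g'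
    using FM_Add_right[OF _ that] assms(1) by (simp add: homset_iff)
qed (use assms FM_closed in blast)+

end

text \<open>A biadditive functor whose value lies in \<open>JC\<close> if one of its arguments lies in \<open>JA\<close>, respectively \<open>JB\<close>.\<close>

locale biadditive_quotient =
  biadditive_functor A B C FO FM +
  QA: additive_quotient A JA + QB: additive_quotient B JB + QC: additive_quotient C JC
  for A :: "('a, 'f) cat" and B :: "('b, 'g) cat" and C :: "('c, 'h) cat"
    and FO FM JA JB JC +
  assumes FM_ideal_left: "\<lbrakk>f \<in> JA; g \<in> Arr B\<rbrakk> \<Longrightarrow> FM f g \<in> JC"
    and FM_ideal_right: "\<lbrakk>f \<in> Arr A; g \<in> JB\<rbrakk> \<Longrightarrow> FM f g \<in> JC"
begin

lemma quot_FM: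
  assumes "f \<in> Arr A" "g \<in> Arr B"
  shows "quot_op C JC FM (quot_class A JA f) (quot_class B JB g) = quot_class C JC (FM f g)"
proof -
  note f = A.Arr_homset[OF assms(1)] and g = B.Arr_homset[OF assms(2)]
  show ?thesis
    using QA.additive_quotient_axioms QB.additive_quotient_axioms QC.additive_quotient_axioms f g
  proof (rule quot_op_class)
    show "additive_map A C (Dom A f) (Cod A f) (FO (Dom A f) (Dom B g)) (FO (Cod A f) (Cod B g)) (\<lambda>f. FM f h)"
      if "h \<in> homset B (Dom B g) (Cod B g)" for h
      using additive_map_FM_left[OF that] A.homset_Obj[OF f] by simp
    show "additive_map B C (Dom B g) (Cod B g) (FO (Dom A f) (Dom B g)) (FO (Cod A f) (Cod B g)) (FM f)"
      using additive_map_FM_right[OF f] B.homset_Obj[OF g] by simp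
  qed (use assms FM_ideal_left FM_ideal_right in \<open>auto simp: homset_iff\<close>)
qed

lemma biadditive_quot:
  "biadditive_functor QA.Q QB.Q QC.Q FO (quot_op C JC FM)"
proof (intro biadditive_functor.intro biadditive_functor_axioms.intro)
  show "additive_category QA.Q" "additive_category QB.Q" "additive_category QC.Q"
    by (rule QA.additive_quot_cat QB.additive_quot_cat QC.additive_quot_cat)+
next
  fix X Y assume "X \<in> Obj QA.Q" "Y \<in> Obj QB.Q"
  then have XY: "X \<in> Obj A" "Y \<in> Obj B" by auto
  then show "FO X Y \<in> Obj QC.Q" by (simp add: FO_closed)
  show "quot_op C JC FM (Idn QA.Q X) (Idn QB.Q Y) = Idn QC.Q (FO X Y)"
    using quot_FM[of "Idn A X" "Idn B Y"] A.Idn_closed[OF XY(1)] B.Idn_closed[OF XY(2)] FM_Idn[OF XY]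
    by (simp add: QA.quot_Idn QB.quot_Idn QC.quot_Idn homset_iff)
next
  fix c e X X' Y Y' assume "c \<in> homset QA.Q X X'" "e \<in> homset QB.Q Y Y'"
  then obtain f g where f: "f \<in> homset A X X'" "c = QA.cls f"
    and g: "g \<in> homset B Y Y'" "e = QB.cls g" by (auto simp: QA.quot_hom QB.quot_hom)
  have "quot_op C JC FM c e = QC.cls (FM f g)"
    using quot_FM f g by (simp add: homset_iff)
  then show "quot_op C JC FM c e \<in> homset QC.Q (FO X Y) (FO X' Y')"
    using QC.quot_class_hom[OF FM_closed[OF f(1) g(1)]] by simp
next
  fix c c' e e' X X' X'' Y Y' Y''
  assume "c \<in> homset QA.Q X X'" "c' \<in> homset QA.Q X' X''"
    "e \<in> homset QB.Q Y Y'" "e' \<in> homset QB.Q Y' Y''"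
  then obtain f f' g g' where f: "f \<in> homset A X X'" "c = QA.cls f"
    and f': "f' \<in> homset A X' X''" "c' = QA.cls f'"
    and g: "g \<in> homset B Y Y'" "e = QB.cls g" and g': "g' \<in> homset B Y' Y''" "e' = QB.cls g'"
    by (auto simp: QA.quot_hom QB.quot_hom)
  have "Comp A f' f \<in> Arr A" "Comp B g' g \<in> Arr B"
    using A.Comp_closed[OF f(1) f'(1)] B.Comp_closed[OF g(1) g'(1)] by (auto simp: homset_iff)
  moreover have "f \<in> Arr A" "f' \<in> Arr A" "g \<in> Arr B" "g' \<in> Arr B" using f f' g g' by (auto simp: homset_iff)
  ultimately show "quot_op C JC FM (Comp QA.Q c' c) (Comp QB.Q e' e)
      = Comp QC.Q (quot_op C JC FM c' e') (quot_op C JC FM c e)"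
    by (simp add: f(2) f'(2) g(2) g'(2) QA.quot_Comp[OF f(1) f'(1)] QB.quot_Comp[OF g(1) g'(1)] quot_FM
      QC.quot_Comp[OF FM_closed[OF f(1) g(1)] FM_closed[OF f'(1) g'(1)]] FM_Comp[OF f(1) f'(1) g(1) g'(1)])
next
  fix c c' e X X'
  assume "c \<in> homset QA.Q X X'" "c' \<in> homset QA.Q X X'" "e \<in> Arr QB.Q"
  then obtain f f' g where f: "f \<in> homset A X X'" "c = QA.cls f"
    and f': "f' \<in> homset A X X'" "c' = QA.cls f'" and g: "g \<in> Arr B" "e = QB.cls g"
    by (auto simp: QA.quot_hom QB.quot_Arr)
  note h = FM_closed[OF f(1) B.Arr_homset[OF g(1)]] FM_closed[OF f'(1) B.Arr_homset[OF g(1)]]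
  have "f \<in> Arr A" "f' \<in> Arr A" "Add A f f' \<in> Arr A"
    using f f' A.Add_closed[OF f(1) f'(1)] by (auto simp: homset_iff)
  then show "quot_op C JC FM (Add QA.Q c c') e
      = Add QC.Q (quot_op C JC FM c e) (quot_op C JC FM c' e)"
    by (simp add: f(2) f'(2) g QA.quot_Add[OF f(1) f'(1)] quot_FM QC.quot_Add[OF h] FM_Add_left[OF f(1) f'(1) g(1)])
next
  fix c e e' Y Y'
  assume "c \<in> Arr QA.Q" "e \<in> homset QB.Q Y Y'" "e' \<in> homset QB.Q Y Y'"
  then obtain f g g' where f: "f \<in> Arr A" "c = QA.cls f"
    and g: "g \<in> homset B Y Y'" "e = QB.cls g" and g': "g' \<in> homset B Y Y'" "e' = QB.cls g'"
    by (auto simp: QA.quot_Arr QB.quot_hom)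
  note h = FM_closed[OF A.Arr_homset[OF f(1)] g(1)] FM_closed[OF A.Arr_homset[OF f(1)] g'(1)]
  have "g \<in> Arr B" "g' \<in> Arr B" "Add B g g' \<in> Arr B"
    using g g' B.Add_closed[OF g(1) g'(1)] by (auto simp: homset_iff)
  then show "quot_op C JC FM c (Add QB.Q e e')
      = Add QC.Q (quot_op C JC FM c e) (quot_op C JC FM c e')"
    by (simp add: f g(2) g'(2) QB.quot_Add[OF g(1) g'(1)] quot_FM QC.quot_Add[OF h] FM_Add_right[OF f(1) g(1) g'(1)])
qed

end

lemma strict_monoidal_action_quot:
  assumes "strict_monoidal_action A TO TM U C LO LM"
    and "biadditive_quotient A A A TO TM JA JA JA" "biadditive_quotient A C C LO LM JA JC JC"
  shows "strict_monoidal_action (quot_cat A JA) TO (quot_op A JA TM) U (quot_cat C JC) LO (quot_op C JC LM)"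
proof -
  interpret strict_monoidal_action A TO TM U C LO LM by fact
  interpret T: biadditive_quotient A A A TO TM JA JA JA by fact
  interpret L: biadditive_quotient A C C LO LM JA JC JC by fact
  have TM_Arr: "TM f g \<in> Arr A" if "f \<in> Arr A" "g \<in> Arr A" for f g
    using FM_closed[OF A.Arr_homset[OF that(1)] A.Arr_homset[OF that(2)]] by (simp add: homset_iff)
  have LM_Arr: "LM f g \<in> Arr C" if "f \<in> Arr A" "g \<in> Arr C" for f g
    using action.FM_closed[OF A.Arr_homset[OF that(1)] action.B.Arr_homset[OF that(2)]] by (simp add: homset_iff)
  have I: "Idn A U \<in> Arr A" using A.Idn_closed[OF U_closed] by (simp add: homset_iff)
  interpret Tq: biadditive_functor "quot_cat A JA" "quot_cat A JA" "quot_cat A JA" TO "quot_op A JA TM"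
    by (rule T.biadditive_quot)
  interpret Lq: biadditive_functor "quot_cat A JA" "quot_cat C JC" "quot_cat C JC" LO "quot_op C JC LM"
    by (rule L.biadditive_quot)
  have "strict_monoidal_category (quot_cat A JA) TO (quot_op A JA TM) U"
    by unfold_locales
      (use I TM_Arr in \<open>auto simp: T.QA.quot_Arr T.QA.quot_Idn T.quot_FM U_closed TO_assoc TO_unit TM_assoc TM_unit\<close>)
  then interpret Sq: strict_monoidal_category "quot_cat A JA" TO "quot_op A JA TM" U .
  show ?thesis
    by unfold_locales
      (use I TM_Arr LM_Arr in \<open>auto simp: T.QA.quot_Arr L.QB.quot_Arr T.QA.quot_Idn T.quot_FM L.quot_FM
        LO_assoc LO_unit LM_assoc LM_unit\<close>)
qed

section \<open>Signs\<close>

text \<open>The morphism \<open>(-1)\<^sup>k f\<close>.\<close>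

definition alt :: "('o, 'm) cat \<Rightarrow> int \<Rightarrow> 'm \<Rightarrow> 'm" where
  "alt C k f = (if even k then f else neg C f)"

text \<open>The automorphism of a family that is \<open>(-1)\<^sup>k\<close> in height \<open>k\<close>.\<close>

definition sign_mat :: "('o, 'm) cat \<Rightarrow> (idx \<Rightarrow> 'o) \<Rightarrow> idx \<Rightarrow> idx \<Rightarrow> 'm" where
  "sign_mat C X = diag_mat C X X (\<lambda>a. alt C (ht a) (Idn C (X a)))"

context additive_category
begin

interpretation fam: additive_category "fam_cat C" by (rule additive_fam_cat)

lemma alt_closed: "f \<in> homset C X Y \<Longrightarrow> alt C k f \<in> homset C X Y"
  by (simp add: alt_def neg_closed)

lemma alt_Comp_left:
  "\<lbrakk>f \<in> homset C X Y; g \<in> homset C Y Z\<rbrakk> \<Longrightarrow> Comp C (alt C k g) f = alt C k (Comp C g f)"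
  by (simp add: alt_def Comp_neg_left)

lemma alt_Comp_right:
  "\<lbrakk>f \<in> homset C X Y; g \<in> homset C Y Z\<rbrakk> \<Longrightarrow> Comp C g (alt C k f) = alt C k (Comp C g f)"
  by (simp add: alt_def Comp_neg_right)

lemma alt_alt: "f \<in> homset C X Y \<Longrightarrow> alt C k (alt C k f) = f"
  by (simp add: alt_def neg_neg)

lemma alt_Suc: "f \<in> homset C X Y \<Longrightarrow> alt C (k + 1) f = neg C (alt C k f)"
  by (simp add: alt_def neg_neg)

lemma alt_add: "f \<in> homset C X Y \<Longrightarrow> alt C k (alt C l f) = alt C (k + l) f"
  by (simp add: alt_def neg_neg)

lemma alt_Zero: "\<lbrakk>X \<in> Obj C; Y \<in> Obj C\<rbrakk> \<Longrightarrow> alt C k (Zero C X Y) = Zero C X Y"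
  by (simp add: alt_def neg_Zero)

lemma sign_entry: "(\<And>a. X a \<in> Obj C) \<Longrightarrow> alt C (ht a) (Idn C (X a)) \<in> homset C (X a) (X a)"
  by (simp add: alt_closed Idn_closed)

lemma sign_mat_hom: "X \<in> Obj Fam \<Longrightarrow> sign_mat C X \<in> homset Fam X X"
  unfolding sign_mat_def fam_hom by (rule is_mat_diag) (simp add: sign_entry)

lemma sign_mat_homog: "X \<in> Obj Fam \<Longrightarrow> homog C 0 X X (sign_mat C X)"
  using sign_mat_hom by (auto simp: homog_def sign_mat_def diag_mat_def)

lemma sign_Comp_entry:
  assumes "M \<in> homset Fam X Y"
  shows "(sign_mat C Y \<odot>\<^sub>C M) a b = alt C (ht a) (M a b)"
    and "(M \<odot>\<^sub>C sign_mat C X) a b = alt C (ht b) (M a b)"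
proof -
  have M: "is_mat C X Y M" using assms by (simp add: fam_hom)
  note obj = is_mat_Obj[OF M] and m = is_mat_hom[OF M, of a b]
  have s: "\<And>a. alt C (ht a) (Idn C (X a)) \<in> homset C (X a) (X a)"
    "\<And>a. alt C (ht a) (Idn C (Y a)) \<in> homset C (Y a) (Y a)"
    using sign_entry obj by blast+
  show "(sign_mat C Y \<odot>\<^sub>C M) a b = alt C (ht a) (M a b)"
    using Comp_diag_left[OF M s(2)] alt_Comp_left[OF m Idn_closed[OF obj(2)]] Idn_Comp[OF m]
    by (simp add: sign_mat_def)
  show "(M \<odot>\<^sub>C sign_mat C X) a b = alt C (ht b) (M a b)"
    using Comp_diag_right[OF s(1) M] alt_Comp_right[OF Idn_closed[OF obj(1)] m] Comp_Idn[OF m]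
    by (simp add: sign_mat_def)
qed

lemma sign_mat_commute:
  assumes "homog C 0 X Y M"
  shows "sign_mat C Y \<odot>\<^sub>C M = M \<odot>\<^sub>C sign_mat C X"
proof (intro ext)
  fix a b
  have "alt C (ht a) (M a b) = alt C (ht b) (M a b)"
    using homog_zero[OF assms, of a b] alt_Zero is_mat_Obj[OF homog_mat[OF assms]]
    by (cases "ht a = ht b") auto
  then show "(sign_mat C Y \<odot>\<^sub>C M) a b = (M \<odot>\<^sub>C sign_mat C X) a b"
    using sign_Comp_entry[OF homog_hom[OF assms]] by simp
qed

lemma sign_mat_anticommute:
  assumes "homog C p X Y M" "odd p"
  shows "sign_mat C Y \<odot>\<^sub>C M = neg Fam (M \<odot>\<^sub>C sign_mat C X)"
proof -
  have X: "X \<in> Obj Fam" using is_mat_Obj(1)[OF homog_mat[OF assms(1)]] by simp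
  have "alt C (ht a) (M a b) = neg C (alt C (ht b) (M a b))" for a b
    using homog_zero[OF assms(1), of a b] alt_Zero neg_Zero is_mat_Obj[OF homog_mat[OF assms(1)]]
      assms(2) neg_neg[OF homog_entry[OF assms(1)]]
    by (cases "ht a = ht b + p") (auto simp: alt_def)
  then show ?thesis
    using sign_Comp_entry[OF homog_hom[OF assms(1)]]
      fam_neg[OF fam.Comp_closed[OF sign_mat_hom[OF X] homog_hom[OF assms(1)]]] by (simp add: fun_eq_iff)
qed

lemma sign_mat_involution:
  assumes "M \<in> homset Fam X Y"
  shows "sign_mat C Y \<odot>\<^sub>C (sign_mat C Y \<odot>\<^sub>C M) = M"
    "(M \<odot>\<^sub>C sign_mat C X) \<odot>\<^sub>C sign_mat C X = M"
proof -
  have M: "is_mat C X Y M" using assms by (simp add: fam_hom)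
  note obj = fam.homset_Obj[OF assms]
  note S = fam.Comp_closed[OF assms sign_mat_hom[OF obj(2)]] fam.Comp_closed[OF sign_mat_hom[OF obj(1)] assms]
  show "sign_mat C Y \<odot>\<^sub>C (sign_mat C Y \<odot>\<^sub>C M) = M"
    "(M \<odot>\<^sub>C sign_mat C X) \<odot>\<^sub>C sign_mat C X = M"
    using sign_Comp_entry(1)[OF S(1)] sign_Comp_entry(2)[OF S(2)] sign_Comp_entry[OF assms]
      alt_alt[OF is_mat_hom[OF M]] by (auto simp: fun_eq_iff)
qed

end

section \<open>The product of two matrices along a biadditive functor\<close>

text \<open>
  The product of two families, with indices cut after the first \<open>n\<close> positions, and the product of two
  matrices, with the row index cut after \<open>n'\<close> and the column index cut after \<open>n\<close> positions. No signs
  are involved; they are inserted with \<^const>\<open>sign_mat\<close>.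
\<close>

definition kron_obj :: "('a \<Rightarrow> 'b \<Rightarrow> 'c) \<Rightarrow> nat \<Rightarrow> (idx \<Rightarrow> 'a) \<Rightarrow> (idx \<Rightarrow> 'b) \<Rightarrow> idx \<Rightarrow> 'c" where
  "kron_obj FO n X Y a = FO (X (\<pi> n a)) (Y (\<sigma> n a))"

definition kron :: "('f \<Rightarrow> 'g \<Rightarrow> 'h) \<Rightarrow> nat \<Rightarrow> nat \<Rightarrow>
    (idx \<Rightarrow> idx \<Rightarrow> 'f) \<Rightarrow> (idx \<Rightarrow> idx \<Rightarrow> 'g) \<Rightarrow> idx \<Rightarrow> idx \<Rightarrow> 'h" where
  "kron FM n' n M N a b = FM (M (\<pi> n' a) (\<pi> n b)) (N (\<sigma> n' a) (\<sigma> n b))"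

text \<open>The family \<open>X\<close> vanishes at the indices that have a nonzero coordinate after the first \<open>n\<close> ones.\<close>

definition supported :: "('o, 'm) cat \<Rightarrow> nat \<Rightarrow> (idx \<Rightarrow> 'o) \<Rightarrow> bool" where
  "supported B n X \<longleftrightarrow> (\<forall>u. \<pi> n u \<noteq> u \<longrightarrow> zero_object B (X u))"

lemma pyramid_supported:
  assumes "is_pyramid B X"
  shows "supported B (prank X) (pobj X)"
  unfolding supported_def
proof (intro allI impI)
  fix u assume "\<pi> (prank X) u \<noteq> u"
  then obtain i where "coord (\<pi> (prank X) u) i \<noteq> coord u i" using poly_mapping_eqI[of "\<pi> (prank X) u" u] by blast
  then have "prank X \<le> i" "coord u i \<noteq> 0" by (auto split: if_splits)
  then show "zero_object B (pobj X u)" by (rule pyramid_rank[OF assms])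
qed

context biadditive_functor
begin

interpretation famA: additive_category "fam_cat A" by (rule A.additive_fam_cat)
interpretation famB: additive_category "fam_cat B" by (rule B.additive_fam_cat)
interpretation famC: additive_category "fam_cat C" by (rule C.additive_fam_cat)

lemma FM_Zero_left:
  "\<lbrakk>g \<in> homset B Y Y'; X \<in> Obj A; X' \<in> Obj A\<rbrakk> \<Longrightarrow> FM (Zero A X X') g = Zero C (FO X Y) (FO X' Y')"
  by (rule additive_map.map_Zero[OF additive_map_FM_left])

lemma FM_Zero_right:
  "\<lbrakk>f \<in> homset A X X'; Y \<in> Obj B; Y' \<in> Obj B\<rbrakk> \<Longrightarrow> FM f (Zero B Y Y') = Zero C (FO X Y) (FO X' Y')"
  by (rule additive_map.map_Zero[OF additive_map_FM_right])

lemma FM_neg_left: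
  "\<lbrakk>f \<in> homset A X X'; g \<in> homset B Y Y'\<rbrakk> \<Longrightarrow> FM (neg A f) g = neg C (FM f g)"
  using additive_map.map_neg[OF additive_map_FM_left] A.homset_Obj by blast

lemma FM_neg_right:
  "\<lbrakk>f \<in> homset A X X'; g \<in> homset B Y Y'\<rbrakk> \<Longrightarrow> FM f (neg B g) = neg C (FM f g)"
  using additive_map.map_neg[OF additive_map_FM_right] B.homset_Obj by blast

lemma FM_alt_left: "\<lbrakk>f \<in> homset A X X'; g \<in> homset B Y Y'\<rbrakk> \<Longrightarrow> FM (alt A k f) g = alt C k (FM f g)"
  by (simp add: alt_def FM_neg_left)

lemma FM_alt_right: "\<lbrakk>f \<in> homset A X X'; g \<in> homset B Y Y'\<rbrakk> \<Longrightarrow> FM f (alt B k g) = alt C k (FM f g)"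
  by (simp add: alt_def FM_neg_right)

lemma FO_zero_left: "\<lbrakk>zero_object A X; Y \<in> Obj B\<rbrakk> \<Longrightarrow> zero_object C (FO X Y)"
  using FM_Idn[of X Y] FM_Zero_left[OF B.Idn_closed, of Y X X]
  by (simp add: A.zero_object_iff C.zero_object_iff FO_closed)

lemma FO_zero_right: "\<lbrakk>X \<in> Obj A; zero_object B Y\<rbrakk> \<Longrightarrow> zero_object C (FO X Y)"
  using FM_Idn[of X Y] FM_Zero_right[OF A.Idn_closed, of X Y Y]
  by (simp add: B.zero_object_iff C.zero_object_iff FO_closed)

lemma kron_obj_fam:
  "\<lbrakk>X \<in> Obj A.Fam; Y \<in> Obj B.Fam\<rbrakk> \<Longrightarrow> kron_obj FO n X Y \<in> Obj C.Fam"
  by (simp add: kron_obj_def FO_closed)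

lemma kron_entry:
  assumes "M \<in> homset A.Fam X X'" "N \<in> homset B.Fam Y Y'"
  shows "kron FM n' n M N a b \<in> homset C (kron_obj FO n X Y b) (kron_obj FO n' X' Y' a)"
  unfolding kron_def kron_obj_def
  by (rule FM_closed[OF is_mat_hom[OF assms(1)[unfolded fam_hom]] is_mat_hom[OF assms(2)[unfolded fam_hom]]])

lemma kron_zero:
  assumes "M \<in> homset A.Fam X X'" "N \<in> homset B.Fam Y Y'"
    and "M (\<pi> n' a) (\<pi> n b) = Zero A (X (\<pi> n b)) (X' (\<pi> n' a)) \<or>
         N (\<sigma> n' a) (\<sigma> n b) = Zero B (Y (\<sigma> n b)) (Y' (\<sigma> n' a))"
  shows "kron FM n' n M N a b = Zero C (kron_obj FO n X Y b) (kron_obj FO n' X' Y' a)"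
proof -
  have M: "is_mat A X X' M" and N: "is_mat B Y Y' N" using assms(1,2) by (simp_all add: fam_hom)
  show ?thesis
    using assms(3) FM_Zero_left[OF is_mat_hom[OF N] is_mat_Obj[OF M]]
      FM_Zero_right[OF is_mat_hom[OF M] is_mat_Obj[OF N]]
    by (auto simp: kron_def kron_obj_def)
qed

lemma kron_hom:
  assumes "M \<in> homset A.Fam X X'" "N \<in> homset B.Fam Y Y'"
  shows "kron FM n' n M N \<in> homset C.Fam (kron_obj FO n X Y) (kron_obj FO n' X' Y')"
proof -
  have M: "is_mat A X X' M" and N: "is_mat B Y Y' N" using assms by (simp_all add: fam_hom)
  have "finite {a. kron FM n' n M N a b \<noteq> Zero C (kron_obj FO n X Y b) (kron_obj FO n' X' Y' a)}" for b
  proof -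
    let ?F = "{u. M u (\<pi> n b) \<noteq> Zero A (X (\<pi> n b)) (X' u)}"
    let ?G = "{v. N v (\<sigma> n b) \<noteq> Zero B (Y (\<sigma> n b)) (Y' v)}"
    have "{a. kron FM n' n M N a b \<noteq> Zero C (kron_obj FO n X Y b) (kron_obj FO n' X' Y' a)}
        \<subseteq> (\<lambda>(u, v). idx_join n' u v) ` (?F \<times> ?G)"
    proof
      fix a assume "a \<in> {a. kron FM n' n M N a b \<noteq> Zero C (kron_obj FO n X Y b) (kron_obj FO n' X' Y' a)}"
      then have "(\<pi> n' a, \<sigma> n' a) \<in> ?F \<times> ?G" using kron_zero[OF assms] by auto
      then show "a \<in> (\<lambda>(u, v). idx_join n' u v) ` (?F \<times> ?G)"
        by (rule rev_image_eqI) simp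
    qed
    moreover have "finite (?F \<times> ?G)" using is_mat_finite[OF M] is_mat_finite[OF N] by blast
    ultimately show ?thesis by (rule finite_subset[OF _ finite_imageI])
  qed
  then show ?thesis
    using kron_entry[OF assms] kron_obj_fam is_mat_Obj[OF M] is_mat_Obj[OF N]
    by (simp add: fam_hom is_mat_def)
qed

lemma kron_homog:
  assumes "homog A p X X' M" "homog B q Y Y' N"
  shows "homog C (p + q) (kron_obj FO n X Y) (kron_obj FO n' X' Y') (kron FM n' n M N)"
proof -
  note hom = homog_hom[OF assms(1)] homog_hom[OF assms(2)]
  have "kron FM n' n M N a b = Zero C (kron_obj FO n X Y b) (kron_obj FO n' X' Y' a)"
    if "ht a \<noteq> ht b + (p + q)" for a b
  proof (rule kron_zero[OF hom])
    have "ht (\<pi> n' a) \<noteq> ht (\<pi> n b) + p \<or> ht (\<sigma> n' a) \<noteq> ht (\<sigma> n b) + q"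
      using that ht_split[of a n'] ht_split[of b n] by auto
    then show "M (\<pi> n' a) (\<pi> n b) = Zero A (X (\<pi> n b)) (X' (\<pi> n' a)) \<or>
        N (\<sigma> n' a) (\<sigma> n b) = Zero B (Y (\<sigma> n b)) (Y' (\<sigma> n' a))"
      using homog_zero[OF assms(1)] homog_zero[OF assms(2)] by blast
  qed
  then show ?thesis using kron_hom[OF hom] by (simp add: homog_def)
qed

lemma kron_Add_left:
  assumes "M \<in> homset A.Fam X X'" "M' \<in> homset A.Fam X X'" "N \<in> homset B.Fam Y Y'"
  shows "kron FM n' n (M \<boxplus>\<^sub>A M') N = kron FM n' n M N \<boxplus>\<^sub>C kron FM n' n M' N"
proof -
  note mat = assms[unfolded fam_hom]
  have "N v y \<in> Arr B" for v y using is_mat_hom[OF mat(3)] by (simp add: homset_iff)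
  then show ?thesis
    using FM_Add_left[OF is_mat_hom[OF mat(1)] is_mat_hom[OF mat(2)]]
    by (simp add: fun_eq_iff kron_def fam_simps)
qed

lemma kron_Add_right:
  assumes "M \<in> homset A.Fam X X'" "N \<in> homset B.Fam Y Y'" "N' \<in> homset B.Fam Y Y'"
  shows "kron FM n' n M (N \<boxplus>\<^sub>B N') = kron FM n' n M N \<boxplus>\<^sub>C kron FM n' n M N'"
proof -
  note mat = assms[unfolded fam_hom]
  have "M u x \<in> Arr A" for u x using is_mat_hom[OF mat(1)] by (simp add: homset_iff)
  then show ?thesis
    using FM_Add_right[OF _ is_mat_hom[OF mat(2)] is_mat_hom[OF mat(3)]]
    by (simp add: fun_eq_iff kron_def fam_simps)
qed

lemma kron_neg_left:
  assumes "M \<in> homset A.Fam X X'" "N \<in> homset B.Fam Y Y'"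
  shows "kron FM n' n (neg A.Fam M) N = neg C.Fam (kron FM n' n M N)"
  using FM_neg_left[OF is_mat_hom[OF assms(1)[unfolded fam_hom]] is_mat_hom[OF assms(2)[unfolded fam_hom]]]
    C.fam_neg[OF kron_hom[OF assms]] A.fam_neg[OF assms(1)]
  by (simp add: fun_eq_iff kron_def)

lemma kron_Idn:
  assumes "X \<in> Obj A.Fam" "Y \<in> Obj B.Fam"
  shows "kron FM n n (Idn A.Fam X) (Idn B.Fam Y) = Idn C.Fam (kron_obj FO n X Y)"
proof (intro ext)
  fix a b
  have obj: "X u \<in> Obj A" "Y u \<in> Obj B" for u using assms by auto
  note I = famA.Idn_closed[OF assms(1)] famB.Idn_closed[OF assms(2)]
  show "kron FM n n (Idn A.Fam X) (Idn B.Fam Y) a b = Idn C.Fam (kron_obj FO n X Y) a b"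
  proof (cases "a = b")
    case True
    then show ?thesis using FM_Idn[OF obj] by (simp add: kron_def fam_Idn diag_mat_def kron_obj_def)
  next
    case False
    then have "\<pi> n a \<noteq> \<pi> n b \<or> \<sigma> n a \<noteq> \<sigma> n b" using idx_split_eqI by blast
    then have "kron FM n n (Idn A.Fam X) (Idn B.Fam Y) a b
        = Zero C (kron_obj FO n X Y b) (kron_obj FO n X Y a)"
      by (intro kron_zero[OF I]) (auto simp: fam_Idn diag_mat_def)
    then show ?thesis using False by (simp add: fam_Idn diag_mat_def)
  qed
qed

text \<open>
  The family in the middle has to vanish outside the first \<open>n'\<close> positions: then the summation over
  an index \<open>c\<close> is one over arbitrary pairs \<open>(\<pi> n' c, \<sigma> n' c)\<close>.
\<close>

lemma kron_Comp:
  assumes M: "M \<in> homset A.Fam X X'" "M' \<in> homset A.Fam X' X''"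
    and N: "N \<in> homset B.Fam Y Y'" "N' \<in> homset B.Fam Y' Y''"
    and supp: "supported A n' X'"
  shows "kron FM n'' n' M' N' \<odot>\<^sub>C kron FM n' n M N = kron FM n'' n (M' \<odot>\<^sub>A M) (N' \<odot>\<^sub>B N)"
proof (intro ext)
  fix a b
  have mat: "is_mat A X X' M" "is_mat A X' X'' M'" "is_mat B Y Y' N" "is_mat B Y' Y'' N'"
    using M N by (simp_all add: fam_hom)
  note K = kron_hom[OF M(1) N(1), of n' n, unfolded fam_hom] kron_hom[OF M(2) N(2), of n'' n', unfolded fam_hom]
  let ?x = "\<pi> n b" and ?y = "\<sigma> n b" and ?x'' = "\<pi> n'' a" and ?y'' = "\<sigma> n'' a"
  let ?S = "kron_obj FO n X Y b" and ?T = "kron_obj FO n'' X'' Y'' a"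
  let ?F = "{u. M u ?x \<noteq> Zero A (X ?x) (X' u)}" and ?G = "{v. N v ?y \<noteq> Zero B (Y ?y) (Y' v)}"
  let ?f = "\<lambda>u. Comp A (M' ?x'' u) (M u ?x)" and ?g = "\<lambda>v. Comp B (N' ?y'' v) (N v ?y)"
  have F: "finite ?F" and G: "finite ?G" using is_mat_finite mat by blast+
  have f: "?f u \<in> homset A (X ?x) (X'' ?x'')" for u
    by (rule A.Comp_closed[OF is_mat_hom[OF mat(1)] is_mat_hom[OF mat(2)]])
  have g: "?g v \<in> homset B (Y ?y) (Y'' ?y'')" for v
    by (rule B.Comp_closed[OF is_mat_hom[OF mat(3)] is_mat_hom[OF mat(4)]])
  have fg: "FM (?f u) (?g v) \<in> homset C ?S ?T" for u v
    unfolding kron_obj_def by (rule FM_closed[OF f g])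
  have ST: "?S \<in> Obj C" "?T \<in> Obj C" using C.homset_Obj[OF fg] by auto
  have XX: "X ?x \<in> Obj A" "X'' ?x'' \<in> Obj A" "Y ?y \<in> Obj B" "Y'' ?y'' \<in> Obj B"
    using A.homset_Obj[OF f] B.homset_Obj[OF g] by auto
  let ?sum = "finsum (Hom C ?S ?T)"
  interpret H: abelian_group "Hom C ?S ?T" by (rule C.Hom_abelian_group[OF ST])
  have pi: "\<pi> n' u = u" if "u \<in> ?F" for u
    using that supp A.homset_zero_object[OF is_mat_hom[OF mat(1)]] unfolding supported_def by blast
  \<comment> \<open>the support of the middle index runs over the pairs \<open>(u, v)\<close>, glued to one index\<close>
  let ?j = "\<lambda>(u, v). idx_join n' u v"
  have inj: "inj_on ?j (?F \<times> ?G)"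
  proof (rule inj_onI, clarify)
    fix u v u' v'
    assume eq: "idx_join n' u v = idx_join n' u' v'"
      and "M u ?x \<noteq> Zero A (X ?x) (X' u)" "M u' ?x \<noteq> Zero A (X ?x) (X' u')"
    then have "\<pi> n' u = u" "\<pi> n' u' = u'" using pi by auto
    then show "u = u' \<and> v = v'"
      using arg_cong[OF eq, of "\<pi> n'"] arg_cong[OF eq, of "\<sigma> n'"] by (simp add: pi_join)
  qed
  let ?t = "\<lambda>c. Comp C (kron FM n'' n' M' N' a c) (kron FM n' n M N c b)"
  have t: "?t c = FM (?f (\<pi> n' c)) (?g (\<sigma> n' c))" for c
    unfolding kron_def
    by (rule FM_Comp[symmetric, OF is_mat_hom[OF mat(1)] is_mat_hom[OF mat(2)]
          is_mat_hom[OF mat(3)] is_mat_hom[OF mat(4)]])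
  have "(kron FM n'' n' M' N' \<odot>\<^sub>C kron FM n' n M N) a b = ?sum ?t (?j ` (?F \<times> ?G))"
  proof (rule C.fam_Comp_entry[OF K])
    show "finite (?j ` (?F \<times> ?G))" using F G by blast
    fix c assume "c \<notin> ?j ` (?F \<times> ?G)"
    then have "(\<pi> n' c, \<sigma> n' c) \<notin> ?F \<times> ?G" by (metis (no_types, lifting) join_split case_prod_conv image_eqI)
    then show "kron FM n' n M N c b = Zero C ?S (kron_obj FO n' X' Y' c)"
      by (intro kron_zero[OF M(1) N(1)]) auto
  qed
  also have "\<dots> = ?sum (\<lambda>p. ?t (?j p)) (?F \<times> ?G)"
    by (rule H.finsum_reindex[OF _ inj]) (use fg t in auto)
  also have "\<dots> = ?sum (\<lambda>(u, v). FM (?f u) (?g v)) (?F \<times> ?G)"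
    by (rule H.finsum_cong'[OF refl]) (use fg pi in \<open>auto simp: t pi_join\<close>)
  also have "\<dots> = ?sum (\<lambda>u. ?sum (\<lambda>v. FM (?f u) (?g v)) ?G) ?F"
    using C.finsum_product[OF ST F G, of "\<lambda>u v. FM (?f u) (?g v)"] fg by simp
  also have "\<dots> = ?sum (\<lambda>u. FM (?f u) (finsum (Hom B (Y ?y) (Y'' ?y'')) ?g ?G)) ?F"
  proof -
    have "?sum (\<lambda>v. FM (?f u) (?g v)) ?G = FM (?f u) (finsum (Hom B (Y ?y) (Y'' ?y'')) ?g ?G)" for u
      unfolding kron_obj_def
      by (rule additive_map.map_finsum[OF additive_map_FM_right[OF f XX(3,4)] G g, symmetric])
    then show ?thesis by simp
  qed
  also have "\<dots> = FM (finsum (Hom A (X ?x) (X'' ?x'')) ?f ?F) (finsum (Hom B (Y ?y) (Y'' ?y'')) ?g ?G)"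
  proof -
    interpret HB: abelian_group "Hom B (Y ?y) (Y'' ?y'')" by (rule B.Hom_abelian_group[OF XX(3,4)])
    have "finsum (Hom B (Y ?y) (Y'' ?y'')) ?g ?G \<in> homset B (Y ?y) (Y'' ?y'')"
      using g by (intro HB.finsum_closed) auto
    from additive_map.map_finsum[OF additive_map_FM_left[OF this XX(1,2)] F f]
    show ?thesis by (simp add: kron_obj_def)
  qed
  also have "finsum (Hom A (X ?x) (X'' ?x'')) ?f ?F = (M' \<odot>\<^sub>A M) ?x'' ?x"
    by (rule A.fam_Comp_entry[OF mat(1,2) F, symmetric]) auto
  also have "finsum (Hom B (Y ?y) (Y'' ?y'')) ?g ?G = (N' \<odot>\<^sub>B N) ?y'' ?y"
    by (rule B.fam_Comp_entry[OF mat(3,4) G, symmetric]) auto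
  finally show "(kron FM n'' n' M' N' \<odot>\<^sub>C kron FM n' n M N) a b
      = kron FM n'' n (M' \<odot>\<^sub>A M) (N' \<odot>\<^sub>B N) a b"
    by (simp only: kron_def[of FM n'' n "M' \<odot>\<^sub>A M" "N' \<odot>\<^sub>B N"])
qed

end

section \<open>The product of pyramids\<close>

lemma prod_simps [simp]:
  "pobj (pyr_prod_obj A B C FO FM X Y) = kron_obj FO (prank X) (pobj X) (pobj Y)"
  "prank (pyr_prod_obj A B C FO FM X Y) = prank X + prank Y"
  by (auto simp: pyr_prod_obj_def Let_def kron_obj_def)

lemma prod_diff:
  "pdiff (pyr_prod_obj A B C FO FM X Y) a i = (let n = prank X in
     if i < n then FM (pdiff X (\<pi> n a) i) (Idn B (pobj Y (\<sigma> n a)))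
     else alt C (ht (\<pi> n a)) (FM (Idn A (pobj X (\<pi> n a))) (pdiff Y (\<sigma> n a) (i - n))))"
  by (simp add: pyr_prod_obj_def Let_def alt_def)

context biadditive_functor
begin

interpretation famA: additive_category "fam_cat A" by (rule A.additive_fam_cat)
interpretation famB: additive_category "fam_cat B" by (rule B.additive_fam_cat)
interpretation famC: additive_category "fam_cat C" by (rule C.additive_fam_cat)

abbreviation mprod :: "('a, 'f) pmor \<Rightarrow> ('b, 'g) pmor \<Rightarrow> ('c, 'h) pmor" where
  "mprod \<equiv> pyr_prod_mor A B C FO FM"

abbreviation pprod :: "('a, 'f) pyr \<Rightarrow> ('b, 'g) pyr \<Rightarrow> ('c, 'h) pyr" where
  "pprod \<equiv> pyr_prod_obj A B C FO FM"

lemma prod_diff_diff: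
  assumes X: "is_pyramid A X" and Y: "is_pyramid B Y"
  defines "n \<equiv> prank X"
  shows "\<lbrakk>i < n; j < n\<rbrakk> \<Longrightarrow> Comp C (pdiff (pprod X Y) (a + \<epsilon> i) j) (pdiff (pprod X Y) a i)
      = FM (Comp A (pdiff X (\<pi> n a + \<epsilon> i) j) (pdiff X (\<pi> n a) i)) (Idn B (pobj Y (\<sigma> n a)))"
    and "\<lbrakk>n \<le> i; n \<le> j\<rbrakk> \<Longrightarrow> Comp C (pdiff (pprod X Y) (a + \<epsilon> i) j) (pdiff (pprod X Y) a i)
      = FM (Idn A (pobj X (\<pi> n a))) (Comp B (pdiff Y (\<sigma> n a + \<epsilon> (i - n)) (j - n)) (pdiff Y (\<sigma> n a) (i - n)))"
    and "\<lbrakk>i < n; n \<le> j\<rbrakk> \<Longrightarrow> Comp C (pdiff (pprod X Y) (a + \<epsilon> i) j) (pdiff (pprod X Y) a i)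
      = neg C (alt C (ht (\<pi> n a)) (FM (pdiff X (\<pi> n a) i) (pdiff Y (\<sigma> n a) (j - n))))"
    and "\<lbrakk>n \<le> i; j < n\<rbrakk> \<Longrightarrow> Comp C (pdiff (pprod X Y) (a + \<epsilon> i) j) (pdiff (pprod X Y) a i)
      = alt C (ht (\<pi> n a)) (FM (pdiff X (\<pi> n a) j) (pdiff Y (\<sigma> n a) (i - n)))"
proof -
  let ?x = "\<pi> n a" and ?y = "\<sigma> n a"
  note dX = pyramid_diff[OF X] and dY = pyramid_diff[OF Y]
  have IX: "Idn A (pobj X x) \<in> homset A (pobj X x) (pobj X x)" for x
    by (rule A.Idn_closed[OF pyramid_Obj[OF X]])
  have IY: "Idn B (pobj Y y) \<in> homset B (pobj Y y) (pobj Y y)" for y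
    by (rule B.Idn_closed[OF pyramid_Obj[OF Y]])
  note simps = prod_diff Let_def n_def[symmetric] pi_add sigma_add ht_add
  show "Comp C (pdiff (pprod X Y) (a + \<epsilon> i) j) (pdiff (pprod X Y) a i)
      = FM (Comp A (pdiff X (?x + \<epsilon> i) j) (pdiff X ?x i)) (Idn B (pobj Y ?y))" if "i < n" "j < n"
    using that FM_Comp[OF dX[of ?x i] dX[of "?x + \<epsilon> i" j] IY[of ?y] IY[of ?y]] B.Idn_Comp[OF IY[of ?y]] by (simp add: simps)
  show "Comp C (pdiff (pprod X Y) (a + \<epsilon> i) j) (pdiff (pprod X Y) a i)
      = FM (Idn A (pobj X ?x)) (Comp B (pdiff Y (?y + \<epsilon> (i - n)) (j - n)) (pdiff Y ?y (i - n)))"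
    if "n \<le> i" "n \<le> j"
  proof -
    let ?f = "FM (Idn A (pobj X ?x)) (pdiff Y ?y (i - n))"
      and ?g = "FM (Idn A (pobj X ?x)) (pdiff Y (?y + \<epsilon> (i - n)) (j - n))"
    note f = FM_closed[OF IX[of ?x] dY[of ?y "i - n"]] and g = FM_closed[OF IX[of ?x] dY[of "?y + \<epsilon> (i - n)" "j - n"]]
    have "Comp C (alt C (ht ?x) ?g) (alt C (ht ?x) ?f) = Comp C ?g ?f"
      using C.alt_Comp_left[OF C.alt_closed[OF f] g] C.alt_Comp_right[OF f g] C.alt_alt[OF C.Comp_closed[OF f g]]
      by simp
    then show ?thesis
      using that FM_Comp[OF IX[of ?x] IX[of ?x] dY[of ?y "i - n"] dY[of "?y + \<epsilon> (i - n)" "j - n"]] A.Idn_Comp[OF IX[of ?x]] by (simp add: simps)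
  qed
  show "Comp C (pdiff (pprod X Y) (a + \<epsilon> i) j) (pdiff (pprod X Y) a i)
      = neg C (alt C (ht ?x) (FM (pdiff X ?x i) (pdiff Y ?y (j - n))))" if "i < n" "n \<le> j"
  proof -
    note f = FM_closed[OF dX[of ?x i] IY[of ?y]] and g = FM_closed[OF IX[of "?x + \<epsilon> i"] dY[of ?y "j - n"]]
    show ?thesis
      using that FM_Comp[OF dX[of ?x i] IX[of "?x + \<epsilon> i"] IY[of ?y] dY[of ?y "j - n"]]
        A.Idn_Comp[OF dX[of ?x i]] B.Comp_Idn[OF dY[of ?y "j - n"]]
        C.alt_Comp_left[OF f g] C.alt_Suc[OF C.Comp_closed[OF f g]]
      by (simp add: simps)
  qed
  show "Comp C (pdiff (pprod X Y) (a + \<epsilon> i) j) (pdiff (pprod X Y) a i)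
      = alt C (ht ?x) (FM (pdiff X ?x j) (pdiff Y ?y (i - n)))" if "n \<le> i" "j < n"
  proof -
    note g = FM_closed[OF dX[of ?x j] IY[of "?y + \<epsilon> (i - n)"]] and f = FM_closed[OF IX[of ?x] dY[of ?y "i - n"]]
    show ?thesis
      using that FM_Comp[OF IX[of ?x] dX[of ?x j] dY[of ?y "i - n"] IY[of "?y + \<epsilon> (i - n)"]]
        A.Comp_Idn[OF dX[of ?x j]] B.Idn_Comp[OF dY[of ?y "i - n"]]
        C.alt_Comp_right[OF f g]
      by (simp add: simps)
  qed
qed

lemma is_pyramid_prod:
  assumes X: "is_pyramid A X" and Y: "is_pyramid B Y"
  shows "is_pyramid C (pprod X Y)"
proof -
  define n where "n = prank X"
  note dX = pyramid_diff[OF X] and dY = pyramid_diff[OF Y]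
  note oX = pyramid_Obj[OF X] and oY = pyramid_Obj[OF Y]
  note IX = A.Idn_closed[OF oX] and IY = B.Idn_closed[OF oY]
  note dd = prod_diff_diff[OF X Y, folded n_def]
  obtain m m' where m: "\<And>a i. m \<le> coord a i \<Longrightarrow> zero_object A (pobj X a)"
    and m': "\<And>a i. m' \<le> coord a i \<Longrightarrow> zero_object B (pobj Y a)"
    using pyramid_bounded[OF X] pyramid_bounded[OF Y] by blast
  show ?thesis
  proof (rule pyramidI)
    show "pobj (pprod X Y) a \<in> Obj C" for a using FO_closed oX oY by (simp add: kron_obj_def)
    show "pdiff (pprod X Y) a i \<in> homset C (pobj (pprod X Y) a) (pobj (pprod X Y) (a + \<epsilon> i))" for a i
      using FM_closed[OF dX[of "\<pi> n a" i] IY[of "\<sigma> n a"]]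
        C.alt_closed[OF FM_closed[OF IX[of "\<pi> n a"] dY[of "\<sigma> n a" "i - n"]], of "ht (\<pi> n a)"]
      by (simp add: prod_diff Let_def n_def[symmetric] kron_obj_def pi_add sigma_add)
    show "zero_object C (pobj (pprod X Y) a)" if "prank (pprod X Y) \<le> i" "coord a i \<noteq> 0" for a i
      unfolding prod_simps kron_obj_def
    proof (rule FO_zero_right[OF oX])
      show "zero_object B (pobj Y (\<sigma> (prank X) a))"
        using that by (intro pyramid_rank[OF Y, of "i - prank X"]) auto
    qed
    show "zero_object C (pobj (pprod X Y) a)" if "max m m' \<le> coord a i" for a i
    proof (cases "i < prank X")
      case True
      then have "zero_object A (pobj X (\<pi> (prank X) a))" using that by (intro m[of _ i]) auto
      then show ?thesis using FO_zero_left[OF _ oY] by (simp add: kron_obj_def)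
    next
      case False
      then have "zero_object B (pobj Y (\<sigma> (prank X) a))" using that by (intro m'[of _ "i - prank X"]) auto
      then show ?thesis using FO_zero_right[OF oX] by (simp add: kron_obj_def)
    qed
    show "Comp C (pdiff (pprod X Y) (a + \<epsilon> i) i) (pdiff (pprod X Y) a i)
        = Zero C (pobj (pprod X Y) a) (pobj (pprod X Y) (a + \<epsilon> i + \<epsilon> i))" for a i
    proof (cases "i < n")
      case True
      then have cut: "\<pi> n (a + \<epsilon> i + \<epsilon> i) = \<pi> n a + \<epsilon> i + \<epsilon> i" "\<sigma> n (a + \<epsilon> i + \<epsilon> i) = \<sigma> n a"
        by (simp_all only: pi_add sigma_add pi_eps sigma_eps if_True add_0_right)
      show ?thesis
        unfolding prod_simps kron_obj_def n_def[symmetric] cut dd(1)[OF True True] pyramid_diff_diff[OF X]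
        by (rule FM_Zero_left[OF IY oX oX])
    next
      case False
      then have cut: "\<pi> n (a + \<epsilon> i + \<epsilon> i) = \<pi> n a"
          "\<sigma> n (a + \<epsilon> i + \<epsilon> i) = \<sigma> n a + \<epsilon> (i - n) + \<epsilon> (i - n)"
        by (simp_all only: pi_add sigma_add pi_eps sigma_eps if_False add_0_right)
      have i: "n \<le> i" using False by simp
      show ?thesis
        unfolding prod_simps kron_obj_def n_def[symmetric] cut dd(2)[OF i i] pyramid_diff_diff[OF Y]
        by (rule FM_Zero_right[OF IX oY oY])
    qed
    show "Comp C (pdiff (pprod X Y) (a + \<epsilon> i) j) (pdiff (pprod X Y) a i)
        = neg C (Comp C (pdiff (pprod X Y) (a + \<epsilon> j) i) (pdiff (pprod X Y) a j))" for a i j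
    proof -
      consider "i < n" "j < n" | "n \<le> i" "n \<le> j" | "i < n" "n \<le> j" | "n \<le> i" "j < n" by linarith
      then show ?thesis
      proof cases
        case 1
        then show ?thesis
          using pyramid_anticommute[OF X, of "\<pi> n a" i j] FM_neg_left[OF A.Comp_closed[OF dX dX] IY]
          by (simp add: dd(1))
      next
        case 2
        then show ?thesis
          using pyramid_anticommute[OF Y, of "\<sigma> n a" "i - n" "j - n"]
            FM_neg_right[OF IX B.Comp_closed[OF dY dY]]
          by (simp add: dd(2))
      next
        case 3
        \<comment> \<open>a step in the first factor changes the sign of the following step in the second one\<close>
        then show ?thesis by (simp add: dd(3,4))
      next
        case 4
        then show ?thesis
          using C.neg_neg[OF C.alt_closed[OF FM_closed[OF dX dY]]] by (simp add: dd(3,4))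
      qed
    qed
  qed
qed

text \<open>The differential of a product is \<open>d \<otimes> 1 + s (1 \<otimes> \<partial>)\<close> with the sign \<open>s\<close> of the first factor.\<close>

lemma diff_mat_prod:
  assumes X: "is_pyramid A X" and Y: "is_pyramid B Y"
  defines "n \<equiv> prank X"
  shows "diff_mat C (pprod X Y) =
    kron FM n n (diff_mat A X) (Idn B.Fam (pobj Y)) \<boxplus>\<^sub>C kron FM n n (sign_mat A (pobj X)) (diff_mat B Y)"
proof (intro ext)
  fix a b
  note dX = pyramid_diff[OF X] and dY = pyramid_diff[OF Y]
  note oX = pyramid_Obj[OF X] and oY = pyramid_Obj[OF Y]
  note IX = A.Idn_closed[OF oX] and IY = B.Idn_closed[OF oY]
  note fX = A.pobj_fam[OF X] and fY = B.pobj_fam[OF Y]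
  note D = A.diff_mat_hom[OF X] B.diff_mat_hom[OF Y]
  let ?K = "kron FM n n (diff_mat A X) (Idn B.Fam (pobj Y))"
    and ?L = "kron FM n n (sign_mat A (pobj X)) (diff_mat B Y)"
  note K = kron_hom[OF D(1) famB.Idn_closed[OF fY], of n n]
    and L = kron_hom[OF A.sign_mat_hom[OF fX] D(2), of n n]
  note K0 = kron_zero[OF D(1) famB.Idn_closed[OF fY], of n a n b]
    and L0 = kron_zero[OF A.sign_mat_hom[OF fX] D(2), of n a n b]
  let ?O = "Zero C (pobj (pprod X Y) b) (pobj (pprod X Y) a)"
  have KL: "?K a b \<in> homset C (pobj (pprod X Y) b) (pobj (pprod X Y) a)"
    "?L a b \<in> homset C (pobj (pprod X Y) b) (pobj (pprod X Y) a)"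
    using is_mat_hom K L by (simp_all add: fam_hom n_def)
  show "diff_mat C (pprod X Y) a b = (?K \<boxplus>\<^sub>C ?L) a b"
  proof (cases "\<exists>i. a = b + \<epsilon> i")
    case True
    then obtain i where a: "a = b + \<epsilon> i" by blast
    show ?thesis
    proof (cases "i < n")
      case True
      have "coord (\<pi> n a) i \<noteq> coord (\<pi> n b) i"
        using True a by (simp add: lookup_add lookup_eps)
      then have "\<pi> n a \<noteq> \<pi> n b" by metis
      then have "?L a b = ?O" using L0 by (simp add: sign_mat_def diag_mat_def n_def)
      moreover have "?K a b = pdiff (pprod X Y) b i"
        using True a by (simp add: kron_def pi_add sigma_add prod_diff n_def[symmetric] fam_Idn diag_mat_def)
      ultimately show ?thesis using C.Add_Zero[OF KL(1)] a by (simp add: fam_simps)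
    next
      case False
      have "coord (\<sigma> n a) (i - n) \<noteq> coord (\<sigma> n b) (i - n)"
        using False a by (simp add: lookup_add lookup_eps)
      then have "\<sigma> n a \<noteq> \<sigma> n b" by metis
      then have "?K a b = ?O" using K0 by (simp add: fam_Idn diag_mat_def n_def)
      moreover have "?L a b = pdiff (pprod X Y) b i"
        using False a FM_neg_left[OF IX dY]
        by (simp add: kron_def pi_add sigma_add prod_diff n_def[symmetric] sign_mat_def diag_mat_def alt_def Let_def)
      ultimately show ?thesis using C.Zero_Add[OF KL(2)] a by (simp add: fam_simps)
    qed
  next
    case False
    have "?K a b = ?O"
    proof (cases "\<sigma> n a = \<sigma> n b \<and> (\<exists>i. \<pi> n a = \<pi> n b + \<epsilon> i)")
      case True
      then obtain i where i: "\<sigma> n a = \<sigma> n b" "\<pi> n a = \<pi> n b + \<epsilon> i" by blast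
      have "i < n"
      proof (rule ccontr)
        assume "\<not> i < n"
        then show False using arg_cong[OF i(2), of "\<lambda>u. coord u i"] by (simp add: lookup_add lookup_eps)
      qed
      then have "a = b + \<epsilon> i" using i by (rule_tac idx_split_eqI[of n]) (simp_all add: pi_add sigma_add)
      then show ?thesis using \<open>\<nexists>i. a = b + \<epsilon> i\<close> by blast
    next
      case False
      then have "diff_mat A X (\<pi> n a) (\<pi> n b) = Zero A (pobj X (\<pi> n b)) (pobj X (\<pi> n a)) \<or>
          Idn B.Fam (pobj Y) (\<sigma> n a) (\<sigma> n b) = Zero B (pobj Y (\<sigma> n b)) (pobj Y (\<sigma> n a))"
        using diff_mat_zero[of "\<pi> n a" "\<pi> n b" A X] by (auto simp: fam_Idn diag_mat_def)
      then show ?thesis using K0 by (simp add: n_def)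
    qed
    moreover have "?L a b = ?O"
    proof (cases "\<pi> n a = \<pi> n b \<and> (\<exists>i. \<sigma> n a = \<sigma> n b + \<epsilon> i)")
      case True
      then obtain i where i: "\<pi> n a = \<pi> n b" "\<sigma> n a = \<sigma> n b + \<epsilon> i" by blast
      then have "a = b + \<epsilon> (n + i)" by (rule_tac idx_split_eqI[of n]) (simp_all add: pi_add sigma_add)
      then show ?thesis using \<open>\<nexists>i. a = b + \<epsilon> i\<close> by blast
    next
      case False
      then have "sign_mat A (pobj X) (\<pi> n a) (\<pi> n b) = Zero A (pobj X (\<pi> n b)) (pobj X (\<pi> n a)) \<or>
          diff_mat B Y (\<sigma> n a) (\<sigma> n b) = Zero B (pobj Y (\<sigma> n b)) (pobj Y (\<sigma> n a))"
        using diff_mat_zero[of "\<sigma> n a" "\<sigma> n b" B Y] by (auto simp: sign_mat_def diag_mat_def)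
      then show ?thesis using L0 by (simp add: n_def)
    qed
    ultimately show ?thesis
      using False diff_mat_zero[of a b C "pprod X Y"] C.Zero_Add[OF KL(2)] by (simp add: fam_simps)
  qed
qed

text \<open>The two composites of a product of matrices with the differentials of products.\<close>

lemma kron_diff_right:
  assumes X: "is_pyramid A X" and Y: "is_pyramid B Y"
    and M: "M \<in> homset A.Fam (pobj X) X'" and N: "N \<in> homset B.Fam (pobj Y) Y'"
  shows "kron FM n' (prank X) M N \<odot>\<^sub>C diff_mat C (pprod X Y)
    = kron FM n' (prank X) (M \<odot>\<^sub>A diff_mat A X) N
      \<boxplus>\<^sub>C kron FM n' (prank X) (M \<odot>\<^sub>A sign_mat A (pobj X)) (N \<odot>\<^sub>B diff_mat B Y)"
proof -
  note D = A.diff_mat_hom[OF X] B.diff_mat_hom[OF Y]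
  note S = A.sign_mat_hom[OF A.pobj_fam[OF X]] and I = famB.Idn_closed[OF B.pobj_fam[OF Y]]
  note supp = pyramid_supported[OF X]
  show ?thesis
    unfolding diff_mat_prod[OF X Y]
      famC.Comp_Add_right[OF kron_hom[OF D(1) I] kron_hom[OF S D(2)] kron_hom[OF M N]]
      kron_Comp[OF D(1) M I N supp] kron_Comp[OF S M D(2) N supp] famB.Comp_Idn[OF N] ..
qed

lemma kron_diff_left:
  assumes X: "is_pyramid A X'" and Y: "is_pyramid B Y'"
    and M: "M \<in> homset A.Fam X (pobj X')" and N: "N \<in> homset B.Fam Y (pobj Y')"
  shows "diff_mat C (pprod X' Y') \<odot>\<^sub>C kron FM (prank X') n M N
    = kron FM (prank X') n (diff_mat A X' \<odot>\<^sub>A M) N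
      \<boxplus>\<^sub>C kron FM (prank X') n (sign_mat A (pobj X') \<odot>\<^sub>A M) (diff_mat B Y' \<odot>\<^sub>B N)"
proof -
  note D = A.diff_mat_hom[OF X] B.diff_mat_hom[OF Y]
  note S = A.sign_mat_hom[OF A.pobj_fam[OF X]] and I = famB.Idn_closed[OF B.pobj_fam[OF Y]]
  note supp = pyramid_supported[OF X]
  show ?thesis
    unfolding diff_mat_prod[OF X Y]
      famC.Comp_Add_left[OF kron_hom[OF M N] kron_hom[OF D(1) I] kron_hom[OF S D(2)]]
      kron_Comp[OF M D(1) N I supp] kron_Comp[OF M S N D(2) supp] famB.Idn_Comp[OF N] ..
qed

lemma chain_map_kron:
  assumes M: "chain_map A X X' M" and N: "chain_map B Y Y' N"
  shows "chain_map C (pprod X Y) (pprod X' Y') (kron FM (prank X') (prank X) M N)"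
proof -
  note pX = A.chain_map_pyramid[OF M] and pY = B.chain_map_pyramid[OF N]
  note m = A.chain_map_hom[OF M] and n = B.chain_map_hom[OF N]
  have "kron FM (prank X') (prank X) M N \<odot>\<^sub>C diff_mat C (pprod X Y)
      = diff_mat C (pprod X' Y') \<odot>\<^sub>C kron FM (prank X') (prank X) M N"
    unfolding kron_diff_right[OF pX(1) pY(1) m n] kron_diff_left[OF pX(2) pY(2) m n]
      A.chain_map_commute[OF M] B.chain_map_commute[OF N] A.sign_mat_commute[OF A.chain_map_homog[OF M]] ..
  then show ?thesis
    using is_pyramid_prod[OF pX(1) pY(1)] is_pyramid_prod[OF pX(2) pY(2)]
      kron_homog[OF A.chain_map_homog[OF M] B.chain_map_homog[OF N]]
    by (simp add: chain_map_def)
qed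

text \<open>A homotopy in the first factor needs no sign: it is \<open>H \<otimes> N\<close>.\<close>

lemma null_mat_kron_left:
  assumes pX: "is_pyramid A X" "is_pyramid A X'" and M: "null_mat A X X' M" and N: "chain_map B Y Y' N"
  shows "null_mat C (pprod X Y) (pprod X' Y') (kron FM (prank X') (prank X) M N)"
proof -
  note pY = B.chain_map_pyramid[OF N] and n = B.chain_map_hom[OF N]
  obtain H where H: "homog A (-1) (pobj X) (pobj X') H"
      "M = (H \<odot>\<^sub>A diff_mat A X) \<boxplus>\<^sub>A (diff_mat A X' \<odot>\<^sub>A H)"
    using M unfolding null_mat_def by blast
  note h = homog_hom[OF H(1)]
  note D = A.diff_mat_hom[OF pX(1)] A.diff_mat_hom[OF pX(2)] B.diff_mat_hom[OF pY(2)]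
  note S = A.sign_mat_hom[OF A.pobj_fam[OF pX(1)]]
  let ?k = "kron FM (prank X') (prank X)"
  let ?P = "?k (H \<odot>\<^sub>A diff_mat A X) N" and ?R = "?k (diff_mat A X' \<odot>\<^sub>A H) N"
    and ?Q = "?k (H \<odot>\<^sub>A sign_mat A (pobj X)) (diff_mat B Y' \<odot>\<^sub>B N)"
  let ?X = "kron_obj FO (prank X) (pobj X) (pobj Y)" and ?X' = "kron_obj FO (prank X') (pobj X') (pobj Y')"
  have P: "?P \<in> homset C.Fam ?X ?X'" and R: "?R \<in> homset C.Fam ?X ?X'"
    and Q: "?Q \<in> homset C.Fam ?X ?X'"
    using kron_hom[OF famA.Comp_closed[OF D(1) h] n] kron_hom[OF famA.Comp_closed[OF h D(2)] n]
      kron_hom[OF famA.Comp_closed[OF S h] famB.Comp_closed[OF n D(3)]] by auto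
  have "?k H N \<odot>\<^sub>C diff_mat C (pprod X Y) = ?P \<boxplus>\<^sub>C ?Q"
    unfolding kron_diff_right[OF pX(1) pY(1) h n] B.chain_map_commute[OF N] ..
  moreover have "diff_mat C (pprod X' Y') \<odot>\<^sub>C ?k H N = ?R \<boxplus>\<^sub>C neg C.Fam ?Q"
    using A.sign_mat_anticommute[OF H(1)]
      kron_neg_left[OF famA.Comp_closed[OF S h] famB.Comp_closed[OF n D(3)]]
    unfolding kron_diff_left[OF pX(2) pY(2) h n] by simp
  \<comment> \<open>the two mixed terms cancel, as \<open>H\<close> has odd degree and so anticommutes with the sign\<close>
  moreover have "(?P \<boxplus>\<^sub>C ?Q) \<boxplus>\<^sub>C (?R \<boxplus>\<^sub>C neg C.Fam ?Q) = ?P \<boxplus>\<^sub>C ?R"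
    using famC.Add_interchange[OF P Q R famC.neg_closed[OF Q]] famC.Add_neg[OF Q]
      famC.Add_Zero[OF famC.Add_closed[OF P R]] by simp
  moreover have "?k M N = ?P \<boxplus>\<^sub>C ?R"
    unfolding H(2) by (rule kron_Add_left[OF famA.Comp_closed[OF D(1) h] famA.Comp_closed[OF h D(2)] n])
  ultimately have "?k M N = (?k H N \<odot>\<^sub>C diff_mat C (pprod X Y)) \<boxplus>\<^sub>C (diff_mat C (pprod X' Y') \<odot>\<^sub>C ?k H N)"
    by simp
  then show ?thesis
    using kron_homog[OF H(1) B.chain_map_homog[OF N], of "prank X" "prank X'"] unfolding null_mat_def by auto
qed

text \<open>A homotopy in the second factor needs the sign of the first one: it is \<open>s M \<otimes> H\<close>.\<close>

lemma null_mat_kron_right: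
  assumes M: "chain_map A X X' M" and pY: "is_pyramid B Y" "is_pyramid B Y'" and N: "null_mat B Y Y' N"
  shows "null_mat C (pprod X Y) (pprod X' Y') (kron FM (prank X') (prank X) M N)"
proof -
  note pX = A.chain_map_pyramid[OF M] and m = A.chain_map_hom[OF M]
  obtain H where H: "homog B (-1) (pobj Y) (pobj Y') H"
      "N = (H \<odot>\<^sub>B diff_mat B Y) \<boxplus>\<^sub>B (diff_mat B Y' \<odot>\<^sub>B H)"
    using N unfolding null_mat_def by blast
  note h = homog_hom[OF H(1)]
  note D = A.diff_mat_hom[OF pX(1)] A.diff_mat_hom[OF pX(2)] B.diff_mat_hom[OF pY(1)] B.diff_mat_hom[OF pY(2)]
  note obj = A.pobj_fam[OF pX(1)] A.pobj_fam[OF pX(2)]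
  note S = A.sign_mat_hom[OF obj(2)]
  let ?S = "sign_mat A (pobj X')"
  note SM = famA.Comp_closed[OF m S]
  have comm: "?S \<odot>\<^sub>A M = M \<odot>\<^sub>A sign_mat A (pobj X)"
    by (rule A.sign_mat_commute[OF A.chain_map_homog[OF M]])
  have inv: "(?S \<odot>\<^sub>A M) \<odot>\<^sub>A sign_mat A (pobj X) = M" "?S \<odot>\<^sub>A (?S \<odot>\<^sub>A M) = M"
    using A.sign_mat_involution[OF m] comm by simp_all
  have SD: "(?S \<odot>\<^sub>A M) \<odot>\<^sub>A diff_mat A X = neg A.Fam (diff_mat A X' \<odot>\<^sub>A (?S \<odot>\<^sub>A M))"
  proof -
    have "(?S \<odot>\<^sub>A M) \<odot>\<^sub>A diff_mat A X = (?S \<odot>\<^sub>A diff_mat A X') \<odot>\<^sub>A M"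
      using famA.Comp_assoc[OF D(1) m S] famA.Comp_assoc[OF m D(2) S] A.chain_map_commute[OF M] by simp
    also have "\<dots> = neg A.Fam (diff_mat A X' \<odot>\<^sub>A ?S) \<odot>\<^sub>A M"
      using A.sign_mat_anticommute[OF A.homog_diff_mat[OF pX(2)]] by simp
    also have "\<dots> = neg A.Fam (diff_mat A X' \<odot>\<^sub>A (?S \<odot>\<^sub>A M))"
      using famA.Comp_neg_left[OF m famA.Comp_closed[OF S D(2)]] famA.Comp_assoc[OF m S D(2)] by simp
    finally show ?thesis .
  qed
  let ?k = "kron FM (prank X') (prank X)"
  let ?R = "?k (diff_mat A X' \<odot>\<^sub>A (?S \<odot>\<^sub>A M)) H" and ?Q = "?k M (H \<odot>\<^sub>B diff_mat B Y)"
    and ?T = "?k M (diff_mat B Y' \<odot>\<^sub>B H)"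
  let ?X = "kron_obj FO (prank X) (pobj X) (pobj Y)" and ?X' = "kron_obj FO (prank X') (pobj X') (pobj Y')"
  note DSM = famA.Comp_closed[OF SM D(2)]
  have R: "?R \<in> homset C.Fam ?X ?X'" and Q: "?Q \<in> homset C.Fam ?X ?X'"
    and T: "?T \<in> homset C.Fam ?X ?X'"
    using kron_hom[OF DSM h] kron_hom[OF m famB.Comp_closed[OF D(3) h]]
      kron_hom[OF m famB.Comp_closed[OF h D(4)]] by auto
  have "?k (?S \<odot>\<^sub>A M) H \<odot>\<^sub>C diff_mat C (pprod X Y) = neg C.Fam ?R \<boxplus>\<^sub>C ?Q"
    unfolding kron_diff_right[OF pX(1) pY(1) SM h] SD inv kron_neg_left[OF DSM h] ..
  moreover have "diff_mat C (pprod X' Y') \<odot>\<^sub>C ?k (?S \<odot>\<^sub>A M) H = ?R \<boxplus>\<^sub>C ?T"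
    unfolding kron_diff_left[OF pX(2) pY(2) SM h] inv ..
  \<comment> \<open>the differential of the first factor occurs twice, with opposite signs\<close>
  moreover have "(neg C.Fam ?R \<boxplus>\<^sub>C ?Q) \<boxplus>\<^sub>C (?R \<boxplus>\<^sub>C ?T) = ?Q \<boxplus>\<^sub>C ?T"
    using famC.Add_interchange[OF famC.neg_closed[OF R] Q R T] famC.neg_Add[OF R]
      famC.Zero_Add[OF famC.Add_closed[OF Q T]] by simp
  moreover have "?k M N = ?Q \<boxplus>\<^sub>C ?T"
    unfolding H(2) by (rule kron_Add_right[OF m famB.Comp_closed[OF D(3) h] famB.Comp_closed[OF h D(4)]])
  ultimately have "?k M N = (?k (?S \<odot>\<^sub>A M) H \<odot>\<^sub>C diff_mat C (pprod X Y))
      \<boxplus>\<^sub>C (diff_mat C (pprod X' Y') \<odot>\<^sub>C ?k (?S \<odot>\<^sub>A M) H)" by simp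
  moreover have "homog A 0 (pobj X) (pobj X') (?S \<odot>\<^sub>A M)"
    using A.homog_Comp[OF A.chain_map_homog[OF M] A.sign_mat_homog[OF obj(2)]] by simp
  ultimately show ?thesis
    using kron_homog[OF _ H(1), of 0 "pobj X" "pobj X'" "?S \<odot>\<^sub>A M" "prank X" "prank X'"]
    unfolding null_mat_def by auto
qed

lemma prod_mor_pmor_of:
  assumes "homog A 0 (pobj X) (pobj X') M" "N \<in> homset B.Fam (pobj Y) (pobj Y')"
  shows "mprod (pmor_of X X' M) (pmor_of Y Y' N)
    = pmor_of (pprod X Y) (pprod X' Y') (kron FM (prank X') (prank X) M N)"
  unfolding pyr_prod_mor_def Let_def pmor_of_simps pmor_of_def[of "pprod X Y"]
proof (simp only: pmor.ext_inject simp_thms prod_simps, rule level_restrict_cong)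
  fix k and a b :: idx
  assume ht: "ht a = k" "ht b = k"
  let ?n = "prank X" and ?n' = "prank X'"
  show "(if ht (\<pi> ?n' a) = ht (\<pi> ?n b)
      then FM (level_restrict (\<lambda>k. M) (ht (\<pi> ?n' a)) (\<pi> ?n' a) (\<pi> ?n b))
        (level_restrict (\<lambda>k. N) (k - ht (\<pi> ?n' a)) (\<sigma> ?n' a) (\<sigma> ?n b))
      else Zero C (kron_obj FO ?n (pobj X) (pobj Y) b) (kron_obj FO ?n' (pobj X') (pobj Y') a))
    = kron FM ?n' ?n M N a b"
  proof (cases "ht (\<pi> ?n' a) = ht (\<pi> ?n b)")
    case True
    then have "ht (\<sigma> ?n' a) = k - ht (\<pi> ?n' a)" "ht (\<sigma> ?n b) = k - ht (\<pi> ?n' a)"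
      using ht ht_split[of a ?n'] ht_split[of b ?n] by auto
    then show ?thesis using True by (simp add: kron_def)
  next
    case False
    then have "M (\<pi> ?n' a) (\<pi> ?n b) = Zero A (pobj X (\<pi> ?n b)) (pobj X' (\<pi> ?n' a))"
      by (intro homog_zero[OF assms(1)]) simp
    then show ?thesis using False kron_zero[OF homog_hom[OF assms(1)] assms(2)] by simp
  qed
qed

lemmas prod_mor_chain_map = prod_mor_pmor_of[OF A.chain_map_homog B.chain_map_hom]

theorem biadditive_pyr_prod:
  "biadditive_functor A.Pyr B.Pyr C.Pyr pprod mprod"
proof (intro biadditive_functor.intro biadditive_functor_axioms.intro)
  show "additive_category A.Pyr" "additive_category B.Pyr" "additive_category C.Pyr"
    by (rule A.additive_pyr_cat B.additive_pyr_cat C.additive_pyr_cat)+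
next
  fix X Y assume "X \<in> Obj A.Pyr" "Y \<in> Obj B.Pyr"
  then have XY: "is_pyramid A X" "is_pyramid B Y" by auto
  then show "pprod X Y \<in> Obj C.Pyr" by (simp add: is_pyramid_prod)
  show "mprod (Idn A.Pyr X) (Idn B.Pyr Y) = Idn C.Pyr (pprod X Y)"
    unfolding pyr_Idn prod_mor_chain_map[OF A.chain_map_Idn[OF XY(1)] B.chain_map_Idn[OF XY(2)]]
    by (simp add: kron_Idn[OF A.pobj_fam[OF XY(1)] B.pobj_fam[OF XY(2)]])
next
  fix \<alpha> \<beta> X X' Y Y' assume "\<alpha> \<in> homset A.Pyr X X'" "\<beta> \<in> homset B.Pyr Y Y'"
  then obtain M N where M: "chain_map A X X' M" "\<alpha> = pmor_of X X' M" and N: "chain_map B Y Y' N" "\<beta> = pmor_of Y Y' N"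
    by (metis A.pyr_homE B.pyr_homE)
  show "mprod \<alpha> \<beta> \<in> homset C.Pyr (pprod X Y) (pprod X' Y')"
    unfolding M(2) N(2) prod_mor_chain_map[OF M(1) N(1)] by (rule C.pmor_of_Arr[OF chain_map_kron[OF M(1) N(1)]])
next
  fix \<alpha> \<alpha>' \<beta> \<beta>' X X' X'' Y Y' Y''
  assume "\<alpha> \<in> homset A.Pyr X X'" "\<alpha>' \<in> homset A.Pyr X' X''"
    "\<beta> \<in> homset B.Pyr Y Y'" "\<beta>' \<in> homset B.Pyr Y' Y''"
  then obtain M M' N N' where M: "chain_map A X X' M" "\<alpha> = pmor_of X X' M"
    and M': "chain_map A X' X'' M'" "\<alpha>' = pmor_of X' X'' M'"
    and N: "chain_map B Y Y' N" "\<beta> = pmor_of Y Y' N" and N': "chain_map B Y' Y'' N'" "\<beta>' = pmor_of Y' Y'' N'"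
    by (metis A.pyr_homE B.pyr_homE)
  show "mprod (Comp A.Pyr \<alpha>' \<alpha>) (Comp B.Pyr \<beta>' \<beta>)
      = Comp C.Pyr (mprod \<alpha>' \<beta>') (mprod \<alpha> \<beta>)"
    unfolding M(2) M'(2) N(2) N'(2) A.pyr_Comp[OF M(1) M'(1)] B.pyr_Comp[OF N(1) N'(1)]
      prod_mor_chain_map[OF M(1) N(1)] prod_mor_chain_map[OF M'(1) N'(1)]
      prod_mor_chain_map[OF A.chain_map_Comp[OF M(1) M'(1)] B.chain_map_Comp[OF N(1) N'(1)]]
      C.pyr_Comp[OF chain_map_kron[OF M(1) N(1)] chain_map_kron[OF M'(1) N'(1)]]
      kron_Comp[OF A.chain_map_hom[OF M(1)] A.chain_map_hom[OF M'(1)] B.chain_map_hom[OF N(1)]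
        B.chain_map_hom[OF N'(1)] pyramid_supported[OF A.chain_map_pyramid(2)[OF M(1)]]] ..
next
  fix \<alpha> \<alpha>' \<beta> X X'
  assume "\<alpha> \<in> homset A.Pyr X X'" "\<alpha>' \<in> homset A.Pyr X X'" "\<beta> \<in> Arr B.Pyr"
  moreover define Y Y' where "Y = psrc \<beta>" "Y' = ptgt \<beta>"
  ultimately have "\<beta> \<in> homset B.Pyr Y Y'" by (simp add: homset_iff)
  with \<open>\<alpha> \<in> _\<close> \<open>\<alpha>' \<in> _\<close> obtain M M' N where M: "chain_map A X X' M" "\<alpha> = pmor_of X X' M"
    and M': "chain_map A X X' M'" "\<alpha>' = pmor_of X X' M'" and N: "chain_map B Y Y' N" "\<beta> = pmor_of Y Y' N"
    by (metis A.pyr_homE B.pyr_homE)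
  show "mprod (Add A.Pyr \<alpha> \<alpha>') \<beta>
      = Add C.Pyr (mprod \<alpha> \<beta>) (mprod \<alpha>' \<beta>)"
    unfolding M(2) M'(2) N(2) pyr_Add prod_mor_chain_map[OF M(1) N(1)] prod_mor_chain_map[OF M'(1) N(1)]
      prod_mor_chain_map[OF A.chain_map_Add[OF M(1) M'(1)] N(1)]
      kron_Add_left[OF A.chain_map_hom[OF M(1)] A.chain_map_hom[OF M'(1)] B.chain_map_hom[OF N(1)]] ..
next
  fix \<alpha> \<beta> \<beta>' Y Y'
  assume "\<alpha> \<in> Arr A.Pyr" "\<beta> \<in> homset B.Pyr Y Y'" "\<beta>' \<in> homset B.Pyr Y Y'"
  moreover define X X' where "X = psrc \<alpha>" "X' = ptgt \<alpha>"
  ultimately have "\<alpha> \<in> homset A.Pyr X X'" by (simp add: homset_iff)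
  with \<open>\<beta> \<in> _\<close> \<open>\<beta>' \<in> _\<close> obtain M N N' where M: "chain_map A X X' M" "\<alpha> = pmor_of X X' M"
    and N: "chain_map B Y Y' N" "\<beta> = pmor_of Y Y' N" and N': "chain_map B Y Y' N'" "\<beta>' = pmor_of Y Y' N'"
    by (metis A.pyr_homE B.pyr_homE)
  show "mprod \<alpha> (Add B.Pyr \<beta> \<beta>')
      = Add C.Pyr (mprod \<alpha> \<beta>) (mprod \<alpha> \<beta>')"
    unfolding M(2) N(2) N'(2) pyr_Add prod_mor_chain_map[OF M(1) N(1)] prod_mor_chain_map[OF M(1) N'(1)]
      prod_mor_chain_map[OF M(1) B.chain_map_Add[OF N(1) N'(1)]]
      kron_Add_right[OF A.chain_map_hom[OF M(1)] B.chain_map_hom[OF N(1)] B.chain_map_hom[OF N'(1)]] ..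
qed

theorem biadditive_quotient_pyr_prod:
  "biadditive_quotient (pyr_cat A) (pyr_cat B) (pyr_cat C) pprod mprod
     (null_homotopic A) (null_homotopic B) (null_homotopic C)"
proof (intro biadditive_quotient.intro biadditive_quotient_axioms.intro additive_quotient.intro
    additive_quotient_axioms.intro)
  show "biadditive_functor (pyr_cat A) (pyr_cat B) (pyr_cat C) pprod mprod"
    by (rule biadditive_pyr_prod)
  show "additive_category (pyr_cat A)" "additive_category (pyr_cat B)" "additive_category (pyr_cat C)"
    by (rule A.additive_pyr_cat B.additive_pyr_cat C.additive_pyr_cat)+
  show "cat_ideal (pyr_cat A) (null_homotopic A)" "cat_ideal (pyr_cat B) (null_homotopic B)"
    "cat_ideal (pyr_cat C) (null_homotopic C)"
    by (rule A.cat_ideal_null_homotopic B.cat_ideal_null_homotopic C.cat_ideal_null_homotopic)+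
next
  fix \<alpha> \<beta> assume \<alpha>: "\<alpha> \<in> null_homotopic A" and "\<beta> \<in> Arr (pyr_cat B)"
  then have "\<beta> \<in> homset (pyr_cat B) (psrc \<beta>) (ptgt \<beta>)" by (simp add: homset_iff)
  then obtain N where N: "chain_map B (psrc \<beta>) (ptgt \<beta>) N" "\<beta> = pmor_of (psrc \<beta>) (ptgt \<beta>) N"
    by (rule B.pyr_homE)
  obtain M where M: "chain_map A (psrc \<alpha>) (ptgt \<alpha>) M" "null_mat A (psrc \<alpha>) (ptgt \<alpha>) M"
    "\<alpha> = pmor_of (psrc \<alpha>) (ptgt \<alpha>) M"
    using \<alpha> by (rule A.null_homotopicE)
  show "mprod \<alpha> \<beta> \<in> null_homotopic C"
    using null_mat_kron_left[OF A.chain_map_pyramid[OF M(1)] M(2) N(1)]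
      C.null_homotopic_iff[OF chain_map_kron[OF M(1) N(1)]]
    by (subst M(3), subst N(2)) (simp add: prod_mor_chain_map[OF M(1) N(1)])
next
  fix \<alpha> \<beta> assume "\<alpha> \<in> Arr (pyr_cat A)" and \<beta>: "\<beta> \<in> null_homotopic B"
  then have "\<alpha> \<in> homset (pyr_cat A) (psrc \<alpha>) (ptgt \<alpha>)" by (simp add: homset_iff)
  then obtain M where M: "chain_map A (psrc \<alpha>) (ptgt \<alpha>) M" "\<alpha> = pmor_of (psrc \<alpha>) (ptgt \<alpha>) M"
    by (rule A.pyr_homE)
  obtain N where N: "chain_map B (psrc \<beta>) (ptgt \<beta>) N" "null_mat B (psrc \<beta>) (ptgt \<beta>) N"
    "\<beta> = pmor_of (psrc \<beta>) (ptgt \<beta>) N"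
    using \<beta> by (rule B.null_homotopicE)
  show "mprod \<alpha> \<beta> \<in> null_homotopic C"
    using null_mat_kron_right[OF M(1) B.chain_map_pyramid[OF N(1)] N(2)]
      C.null_homotopic_iff[OF chain_map_kron[OF M(1) N(1)]]
    by (subst M(2), subst N(3)) (simp add: prod_mor_chain_map[OF M(1) N(1)])
qed

end

section \<open>Associativity and unit laws\<close>

lemma unit_simps [simp]:
  "pobj (pyr_unit A U) a = (if a = 0 then U else the_zero_object A)"
  "pdiff (pyr_unit A U) a i = Zero A (pobj (pyr_unit A U) a) (pobj (pyr_unit A U) (a + \<epsilon> i))"
  "prank (pyr_unit A U) = 0"
  by (simp_all add: pyr_unit_def Let_def)

lemma single_zero_objectD:
  assumes "single_zero_object A"
  shows "zero_object A (the_zero_object A)" "zero_object A Z \<Longrightarrow> Z = the_zero_object A"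
  using assms theI'[of "zero_object A"] unfolding single_zero_object_def the_zero_object_def by blast+

lemma (in additive_category) is_pyramid_unit:
  assumes "single_zero_object C" "U \<in> Obj C"
  shows "is_pyramid C (pyr_unit C U)"
proof -
  note zero = single_zero_objectD(1)[OF assms(1)]
  then have "the_zero_object C \<in> Obj C" by (simp add: zero_object_def)
  then have obj: "pobj (pyr_unit C U) a \<in> Obj C" for a using assms(2) by simp
  show ?thesis
  proof (rule pyramidI)
    show "zero_object C (pobj (pyr_unit C U) a)" if "coord a i \<noteq> 0" for a i
      using that zero by auto
    show "zero_object C (pobj (pyr_unit C U) a)" if "1 \<le> coord a i" for a i
      using that zero by auto
  qed (use obj Zero_closed[OF obj obj] Comp_Zero_left[OF Zero_closed[OF obj obj] obj] neg_Zero[OF obj obj]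
      in \<open>simp_all del: unit_simps(1) add: ac_simps\<close>)
qed

context strict_monoidal_action
begin

abbreviation tprod :: "('a, 'f) pyr \<Rightarrow> ('a, 'f) pyr \<Rightarrow> ('a, 'f) pyr" where
  "tprod \<equiv> pyr_prod_obj A A A TO TM"

abbreviation tmor :: "('a, 'f) pmor \<Rightarrow> ('a, 'f) pmor \<Rightarrow> ('a, 'f) pmor" where
  "tmor \<equiv> pyr_prod_mor A A A TO TM"

abbreviation amor :: "('a, 'f) pmor \<Rightarrow> ('c, 'g) pmor \<Rightarrow> ('c, 'g) pmor" where
  "amor \<equiv> pyr_prod_mor A C C LO LM"

abbreviation aprod :: "('a, 'f) pyr \<Rightarrow> ('c, 'g) pyr \<Rightarrow> ('c, 'g) pyr" where
  "aprod \<equiv> pyr_prod_obj A C C LO LM"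

text \<open>
  Both sides cut an index into the same three pieces \<open>\<pi> n a\<close>, \<open>\<pi> m (\<sigma> n a)\<close> and \<open>\<sigma> (n + m) a\<close>. In the third
  factor the sign is given by the height of \<open>\<pi> (n + m) a\<close>, which is the sum of those of the first two pieces.
\<close>

lemma prod_assoc:
  assumes X: "is_pyramid A X" and Y: "is_pyramid A Y" and Z: "is_pyramid C Z"
  shows "aprod (tprod X Y) Z = aprod X (aprod Y Z)"
proof (rule pyr.equality)
  let ?n = "prank X" and ?m = "prank Y"
  note dX = pyramid_diff[OF X] and dY = pyramid_diff[OF Y] and dZ = pyramid_diff[OF Z]
  note oX = pyramid_Obj[OF X] and oY = pyramid_Obj[OF Y] and oZ = pyramid_Obj[OF Z]
  note IX = A.Idn_closed[OF oX] and IY = A.Idn_closed[OF oY] and IZ = action.B.Idn_closed[OF oZ]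
  have LM_assoc': "LM (TM f g) h = LM f (LM g h)"
    if "f \<in> homset A S S'" "g \<in> homset A T T'" "h \<in> homset C V V'" for f g h S S' T T' V V'
    using that by (intro LM_assoc) (auto simp: homset_iff)
  note cut = pi_pi sigma_pi sigma_sigma
  show "pobj (aprod (tprod X Y) Z) = pobj (aprod X (aprod Y Z))"
    using LO_assoc[OF oX oY oZ] by (simp add: fun_eq_iff kron_obj_def cut)
  show "pdiff (aprod (tprod X Y) Z) = pdiff (aprod X (aprod Y Z))"
  proof (intro ext)
    fix a i
    let ?x = "\<pi> ?n a" and ?y = "\<pi> ?m (\<sigma> ?n a)" and ?z = "\<sigma> (?n + ?m) a"
    consider "i < ?n" | "?n \<le> i" "i < ?n + ?m" | "?n + ?m \<le> i" by linarith
    then show "pdiff (aprod (tprod X Y) Z) a i = pdiff (aprod X (aprod Y Z)) a i"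
    proof cases
      case 1
      then show ?thesis
        using LM_assoc'[OF dX[of ?x i] IY[of ?y] IZ[of ?z]] action.FM_Idn[OF oY[of ?y] oZ[of ?z]]
        by (simp add: prod_diff Let_def cut kron_obj_def)
    next
      case 2
      let ?k = "ht ?x"
      have "LM (alt A ?k (TM (Idn A (pobj X ?x)) (pdiff Y ?y (i - ?n)))) (Idn C (pobj Z ?z))
          = alt C ?k (LM (Idn A (pobj X ?x)) (LM (pdiff Y ?y (i - ?n)) (Idn C (pobj Z ?z))))"
        using action.FM_alt_left[OF FM_closed[OF IX[of ?x] dY[of ?y "i - ?n"]] IZ[of ?z]]
          LM_assoc'[OF IX[of ?x] dY[of ?y "i - ?n"] IZ[of ?z]] by simp
      moreover have "i - ?n < ?m" using 2 by linarith
      ultimately show ?thesis using 2 by (simp add: prod_diff Let_def cut)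
    next
      case 3
      let ?i = "i - (?n + ?m)"
      have "ht (\<pi> (?n + ?m) a) = ht ?x + ht ?y"
        using ht_split[of "\<pi> (?n + ?m) a" ?n] by (simp add: cut)
      moreover have "LM (Idn A (pobj X ?x)) (alt C (ht ?y) (LM (Idn A (pobj Y ?y)) (pdiff Z ?z ?i)))
          = alt C (ht ?y) (LM (Idn A (TO (pobj X ?x) (pobj Y ?y))) (pdiff Z ?z ?i))"
        using action.FM_alt_right[OF IX[of ?x] action.FM_closed[OF IY[of ?y] dZ[of ?z ?i]]]
          LM_assoc'[OF IX[of ?x] IY[of ?y] dZ[of ?z ?i]] FM_Idn[OF oX[of ?x] oY[of ?y]] by simp
      moreover have "LM (Idn A (TO (pobj X ?x) (pobj Y ?y))) (pdiff Z ?z ?i) \<in> homset C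
          (LO (TO (pobj X ?x) (pobj Y ?y)) (pobj Z ?z)) (LO (TO (pobj X ?x) (pobj Y ?y)) (pobj Z (?z + \<epsilon> ?i)))"
        by (rule action.FM_closed[OF A.Idn_closed[OF FO_closed[OF oX oY]] dZ])
      moreover have "\<not> i - ?n < ?m" using 3 by linarith
      ultimately show ?thesis
        using 3 action.B.alt_add by (simp add: prod_diff Let_def cut kron_obj_def)
    qed
  qed
  show "prank (aprod (tprod X Y) Z) = prank (aprod X (aprod Y Z))" by (simp add: add.assoc)
qed simp

lemma prod_mor_assoc:
  assumes "\<alpha> \<in> homset (pyr_cat A) X X'" "\<beta> \<in> homset (pyr_cat A) Y Y'" "\<gamma> \<in> homset (pyr_cat C) Z Z'"
  shows "amor (tmor \<alpha> \<beta>) \<gamma>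
    = amor \<alpha> (amor \<beta> \<gamma>)"
proof -
  from assms obtain M N P where M: "chain_map A X X' M" "\<alpha> = pmor_of X X' M"
    and N: "chain_map A Y Y' N" "\<beta> = pmor_of Y Y' N" and P: "chain_map C Z Z' P" "\<gamma> = pmor_of Z Z' P"
    by (metis A.pyr_homE action.B.pyr_homE)
  have "LM (TM (M a b) (N c d)) (P e f) = LM (M a b) (LM (N c d) (P e f))" for a b c d e f
    using homog_entry[OF A.chain_map_homog[OF M(1)]] homog_entry[OF A.chain_map_homog[OF N(1)]]
      homog_entry[OF action.B.chain_map_homog[OF P(1)]]
    by (intro LM_assoc) (auto simp: homset_iff)
  then have "kron LM (prank X' + prank Y') (prank X + prank Y) (kron TM (prank X') (prank X) M N) P
      = kron LM (prank X') (prank X) M (kron LM (prank Y') (prank Y) N P)"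
    by (simp add: kron_def fun_eq_iff pi_pi sigma_pi sigma_sigma)
  then show ?thesis
    unfolding M(2) N(2) P(2) prod_mor_chain_map[OF M(1) N(1)] action.prod_mor_chain_map[OF N(1) P(1)]
      action.prod_mor_chain_map[OF chain_map_kron[OF M(1) N(1)] P(1)]
      action.prod_mor_chain_map[OF M(1) action.chain_map_kron[OF N(1) P(1)]]
    using A.chain_map_pyramid[OF M(1)] A.chain_map_pyramid[OF N(1)] action.B.chain_map_pyramid[OF P(1)]
    by (simp add: prod_assoc)
qed

lemma prod_unit:
  assumes "is_pyramid C Y"
  shows "aprod (pyr_unit A U) Y = Y"
proof (rule pyr.equality)
  show "pobj (aprod (pyr_unit A U) Y) = pobj Y"
    using LO_unit[OF pyramid_Obj[OF assms]] by (simp add: fun_eq_iff kron_obj_def)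
  have "pdiff Y a i \<in> Arr C" for a i using pyramid_diff[OF assms] by (simp add: homset_iff)
  then show "pdiff (aprod (pyr_unit A U) Y) = pdiff Y"
    by (simp add: fun_eq_iff prod_diff alt_def LM_unit)
qed simp_all

lemma prod_mor_unit:
  assumes "single_zero_object A" "\<beta> \<in> homset (pyr_cat C) Y Y'"
  shows "amor (Idn (pyr_cat A) (pyr_unit A U)) \<beta> = \<beta>"
proof -
  obtain N where N: "chain_map C Y Y' N" "\<beta> = pmor_of Y Y' N" using assms(2) by (rule action.B.pyr_homE)
  have "N a b \<in> Arr C" for a b
    using homog_entry[OF action.B.chain_map_homog[OF N(1)]] by (simp add: homset_iff)
  then have "kron LM 0 0 (Idn A.Fam (pobj (pyr_unit A U))) N = N"
    by (simp add: kron_def fun_eq_iff fam_Idn diag_mat_def LM_unit)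
  then show ?thesis
    unfolding N(2) pyr_Idn
      action.prod_mor_chain_map[OF A.chain_map_Idn[OF A.is_pyramid_unit[OF assms(1) U_closed]] N(1)]
    using action.B.chain_map_pyramid[OF N(1)] by (simp add: prod_unit)
qed

end

text \<open>
  The unit has rank 0 and vanishes off the index 0. As a second factor it gives an object \<open>X \<circ> 0\<close> at
  every index with a nonzero coordinate after the first \<open>n\<close> ones. There \<open>X\<close> itself vanishes, and
  uniqueness of the zero object turns the isomorphism into an equality.
\<close>

context strict_monoidal_category
begin

lemma action_self: "strict_monoidal_action A TO TM U A TO TM"
  by unfold_locales (use TO_assoc TM_assoc TO_unit TM_unit in blast)+

lemma pobj_prod_unit:
  assumes "single_zero_object A" "is_pyramid A X"
  shows "kron_obj TO (prank X) (pobj X) (pobj (pyr_unit A U)) = pobj X"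
proof
  fix a
  let ?n = "prank X"
  note oX = pyramid_Obj[OF assms(2)]
  show "kron_obj TO ?n (pobj X) (pobj (pyr_unit A U)) a = pobj X a"
  proof (cases "\<sigma> ?n a = 0")
    case True
    then have "\<pi> ?n a = a" by (rule_tac idx_split_eqI[of ?n]) (auto intro: poly_mapping_eqI)
    then show ?thesis using True TO_unit(2)[OF oX] by (simp add: kron_obj_def)
  next
    case False
    then obtain i where "coord (\<sigma> ?n a) i \<noteq> 0" by (metis poly_mapping_eqI lookup_zero)
    then have "zero_object A (pobj X a)" by (intro pyramid_rank[OF assms(2), of "?n + i"]) simp_all
    moreover have "zero_object A (TO (pobj X (\<pi> ?n a)) (the_zero_object A))"
      by (rule FO_zero_right[OF oX single_zero_objectD(1)[OF assms(1)]])
    ultimately have "pobj X a = the_zero_object A"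
        "TO (pobj X (\<pi> ?n a)) (the_zero_object A) = the_zero_object A"
      using single_zero_objectD(2)[OF assms(1)] by blast+
    then show ?thesis using False by (simp add: kron_obj_def)
  qed
qed

lemma pyramid_nonzero_index:
  assumes "is_pyramid A X" "\<not> zero_object A (pobj X a)"
  shows "\<pi> (prank X) a = a" "\<sigma> (prank X) a = 0"
proof -
  have "coord a i = 0" if "prank X \<le> i" for i using pyramid_rank[OF assms(1) that] assms(2) by blast
  then show "\<pi> (prank X) a = a" "\<sigma> (prank X) a = 0"
    by (auto intro!: poly_mapping_eqI)
qed

lemma prod_unit_right:
  assumes "single_zero_object A" "is_pyramid A X"
  shows "pyr_prod_obj A A A TO TM X (pyr_unit A U) = X" (is "?P = X")
proof (rule pyr.equality)
  show pobj: "pobj ?P = pobj X" using pobj_prod_unit[OF assms] by simp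
  have P: "is_pyramid A ?P" by (rule is_pyramid_prod[OF assms(2) A.is_pyramid_unit[OF assms(1) U_closed]])
  show "pdiff ?P = pdiff X"
  proof (intro ext)
    fix a i
    note d = pyramid_diff[OF assms(2), of a i] pyramid_diff[OF P, of a i, unfolded pobj]
    show "pdiff ?P a i = pdiff X a i"
    proof (cases "zero_object A (pobj X a) \<or> zero_object A (pobj X (a + \<epsilon> i))")
      case True
      then show ?thesis using A.homset_zero_object[OF d(1)] A.homset_zero_object[OF d(2)] by simp
    next
      case False
      then have a: "\<pi> (prank X) a = a" "\<sigma> (prank X) a = 0"
        using pyramid_nonzero_index[OF assms(2)] by blast+
      have "i < prank X"
      proof (rule ccontr)
        assume i: "\<not> i < prank X"
        then have "coord a i = 0" using arg_cong[OF a(1), of "\<lambda>u. coord u i"] by simp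
        then have "zero_object A (pobj X (a + \<epsilon> i))"
          using i by (intro pyramid_rank[OF assms(2), of i]) (simp_all add: lookup_add)
        then show False using False by blast
      qed
      moreover have "pdiff X a i \<in> Arr A" using d(1) by (simp add: homset_iff)
      ultimately show ?thesis using a TM_unit(2) by (simp add: prod_diff)
    qed
  qed
qed simp_all

lemma prod_mor_unit_right:
  assumes "single_zero_object A" "\<alpha> \<in> homset (pyr_cat A) X X'"
  shows "pyr_prod_mor A A A TO TM \<alpha> (Idn (pyr_cat A) (pyr_unit A U)) = \<alpha>"
proof -
  obtain M where M: "chain_map A X X' M" "\<alpha> = pmor_of X X' M" using assms(2) by (rule A.pyr_homE)
  note pyr = A.chain_map_pyramid[OF M(1)] and unit = A.is_pyramid_unit[OF assms(1) U_closed]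
  note m = A.chain_map_hom[OF M(1)]
  let ?I = "Idn A.Fam (pobj (pyr_unit A U))"
  have K: "is_mat A (pobj X) (pobj X') (kron TM (prank X') (prank X) M ?I)"
    using kron_hom[OF m A.chain_map_hom[OF A.chain_map_Idn[OF unit]], of "prank X'" "prank X"]
    unfolding pobj_prod_unit[OF assms(1) pyr(1)] pobj_prod_unit[OF assms(1) pyr(2)] fam_hom .
  have "kron TM (prank X') (prank X) M ?I a b = M a b" for a b
  proof (cases "zero_object A (pobj X b) \<or> zero_object A (pobj X' a)")
    case True
    then show ?thesis
      using A.homset_zero_object[OF is_mat_hom[OF K]] A.homset_zero_object[OF is_mat_hom[OF m[unfolded fam_hom]]]
      by simp
  next
    case False
    moreover have "M a b \<in> Arr A" using is_mat_hom[OF m[unfolded fam_hom]] by (simp add: homset_iff)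
    ultimately show ?thesis
      using pyramid_nonzero_index[OF pyr(1)] pyramid_nonzero_index[OF pyr(2)] TM_unit(2)
      by (simp add: kron_def fam_Idn diag_mat_def)
  qed
  then have "kron TM (prank X') (prank X) M ?I = M" by (intro ext)
  then show ?thesis
    unfolding M(2) pyr_Idn prod_mor_chain_map[OF M(1) A.chain_map_Idn[OF unit]]
    using pyr by (simp add: prod_unit_right[OF assms(1)])
qed

lemma strict_monoidal_pyr_cat:
  assumes "single_zero_object A"
  shows "strict_monoidal_category (pyr_cat A) (pyr_prod_obj A A A TO TM) (pyr_prod_mor A A A TO TM) (pyr_unit A U)"
proof -
  interpret self: strict_monoidal_action A TO TM U A TO TM by (rule action_self)
  interpret pyr: additive_category "pyr_cat A" by (rule A.additive_pyr_cat)
  note hom = pyr.Arr_homset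
  show ?thesis
  proof (intro strict_monoidal_category.intro strict_monoidal_category_axioms.intro biadditive_pyr_prod)
    show "pyr_unit A U \<in> Obj (pyr_cat A)" by (simp add: A.is_pyramid_unit[OF assms U_closed])
  qed (use self.prod_assoc self.prod_mor_assoc[OF hom hom hom] self.prod_unit prod_unit_right[OF assms]
    self.prod_mor_unit[OF assms hom] prod_mor_unit_right[OF assms hom] in auto)
qed

end

lemma (in strict_monoidal_action) strict_monoidal_action_pyr_cat:
  assumes "single_zero_object A"
  shows "strict_monoidal_action (pyr_cat A) tprod (pyr_prod_mor A A A TO TM) (pyr_unit A U)
    (pyr_cat C) aprod (pyr_prod_mor A C C LO LM)"
proof -
  interpret pyrA: additive_category "pyr_cat A" by (rule A.additive_pyr_cat)
  interpret pyrC: additive_category "pyr_cat C" by (rule action.B.additive_pyr_cat)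
  note hom = pyrA.Arr_homset pyrC.Arr_homset
  show ?thesis
    by (intro strict_monoidal_action.intro strict_monoidal_action_axioms.intro
        strict_monoidal_pyr_cat[OF assms] action.biadditive_pyr_prod)
      (use prod_assoc prod_mor_assoc[OF hom(1) hom(1) hom(2)] prod_unit prod_mor_unit[OF assms hom(2)] in auto)
qed

theorem proposition6:
  fixes A :: "('a, 'f) cat" and TO :: "'a \<Rightarrow> 'a \<Rightarrow> 'a" and TM :: "'f \<Rightarrow> 'f \<Rightarrow> 'f" and U :: 'a
    and C :: "('c, 'g) cat" and LO :: "'a \<Rightarrow> 'c \<Rightarrow> 'c" and LM :: "'f \<Rightarrow> 'g \<Rightarrow> 'g"
  assumes "strict_monoidal_category A TO TM U"
    and "additive_category C"
    and "strict_monoidal_action A TO TM U C LO LM"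
    and "single_zero_object A"
    and "single_zero_object C"
  shows "strict_monoidal_action
           (pyr_cat A) (tens_obj A TO TM) (tens_mor A TO TM) (pyr_unit A U)
           (pyr_cat C) (star_obj A C LO LM) (star_mor A C LO LM) \<and>
         cat_ideal (pyr_cat A) (null_homotopic A) \<and>
         cat_ideal (pyr_cat C) (null_homotopic C) \<and>
         (\<forall>\<alpha>\<in>Arr (pyr_cat A). \<forall>\<beta>\<in>Arr (pyr_cat A).
           htp_op A (tens_mor A TO TM) (htp_class A \<alpha>) (htp_class A \<beta>)
             = htp_class A (tens_mor A TO TM \<alpha> \<beta>)) \<and>
         (\<forall>\<alpha>\<in>Arr (pyr_cat A). \<forall>\<beta>\<in>Arr (pyr_cat C).
           htp_op C (star_mor A C LO LM) (htp_class A \<alpha>) (htp_class C \<beta>)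
             = htp_class C (star_mor A C LO LM \<alpha> \<beta>)) \<and>
         strict_monoidal_action
           (htp_cat A) (tens_obj A TO TM) (htp_op A (tens_mor A TO TM)) (pyr_unit A U)
           (htp_cat C) (star_obj A C LO LM) (htp_op C (star_mor A C LO LM))"
proof -
  interpret strict_monoidal_action A TO TM U C LO LM by (rule assms(3))
  note T = biadditive_quotient_pyr_prod and L = action.biadditive_quotient_pyr_prod
  note act = strict_monoidal_action_pyr_cat[OF assms(4)]
  show ?thesis
    unfolding tens_obj_def tens_mor_def star_obj_def star_mor_def htp_cat_def htp_op_def htp_class_def
    by (intro conjI ballI act A.cat_ideal_null_homotopic action.B.cat_ideal_null_homotopic
        biadditive_quotient.quot_FM[OF T] biadditive_quotient.quot_FM[OF L]
        strict_monoidal_action_quot[OF act T L])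
qed

end
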